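(* Let $g_1(t),g_2(t)$, $t\in\mathbb{R}$, be two smooth families of non-trapping Riemannian metrics on $\mathbb{R}^n$, each a compactly supported (in spacetime) perturbation of the flat metric, with $g_i(t)=g_0$ if $|z|\ge R$ or $|t|\ge T$. Suppose $\mathfrak{Cl}_{g_1}$ is microlocally lens equivalent to $\mathfrak{Cl}_{g_2}$. Then $\ell_{g_1(t)}=\ell_{g_2(t)}$ (for all $t$).
   Context: Non-trapping: for each $t$, the geodesics of $g(t)$ leave every compact set in finite time. $g_0=\sum dz_i^2$; $(z,t)$ are coordinates on $\mathbb{R}^n\times\mathbb{R}$, with dual variables $(\zeta,\tau)$. Length: $\ell_{g_i(t)}$ sends an inward pointing unit covector $(z,v)$ at $z\in\partial B_R(0)$ to the length of the $g_i(t)$-geodesic segment starting from $(z,v)$ until it first exits $B_R(0)$. 1-cusp cotangent bundle: $X=\overline{\mathbb{R}^n}$ is the radial compactification of $\mathbb{R}^n_Z$, $x=1/|Z|$, $y=Z/|Z|$ near infinity. ${}^{\mathrm{1c}}T^*X$ is $T^*\mathbb{R}^n$ in the interior, with fibre coordinates $(\xi,\eta)$ near $\partial X$ given by writing covectors as $\xi\frac{dx}{x^3}+\eta\cdot\frac{dy}{x}$ (so $Z^*\cdot dZ$ has $\xi=-xZ^*\cdot y$ and $\eta=$ part of $Z^*$ orthogonal to $y$). Classical scattering map: for $(Z_-,Z_-^* )\in T^*\mathbb{R}^n$ take the bicharacteristic of $p=\tau+\sum g^{ij}(z,t)\zeta_i\zeta_j$ in $\{p=0\}$ which for $t\ll0$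 is $\zeta=Z_-$, $z=2tZ_--Z_-^*$; for $t\gg0$ it is $\zeta=Z_+$, $z=2tZ_+-Z_+^*$, and $\mathfrak{Cl}_g(Z_-,Z_-^* )=(Z_+,Z_+^* )$. This extends smoothly to the (fibre-compactified) 1-cusp cotangent bundle. Lens equivalence: let $X_b^2=[X\times X;\partial X\times\partial X]$ with $\sigma=x_1/x_2$, and let ${}^{\mathsf{L}\mathrm{1c}}T^*X_b^2$ be the pull-back to $X_b^2$ of $\overline{{}^{\mathrm{1c}}T^*X}\times\overline{{}^{\mathrm{1c}}T^*X}$, with coordinates $(x_1,\sigma,y_1,y_2,\xi_1,\xi_2,\eta_1,\eta_2)$ lifted from the left (1) and right (2) factors; $\tilde\beta_b$ is the projection to the product. The twisted graph is $\mathrm{Gr}(\mathfrak{Cl}_g)'=\{(x_1,y_1,\xi_1,\eta_1;x_2,y_2,\xi_2,\eta_2):(x_1,y_1,\xi_1,\eta_1)=\mathfrak{Cl}_g(x_2,y_2,-\xi_2,-\eta_2)\}$, and $\tilde\beta_b^*(\mathrm{Gr}(\mathfrak{Cl}_g)')$ is the closure of the preimage of its interior part; $\partial$ denotes intersection with the part over the front face $\{x_1=x_2=0\}$ of $X_b^2$. On $\tilde\beta_b^*(\mathrm{Gr}(\mathfrak{Cl}_g)')$ the function $N_1=\frac{\xi_1+\xi_2}{x_1}$ extends smoothly up to $x_1=0$. Let $\beta_{SJ}:[{}^{\mathsf{L}\mathrm{1c}}T^*X_b^2;J]\to{}^{\mathsf{L}\mathrm{1c}}T^*X_b^2$ be the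 blow-down map for the blow-up of $J=\{\xi_1+\xi_2=0,\ x_1=0\}$. $\mathfrak{Cl}_{g_1}$ is microlocally lens equivalent to $\mathfrak{Cl}_{g_2}$ if $\partial\beta_{SJ}^*\tilde\beta_b^*(\mathrm{Gr}(\mathfrak{Cl}_{g_1})')=\partial\beta_{SJ}^*\tilde\beta_b^*(\mathrm{Gr}(\mathfrak{Cl}_{g_2})')$; equivalently $\partial\tilde\beta_b^*(\mathrm{Gr}(\mathfrak{Cl}_{g_1})')=\partial\tilde\beta_b^*(\mathrm{Gr}(\mathfrak{Cl}_{g_2})')$ and the two functions $N_1$ coincide on this set. *)

theory Defs
  imports "HOL-Analysis.Analysis" "HOL-Library.Extended_Real" "HOL-Library.FuncSet"
begin

section \<open>Families of Riemannian metrics\<close>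

fun higher_differentiable ::
  "('a::real_normed_vector \<Rightarrow> 'b::real_normed_vector) \<Rightarrow> nat \<Rightarrow> bool" where
  "higher_differentiable f 0 \<longleftrightarrow> continuous_on UNIV f"
| "higher_differentiable f (Suc k) \<longleftrightarrow>
     (\<forall>x. f differentiable at x) \<and>
     (\<forall>v. higher_differentiable (\<lambda>x. frechet_derivative f (at x) v) k)"

definition smooth :: "('a::real_normed_vector \<Rightarrow> 'b::real_normed_vector) \<Rightarrow> bool" where
  "smooth f \<longleftrightarrow> (\<forall>k. higher_differentiable f k)"

text \<open>A metric on R^n is given by its matrix \<open>h z\<close> in the standard coordinates, a family of metrics
  by \<open>g t z\<close>. Vectors and covectors are both represented by their components, and the dual metric
  has the matrix \<open>matrix_inv (h z)\<close>.\<close>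

definition riemannian_metric :: "(real^'n \<Rightarrow> real^'n^'n) \<Rightarrow> bool" where
  "riemannian_metric h \<longleftrightarrow> smooth h \<and>
     (\<forall>z. transpose (h z) = h z \<and> (\<forall>v. v \<noteq> 0 \<longrightarrow> 0 < v \<bullet> (h z *v v)))"

definition smooth_metric_family :: "(real \<Rightarrow> real^'n \<Rightarrow> real^'n^'n) \<Rightarrow> bool" where
  "smooth_metric_family g \<longleftrightarrow>
     smooth (\<lambda>(t, z). g t z) \<and> (\<forall>t. riemannian_metric (g t))"

section \<open>Geodesics, the non-trapping condition and lengths\<close>

definition partial_deriv :: "'n \<Rightarrow> (real^'n \<Rightarrow> real) \<Rightarrow> real^'n \<Rightarrow> real" where
  "partial_deriv i f x = frechet_derivative f (at x) (axis i 1)"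

definition christoffel :: "(real^'n \<Rightarrow> real^'n^'n) \<Rightarrow> real^'n \<Rightarrow> 'n \<Rightarrow> 'n \<Rightarrow> 'n \<Rightarrow> real" where
  "christoffel h x k i j =
     (1/2) * (\<Sum>l\<in>UNIV. matrix_inv (h x) $ k $ l *
        (partial_deriv i (\<lambda>x. h x $ j $ l) x
       + partial_deriv j (\<lambda>x. h x $ i $ l) x
       - partial_deriv l (\<lambda>x. h x $ i $ j) x))"

definition velocity :: "(real \<Rightarrow> real^'n) \<Rightarrow> real \<Rightarrow> real^'n" where
  "velocity c s = vector_derivative c (at s)"

text \<open>Geodesics are taken to be defined on all of R: metrics that are Euclidean outside a compact
  set are complete, so that each geodesic extends.\<close>

definition geodesic :: "(real^'n \<Rightarrow> real^'n^'n) \<Rightarrow> (real \<Rightarrow> real^'n) \<Rightarrow> bool" where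
  "geodesic h c \<longleftrightarrow>
     (\<forall>s. c differentiable at s) \<and>
     (\<forall>s. (velocity c has_vector_derivative
        (\<chi> k. - (\<Sum>i\<in>UNIV. \<Sum>j\<in>UNIV.
            christoffel h (c s) k i j * velocity c s $ i * velocity c s $ j))) (at s))"

definition nontrapping :: "(real^'n \<Rightarrow> real^'n^'n) \<Rightarrow> bool" where
  "nontrapping h \<longleftrightarrow>
     (\<forall>c K. geodesic h c \<and> velocity c 0 \<noteq> 0 \<and> compact K \<longrightarrow>
        (\<forall>\<^sub>F s in at_top. c s \<notin> K))"

definition geodesic_from :: "(real^'n \<Rightarrow> real^'n^'n) \<Rightarrow> real^'n \<Rightarrow> real^'n \<Rightarrow> real \<Rightarrow> real^'n" where
  "geodesic_from h z v =
     (THE c. geodesic h c \<and> c 0 = z \<and> velocity c 0 = matrix_inv (h z) *v v)"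

definition exit_time :: "real \<Rightarrow> (real \<Rightarrow> real^'n) \<Rightarrow> real" where
  "exit_time R c = Inf {s. 0 < s \<and> c s \<notin> ball 0 R}"

definition curve_length ::
  "(real^'n \<Rightarrow> real^'n^'n) \<Rightarrow> (real \<Rightarrow> real^'n) \<Rightarrow> real \<Rightarrow> real \<Rightarrow> real" where
  "curve_length h c a b =
     integral {a..b} (\<lambda>s. sqrt (velocity c s \<bullet> (h (c s) *v velocity c s)))"

definition inward_unit_covectors ::
  "(real^'n \<Rightarrow> real^'n^'n) \<Rightarrow> real \<Rightarrow> ((real^'n) \<times> (real^'n)) set" where
  "inward_unit_covectors h R =
     {(z, v). z \<in> sphere 0 R \<and> v \<bullet> (matrix_inv (h z) *v v) = 1 \<and>
              (matrix_inv (h z) *v v) \<bullet> z < 0}"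

definition lens_length :: "(real^'n \<Rightarrow> real^'n^'n) \<Rightarrow> real \<Rightarrow> (real^'n) \<times> (real^'n) \<Rightarrow> real" where
  "lens_length h R =
     (\<lambda>(z, v)\<in>inward_unit_covectors h R.
        curve_length h (geodesic_from h z v) 0 (exit_time R (geodesic_from h z v)))"

section \<open>The classical scattering map\<close>

definition symbol_p ::
  "(real \<Rightarrow> real^'n \<Rightarrow> real^'n^'n) \<Rightarrow> real^'n \<Rightarrow> real \<Rightarrow> real^'n \<Rightarrow> real \<Rightarrow> real" where
  "symbol_p g z t \<zeta> \<tau> = \<tau> + \<zeta> \<bullet> (matrix_inv (g t z) *v \<zeta>)"

definition grad :: "(real^'n \<Rightarrow> real) \<Rightarrow> real^'n \<Rightarrow> real^'n" where
  "grad f x = (\<chi> i. partial_deriv i f x)"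

definition null_bicharacteristic ::
  "(real \<Rightarrow> real^'n \<Rightarrow> real^'n^'n) \<Rightarrow>
     (real \<Rightarrow> real^'n) \<Rightarrow> (real \<Rightarrow> real) \<Rightarrow> (real \<Rightarrow> real^'n) \<Rightarrow> (real \<Rightarrow> real) \<Rightarrow> bool" where
  "null_bicharacteristic g z t \<zeta> \<tau> \<longleftrightarrow>
     (\<forall>s. symbol_p g (z s) (t s) (\<zeta> s) (\<tau> s) = 0 \<and>
       (z has_vector_derivative   grad (\<lambda>w. symbol_p g (z s) (t s) w (\<tau> s)) (\<zeta> s)) (at s) \<and>
       (\<zeta> has_vector_derivative - grad (\<lambda>w. symbol_p g w (t s) (\<zeta> s) (\<tau> s)) (z s)) (at s) \<and>
       (t has_real_derivative   deriv (\<lambda>r. symbol_p g (z s) (t s) (\<zeta> s) r) (\<tau> s)) (at s) \<and>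
       (\<tau> has_real_derivative - deriv (\<lambda>r. symbol_p g (z s) r (\<zeta> s) (\<tau> s)) (t s)) (at s))"

text \<open>Along a bicharacteristic dt/ds = 1, so that the regimes of very negative and very positive
  time are those of very negative and very positive parameter.
  Points of T*R^n are pairs \<open>(Z, Z')\<close>, with \<open>Z\<close> the base point and \<open>Z'\<close> the covector; \<open>Z\<close> is the
  asymptotic momentum, and \<open>- Z'\<close> the position at time 0 of the corresponding free motion.\<close>

definition scatters_to ::
  "(real \<Rightarrow> real^'n \<Rightarrow> real^'n^'n) \<Rightarrow> (real^'n) \<times> (real^'n) \<Rightarrow> (real^'n) \<times> (real^'n) \<Rightarrow> bool" where
  "scatters_to g w_in w_out \<longleftrightarrow>
     (\<exists>z t \<zeta> \<tau>. null_bicharacteristic g z t \<zeta> \<tau> \<and>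
       (\<forall>\<^sub>F s in at_bot. \<zeta> s = fst w_in \<and> z s = (2 * t s) *\<^sub>R fst w_in - snd w_in) \<and>
       (\<forall>\<^sub>F s in at_top. \<zeta> s = fst w_out \<and> z s = (2 * t s) *\<^sub>R fst w_out - snd w_out))"

definition scattering_map ::
  "(real \<Rightarrow> real^'n \<Rightarrow> real^'n^'n) \<Rightarrow> (real^'n) \<times> (real^'n) \<Rightarrow> (real^'n) \<times> (real^'n)" where
  "scattering_map g w_in = (THE w_out. scatters_to g w_in w_out)"

section \<open>The 1-cusp cotangent bundle and lens equivalence\<close>

definition bdf :: "(real^'n) \<times> (real^'n) \<Rightarrow> real" where
  "bdf w = 1 / norm (fst w)"

definition angle :: "(real^'n) \<times> (real^'n) \<Rightarrow> real^'n" where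
  "angle w = fst w /\<^sub>R norm (fst w)"

definition xi_1c :: "(real^'n) \<times> (real^'n) \<Rightarrow> real" where
  "xi_1c w = - bdf w * (snd w \<bullet> angle w)"

definition eta_1c :: "(real^'n) \<times> (real^'n) \<Rightarrow> real^'n" where
  "eta_1c w = snd w - (snd w \<bullet> angle w) *\<^sub>R angle w"

text \<open>Only neighbourhoods of boundaries at infinity matter below, so that it suffices to describe
  the part of the 1-cusp cotangent bundle over \<open>Z \<noteq> 0\<close>, where the coordinates \<open>(x, y, \<xi>, \<eta>)\<close> are
  defined with \<open>x = 1 / |Z|\<close>. Each fibre, the space of all \<open>(\<xi>, \<eta>)\<close> with \<open>\<eta>\<close> orthogonal to \<open>y\<close>, is
  compactified radially: it is the open unit ball, and the unit sphere is fibre infinity. Hence the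
  fibre-compactified bundle over \<open>Z \<noteq> 0\<close> is the set of \<open>(x, y, q)\<close> with \<open>0 \<le> x\<close>, \<open>|y| = 1\<close>,
  \<open>q\<close> in R times the orthogonal complement of \<open>y\<close>, and \<open>|q| \<le> 1\<close>; its boundary over infinity
  is \<open>x = 0\<close>.\<close>

type_synonym 'n cotangent_1c = "real \<times> (real^'n) \<times> (real \<times> (real^'n))"

definition radial :: "'a::real_normed_vector \<Rightarrow> 'a" where
  "radial q = q /\<^sub>R sqrt (1 + (norm q)\<^sup>2)"

definition coords_1c :: "(real^'n) \<times> (real^'n) \<Rightarrow> 'n cotangent_1c" where
  "coords_1c w = (bdf w, angle w, radial (xi_1c w, eta_1c w))"

text \<open>The blow-up of the corner \<open>x\<^sub>1 = x\<^sub>2 = 0\<close> is realised as the closure of the graph of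
  \<open>\<sigma> = x\<^sub>1 / x\<^sub>2\<close>, which takes values in the extended reals (in \<open>[0, \<infinity>]\<close>), over the complement of
  the corner; the front face is the part over the corner.\<close>

type_synonym 'n lens_1c = "'n cotangent_1c \<times> 'n cotangent_1c \<times> ereal"

definition lift_b :: "((real^'n) \<times> (real^'n)) \<times> ((real^'n) \<times> (real^'n)) \<Rightarrow> 'n lens_1c" where
  "lift_b = (\<lambda>(w1, w2). (coords_1c w1, coords_1c w2, ereal (bdf w1 / bdf w2)))"

definition over_front_face :: "'n lens_1c \<Rightarrow> bool" where
  "over_front_face = (\<lambda>((x1, _), (x2, _), _). x1 = 0 \<and> x2 = 0)"

definition N1 :: "((real^'n) \<times> (real^'n)) \<times> ((real^'n) \<times> (real^'n)) \<Rightarrow> real" where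
  "N1 = (\<lambda>(w1, w2). (xi_1c w1 + xi_1c w2) / bdf w1)"

text \<open>Since \<open>\<xi>\<close> and \<open>\<eta>\<close> are linear in the covector, changing the sign of \<open>(\<xi>\<^sub>2, \<eta>\<^sub>2)\<close> is changing
  the sign of the covector.\<close>

definition twisted_graph ::
  "(real \<Rightarrow> real^'n \<Rightarrow> real^'n^'n) \<Rightarrow> (((real^'n) \<times> (real^'n)) \<times> ((real^'n) \<times> (real^'n))) set" where
  "twisted_graph g = {(w1, w2). w1 = scattering_map g (fst w2, - snd w2)}"

text \<open>The blow-up of \<open>J = {\<xi>\<^sub>1 + \<xi>\<^sub>2 = 0, x\<^sub>1 = 0}\<close> replaces a point of \<open>J\<close> by the half-circle of
  directions \<open>[x\<^sub>1 : \<xi>\<^sub>1 + \<xi>\<^sub>2]\<close> with \<open>x\<^sub>1 \<ge> 0\<close>, parametrised by \<open>(\<xi>\<^sub>1 + \<xi>\<^sub>2) / x\<^sub>1\<close> in the extended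
  reals. So a subset of the interior is lifted by taking the closure of the graph of this function
  over it. The result below is the part over the front face of the lift of the twisted graph.\<close>

definition boundary_lift ::
  "(real \<Rightarrow> real^'n \<Rightarrow> real^'n^'n) \<Rightarrow> ('n lens_1c \<times> ereal) set" where
  "boundary_lift g =
     closure ((\<lambda>q. (lift_b q, ereal (N1 q))) `
       {(w1, w2) \<in> twisted_graph g. fst w1 \<noteq> 0 \<and> fst w2 \<noteq> 0})
     \<inter> {(q, N). over_front_face q}"

definition microlocally_lens_equivalent ::
  "(real \<Rightarrow> real^'n \<Rightarrow> real^'n^'n) \<Rightarrow> (real \<Rightarrow> real^'n \<Rightarrow> real^'n^'n) \<Rightarrow> bool" where
  "microlocally_lens_equivalent g1 g2 \<longleftrightarrow> boundary_lift g1 = boundary_lift g2"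

end

theory Submission
  imports Defs
begin

text \<open>Rescale a bicharacteristic with large incoming momentum \<open>Z\<close> by \<open>\<epsilon> = 1 / (2 * \<bar>Z\<bar>)\<close>: with
  \<open>s = \<epsilon> r\<close> and \<open>\<theta> = 2 * \<epsilon> * \<zeta>\<close> it solves \<open>z' = A \<theta>\<close>, \<open>\<theta>' = force / 2\<close> at time \<open>t = t0 + \<epsilon> r\<close>, where
  \<open>A\<close> is the dual metric. At \<open>\<epsilon> = 0\<close> these are the geodesic equations of \<open>g t0\<close>, so that by continuous
  dependence on \<open>\<epsilon>\<close> and on the initial data the scattered rays converge to the geodesic with
  the same incoming line. If that geodesic enters the ball at \<open>z0\<close> in direction \<open>y0\<close> and leaves it
  after length \<open>l\<close> at \<open>z1\<close> in direction \<open>y1\<close>, the limit in the lifted twisted graph is the point with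
  \<open>\<xi>\<^sub>2 = - \<xi>\<^sub>1 = 2 * t0\<close>, with \<open>\<eta>\<^sub>2\<close> and \<open>- \<eta>\<^sub>1\<close> the parts of \<open>z0\<close> and \<open>z1\<close> orthogonal to \<open>y0\<close> and \<open>y1\<close>, and
  with \<open>N1 = z1 \<bullet> y1 - z0 \<bullet> y0 - l\<close>. Conversely any sequence in the other graph converging to this
  point has the same incoming data, hence converges to the point of the other geodesic. As
  \<open>\<bar>z1\<bar> = R\<close> and \<open>z1 \<bullet> y1 \<ge> 0\<close>, \<open>\<eta>\<^sub>1\<close> determines \<open>z1 \<bullet> y1\<close>, and then \<open>N1\<close> determines \<open>l\<close>.\<close>

section \<open>Global solutions of Lipschitz differential equations\<close>

text \<open>The field is quadratic in the momentum and the metric depends on time, so neither a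
  global Lipschitz bound nor conservation of energy is at hand. Flatness at large times gives a
  momentum bound uniform in time and in \<epsilon>; the momentum can then be cut off at a large
  radius without changing the rays in question, and existence, uniqueness and continuous dependence
  all come from one globally Lipschitz field. A scattered ray is known as soon as it is outside the
  ball and moving outward at one single time. In strict form this passes from the geodesic to all
  nearby rays, so only rays close to a geodesic have to be followed. The length sits in
  \<open>N1\<close> for the following reason: \<open>- xi_1c w / 2\<close> is the time at which the
  free motion of \<open>w\<close> is closest to the origin. Hence \<xi>1 + \<xi>2 is minus twice the
  delay between the closest approaches of the incoming and the outgoing line. Time is
  \<open>t0\<close> + \<epsilon> r with \<epsilon> of the order of the boundary defining function,
  so the delay vanishes in the limit; division by x1 turns it back into a difference of values of r,
  that is, into a distance travelled at unit speed.\<close>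

lemma has_vector_derivative_affine:
  assumes "(x has_vector_derivative d) (at (a * t + b))"
  shows "((\<lambda>t. x (a * t + b)) has_vector_derivative a *\<^sub>R d) (at t)"
proof -
  have "((\<lambda>t. a * t + b) has_vector_derivative a) (at t)"
    by (auto intro!: derivative_eq_intros simp: has_real_derivative_iff_has_vector_derivative[symmetric])
  from vector_diff_chain_at[OF this assms] show ?thesis by (simp add: o_def)
qed

text \<open>The hypothesis bounds the absolute value of the derivative, so the estimate runs in both
  directions of time: the weight exp(- K t) makes \<phi> nonincreasing, the weight exp(K t) makes it
  nondecreasing.\<close>

lemma gronwall:
  fixes \<phi> \<phi>' :: "real \<Rightarrow> real"
  assumes d: "\<And>u. u \<in> closed_segment s t \<Longrightarrow> (\<phi> has_real_derivative \<phi>' u) (at u)"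
    and b: "\<And>u. u \<in> closed_segment s t \<Longrightarrow> \<bar>\<phi>' u\<bar> \<le> K * \<phi> u"
  shows "\<phi> t \<le> \<phi> s * exp (K * \<bar>t - s\<bar>)"
proof (cases "s \<le> t")
  case True
  have "\<phi> t * exp (- (K * t)) \<le> \<phi> s * exp (- (K * s))"
  proof (rule DERIV_nonpos_imp_nonincreasing[OF True])
    fix u assume "s \<le> u" "u \<le> t"
    then have u: "u \<in> closed_segment s t" by (simp add: closed_segment_eq_real_ivl)
    show "\<exists>y. ((\<lambda>t. \<phi> t * exp (- (K * t))) has_real_derivative y) (at u) \<and> y \<le> 0"
      by (rule exI[of _ "(\<phi>' u - K * \<phi> u) * exp (- (K * u))"])
        (use b[OF u] in \<open>auto intro!: derivative_eq_intros d[OF u] mult_nonpos_nonneg simp: algebra_simps\<close>)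
  qed
  then have "\<phi> t * exp (- (K * t)) * exp (K * t) \<le> \<phi> s * exp (- (K * s)) * exp (K * t)" by simp
  then show ?thesis using True
    by (simp add: mult.assoc flip: exp_add) (simp add: algebra_simps)
next
  case False
  then have "t \<le> s" by simp
  have "\<phi> t * exp (K * t) \<le> \<phi> s * exp (K * s)"
  proof (rule DERIV_nonneg_imp_nondecreasing[OF \<open>t \<le> s\<close>])
    fix u assume "t \<le> u" "u \<le> s"
    then have u: "u \<in> closed_segment s t" by (simp add: closed_segment_eq_real_ivl)
    have "0 \<le> (\<phi>' u + K * \<phi> u) * exp (K * u)" using b[OF u] by simp
    then show "\<exists>y. ((\<lambda>t. \<phi> t * exp (K * t)) has_real_derivative y) (at u) \<and> 0 \<le> y"
      by (intro exI[of _ "(\<phi>' u + K * \<phi> u) * exp (K * u)"] conjI)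
        (auto intro!: derivative_eq_intros d[OF u] simp: algebra_simps)
  qed
  then have "\<phi> t * exp (K * t) * exp (- (K * t)) \<le> \<phi> s * exp (K * s) * exp (- (K * t))" by simp
  then show ?thesis using False
    by (simp add: mult.assoc flip: exp_add) (simp add: algebra_simps)
qed

text \<open>Gronwall is applied to the squared distance, which stays differentiable where the curves
  meet; this costs the factor 2 in the rate, which the square root removes. The curves are solutions
  only on the segment because a straight line will later be compared with a ray on just the part
  that lies outside the ball.\<close>

lemma ode_dependence:
  fixes x y :: "real \<Rightarrow> 'a::real_inner"
  assumes L: "\<And>a b. norm (f a - f b) \<le> L * norm (a - b)"
    and x: "\<And>u. u \<in> closed_segment s t' \<Longrightarrow> (x has_vector_derivative f (x u)) (at u)"
    and y: "\<And>u. u \<in> closed_segment s t' \<Longrightarrow> (y has_vector_derivative f (y u)) (at u)"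
  shows "norm (x t' - y t') \<le> norm (x s - y s) * exp (L * \<bar>t' - s\<bar>)"
proof -
  define \<phi> where "\<phi> t = (x t - y t) \<bullet> (x t - y t)" for t
  have "\<phi> t' \<le> \<phi> s * exp ((2*L) * \<bar>t' - s\<bar>)"
  proof (rule gronwall)
    fix t assume t: "t \<in> closed_segment s t'"
    show "(\<phi> has_real_derivative 2 * ((x t - y t) \<bullet> (f (x t) - f (y t)))) (at t)"
      unfolding \<phi>_def has_field_derivative_def
      by (rule derivative_eq_intros x[OF t, unfolded has_vector_derivative_def] y[OF t, unfolded has_vector_derivative_def] refl)+
        (auto simp: algebra_simps inner_commute)
    have "\<bar>(x t - y t) \<bullet> (f (x t) - f (y t))\<bar> \<le> norm (x t - y t) * (L * norm (x t - y t))"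
      by (rule order_trans[OF Cauchy_Schwarz_ineq2]) (intro mult_left_mono L, simp)
    then show "\<bar>2 * ((x t - y t) \<bullet> (f (x t) - f (y t)))\<bar> \<le> 2 * L * \<phi> t"
      by (simp add: \<phi>_def abs_mult power2_norm_eq_inner[symmetric] power2_eq_square algebra_simps)
  qed
  also have "exp ((2*L) * \<bar>t' - s\<bar>) = (exp (L * \<bar>t' - s\<bar>))\<^sup>2"
    by (simp add: mult.assoc exp_double)
  finally have "(norm (x t' - y t'))\<^sup>2 \<le> (norm (x s - y s) * exp (L * \<bar>t' - s\<bar>))\<^sup>2"
    by (simp add: \<phi>_def power2_norm_eq_inner[symmetric] power_mult_distrib)
  then show ?thesis by (rule power2_le_imp_le) simp
qed

text \<open>The case distinction is the sign convention for oriented integrals: an integral over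
  \<open>{a..b}\<close> with b < a is 0, not minus the reversed one.\<close>

definition primitive :: "(real \<Rightarrow> 'a::banach) \<Rightarrow> real \<Rightarrow> 'a" where
  "primitive h t = (if 0 \<le> t then integral {0..t} h else - integral {t..0} h)"

lemma primitive_0 [simp]: "primitive h 0 = 0"
  by (simp add: primitive_def)

lemma primitive_has_vector_derivative:
  assumes "continuous_on UNIV h"
  shows "(primitive h has_vector_derivative h t) (at t)"
proof -
  define N where "N = \<bar>t\<bar> + 1"
  have c: "continuous_on S h" for S using assms continuous_on_subset by blast
  have i: "h integrable_on {a..b}" for a b by (intro integrable_continuous_real c)
  have "((\<lambda>u. integral {-N..u} h) has_vector_derivative h t) (at t within {-N..N})"
    by (rule integral_has_vector_derivative[OF c]) (auto simp: N_def)
  moreover have "t \<in> interior {-N..N}" by (auto simp: N_def interior_atLeastAtMost_real)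
  ultimately have "((\<lambda>u. integral {-N..u} h) has_vector_derivative h t) (at t)"
    using at_within_interior by metis
  then have "((\<lambda>u. integral {-N..u} h - integral {-N..0} h) has_vector_derivative h t) (at t)"
    by (auto intro!: derivative_eq_intros)
  then show ?thesis
  proof (rule has_vector_derivative_transform_within_open[where S="{-N<..<N}"])
    fix u assume u: "u \<in> {-N<..<N}"
    show "integral {-N..u} h - integral {-N..0} h = primitive h u"
    proof (cases "0 \<le> u")
      case True
      then have "integral {-N..0} h + integral {0..u} h = integral {-N..u} h"
        using u by (intro Henstock_Kurzweil_Integration.integral_combine i) (auto simp: N_def)
      then show ?thesis using True by (simp add: primitive_def algebra_simps)
    next
      case False
      then have "integral {-N..u} h + integral {u..0} h = integral {-N..0} h"
        using u by (intro Henstock_Kurzweil_Integration.integral_combine i) auto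
      then show ?thesis using False by (simp add: primitive_def algebra_simps)
    qed
  qed (auto simp: N_def)
qed

text \<open>Integrating the weight gains the factor 1/k, which is what makes the Picard operator
  contract.\<close>

lemma primitive_exp_bound:
  fixes h :: "real \<Rightarrow> 'a::banach"
  assumes h: "continuous_on UNIV h" and k: "0 < k" and b: "\<And>s. norm (h s) \<le> C * exp (k * \<bar>s\<bar>)"
  shows "norm (primitive h t) \<le> C / k * exp (k * \<bar>t\<bar>)"
proof -
  have c: "continuous_on S h" for S using h continuous_on_subset by blast
  have C: "0 \<le> C" using b[of 0] norm_ge_zero[of "h 0"] by (simp del: norm_ge_zero)
  have ex: "((\<lambda>s. C * exp (\<sigma> * k * s)) has_integral
      (C / (\<sigma> * k) * exp (\<sigma> * k * b) - C / (\<sigma> * k) * exp (\<sigma> * k * a))) {a..b}"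
    if "a \<le> b" "\<sigma> \<noteq> 0" for a b \<sigma> :: real
    by (rule fundamental_theorem_of_calculus[OF that(1)])
      (use k that in \<open>auto intro!: derivative_eq_intros simp: has_real_derivative_iff_has_vector_derivative[symmetric]\<close>)
  show ?thesis
  proof (cases "0 \<le> t")
    case True
    have "norm (integral {0..t} h) \<le> integral {0..t} (\<lambda>s. C * exp (1 * k * s))"
      using b by (intro integral_norm_bound_integral integrable_continuous_real c continuous_intros)
        (metis abs_of_nonneg atLeastAtMost_iff mult_1)
    also have "\<dots> \<le> C / k * exp (k * \<bar>t\<bar>)"
      using integral_unique[OF ex[OF True, of 1]] True C k by simp
    finally show ?thesis using True by (simp add: primitive_def)
  next
    case False
    have "norm (integral {t..0} h) \<le> integral {t..0} (\<lambda>s. C * exp (-1 * k * s))"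
      using b by (intro integral_norm_bound_integral integrable_continuous_real c continuous_intros)
        (metis abs_of_nonpos atLeastAtMost_iff mult_minus_left mult_minus_right mult_1)
    also have "\<dots> \<le> C / k * exp (k * \<bar>t\<bar>)"
      using integral_unique[OF ex[of t 0 "-1"]] False C k by simp
    finally show ?thesis using False by (simp add: primitive_def)
  qed
qed

lemma primitive_diff:
  assumes "continuous_on UNIV f" "continuous_on UNIV h"
  shows "primitive (\<lambda>s. f s - h s) t = primitive f t - primitive h t"
proof -
  have "f integrable_on {a..b}" "h integrable_on {a..b}" for a b
    using assms by (auto intro!: integrable_continuous_real intro: continuous_on_subset)
  then show ?thesis by (simp add: primitive_def Henstock_Kurzweil_Integration.integral_diff)
qed

text \<open>The Picard operator is a contraction for the supremum norm weighted by
  \<open>exp (- k * \<bar>t\<bar>)\<close> as soon as \<open>k\<close> exceeds the Lipschitz constant.\<close>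

lemma ode_global_solution:
  fixes f :: "'a::banach \<Rightarrow> 'a"
  assumes L: "\<And>a b. norm (f a - f b) \<le> L * norm (a - b)"
  obtains x where "x s = x0" "\<And>t. (x has_vector_derivative f (x t)) (at t)"
proof -
  \<comment> \<open>This makes the contraction ratio \<bar>L\<bar> / k less than 1/2 and keeps k
    positive when L = 0.\<close>
  define k where "k = 2 * \<bar>L\<bar> + 1"
  have k: "0 < k" by (simp add: k_def)
  have L': "norm (f a - f b) \<le> \<bar>L\<bar> * norm (a - b)" for a b
    by (rule order_trans[OF L]) (auto intro: mult_right_mono)
  have cf: "continuous_on UNIV f"
  proof -
    have "\<bar>L\<bar>-lipschitz_on UNIV f"
      by (rule lipschitz_onI) (use L' in \<open>auto simp: dist_norm\<close>)
    then show ?thesis by (rule lipschitz_on_continuous_on)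
  qed
  \<comment> \<open>Here u is the deviation from \<open>x0\<close> divided by the weight. Solutions
    may grow exponentially, but u is bounded, so the fixed point is sought in the complete space of
    bounded continuous functions.\<close>
  define E where "E u t = f (x0 + exp (k * \<bar>t\<bar>) *\<^sub>R apply_bcontfun u t)" for u :: "real \<Rightarrow>\<^sub>C 'a" and t
  define P where "P u t = exp (- (k * \<bar>t\<bar>)) *\<^sub>R primitive (E u) t" for u t
  have cE: "continuous_on UNIV (E u)" for u
    unfolding E_def by (rule continuous_on_compose2[OF cf]) (auto intro!: continuous_intros)
  have cP: "continuous_on UNIV (P u)" for u
    unfolding P_def
    by (intro continuous_intros continuous_at_imp_continuous_on ballI
        has_vector_derivative_continuous[OF primitive_has_vector_derivative[OF cE]])
  have Ebd: "norm (E u t) \<le> (norm (f x0) + \<bar>L\<bar> * norm u) * exp (k * \<bar>t\<bar>)" for u t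
  proof -
    have "norm (E u t) \<le> norm (f x0) + norm (E u t - f x0)"
      by (metis add.commute diff_add_cancel norm_triangle_ineq)
    also have "norm (E u t - f x0) \<le> \<bar>L\<bar> * (exp (k * \<bar>t\<bar>) * norm (apply_bcontfun u t))"
      using L'[of "x0 + exp (k * \<bar>t\<bar>) *\<^sub>R apply_bcontfun u t" x0] by (simp add: E_def)
    also have "\<dots> \<le> \<bar>L\<bar> * norm u * exp (k * \<bar>t\<bar>)"
      using mult_left_mono[OF norm_bounded[of u t], of "\<bar>L\<bar> * exp (k * \<bar>t\<bar>)"] by (simp add: mult_ac)
    also have "norm (f x0) \<le> norm (f x0) * exp (k * \<bar>t\<bar>)"
      using k by (intro mult_le_cancel_left1[THEN iffD2]) auto
    finally show ?thesis by (simp add: algebra_simps)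
  qed
  have Pbd: "norm (P u t) \<le> (norm (f x0) + \<bar>L\<bar> * norm u) / k" for u t
  proof -
    have "norm (P u t) \<le> exp (- (k * \<bar>t\<bar>)) * ((norm (f x0) + \<bar>L\<bar> * norm u) / k * exp (k * \<bar>t\<bar>))"
      using mult_left_mono[OF primitive_exp_bound[OF cE k Ebd], of "exp (- (k * \<bar>t\<bar>))" u t]
      by (simp add: P_def)
    also have "\<dots> = (norm (f x0) + \<bar>L\<bar> * norm u) / k"
      by (simp add: exp_minus)
    finally show ?thesis .
  qed
  define Q where "Q u = Bcontfun (P u)" for u
  have Q: "apply_bcontfun (Q u) = P u" for u
    unfolding Q_def by (intro Bcontfun_inverse bcontfun_normI[OF cP Pbd])
  have "\<exists>!u. Q u = u"
  proof (rule banach_fix_type[of "\<bar>L\<bar>/k"])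
    show "0 \<le> \<bar>L\<bar>/k" "\<bar>L\<bar>/k < 1" by (auto simp: k_def)
    show "\<forall>u v. dist (Q u) (Q v) \<le> \<bar>L\<bar>/k * dist u v"
    proof (intro allI dist_bound)
      fix u v t
      have "norm (E u s - E v s) \<le> (\<bar>L\<bar> * dist u v) * exp (k * \<bar>s\<bar>)" for s
      proof -
        have "norm (E u s - E v s) \<le> \<bar>L\<bar> * (exp (k * \<bar>s\<bar>) * dist (apply_bcontfun u s) (apply_bcontfun v s))"
          unfolding E_def by (rule order_trans[OF L']) (simp add: dist_norm flip: scaleR_diff_right)
        also have "\<dots> \<le> \<bar>L\<bar> * (exp (k * \<bar>s\<bar>) * dist u v)"
          by (intro mult_left_mono dist_bounded) auto
        finally show ?thesis by (simp add: mult_ac)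
      qed
      then have "norm (primitive (\<lambda>s. E u s - E v s) t) \<le> (\<bar>L\<bar> * dist u v) / k * exp (k * \<bar>t\<bar>)"
        by (intro primitive_exp_bound k continuous_intros cE)
      then have "norm (P u t - P v t) \<le> exp (- (k * \<bar>t\<bar>)) * ((\<bar>L\<bar> * dist u v) / k * exp (k * \<bar>t\<bar>))"
        by (simp add: P_def primitive_diff cE flip: scaleR_diff_right del: mult_le_cancel_left_pos times_divide_eq_left times_divide_eq_right)
      also have "\<dots> = \<bar>L\<bar> / k * dist u v"
        by (simp add: exp_minus)
      finally show "dist (apply_bcontfun (Q u) t) (apply_bcontfun (Q v) t) \<le> \<bar>L\<bar>/k * dist u v"
        by (simp add: Q dist_norm)
    qed
  qed
  then obtain u where u: "Q u = u" by blast
  define x where "x t = x0 + primitive (E u) t" for t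
  have "x t = x0 + exp (k * \<bar>t\<bar>) *\<^sub>R apply_bcontfun u t" for t
  proof -
    have "apply_bcontfun u t = exp (- (k * \<bar>t\<bar>)) *\<^sub>R primitive (E u) t"
      using Q[of u] by (simp add: u P_def)
    then show ?thesis by (simp add: x_def flip: exp_add)
  qed
  then have "E u t = f (x t)" for t by (simp add: E_def)
  then have "(x has_vector_derivative f (x t)) (at t)" for t
    unfolding x_def using primitive_has_vector_derivative[OF cE, of u t]
    by (auto intro!: derivative_eq_intros)
  \<comment> \<open>The equation is autonomous, so the solution found for initial time 0 is
    translated to initial time s.\<close>
  then have "((\<lambda>t. x (t - s)) has_vector_derivative f (x (t - s))) (at t)" for t
    using has_vector_derivative_affine[of x "f (x (t - s))" 1 t "- s"] by simp
  then show ?thesis by (rule that[rotated]) (simp add: x_def)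
qed

section \<open>Bounded Lipschitz functions\<close>

text \<open>Boundedness is part of the notion so that it is stable under products: a product of
  Lipschitz functions is in general not Lipschitz unless the factors are bounded.\<close>

definition bounded_lipschitz :: "('a::real_normed_vector \<Rightarrow> 'b::real_normed_vector) \<Rightarrow> bool" where
  "bounded_lipschitz f \<longleftrightarrow>
     (\<exists>C. \<forall>x. norm (f x) \<le> C) \<and> (\<exists>L. \<forall>x y. norm (f x - f y) \<le> L * norm (x - y))"

lemma bounded_lipschitzI:
  assumes "\<And>x. norm (f x) \<le> C" "\<And>x y. norm (f x - f y) \<le> L * norm (x - y)"
  shows "bounded_lipschitz f"
  using assms unfolding bounded_lipschitz_def by blast

lemma bounded_lipschitzE:
  assumes "bounded_lipschitz f"
  obtains C L where "0 \<le> C" "0 \<le> L" "\<And>x. norm (f x) \<le> C" "\<And>x y. norm (f x - f y) \<le> L * norm (x - y)"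
proof -
  obtain C L where *: "\<And>x. norm (f x) \<le> C" "\<And>x y. norm (f x - f y) \<le> L * norm (x - y)"
    using assms unfolding bounded_lipschitz_def by blast
  have "0 \<le> C" using *(1)[of 0] norm_ge_zero order_trans by blast
  moreover have "norm (f x - f y) \<le> \<bar>L\<bar> * norm (x - y)" for x y
    using *(2)[of x y] by (rule order_trans) (auto intro: mult_right_mono)
  ultimately show ?thesis using * that[of C "\<bar>L\<bar>"] by simp
qed

lemma bounded_lipschitz_const: "bounded_lipschitz (\<lambda>x. c)"
  by (rule bounded_lipschitzI[of _ "norm c" 0]) auto

lemma bounded_lipschitz_add:
  assumes "bounded_lipschitz f" "bounded_lipschitz h"
  shows "bounded_lipschitz (\<lambda>x. f x + h x)"
proof -
  obtain C L C' L' where "\<And>x. norm (f x) \<le> C" "\<And>x y. norm (f x - f y) \<le> L * norm (x - y)"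
    "\<And>x. norm (h x) \<le> C'" "\<And>x y. norm (h x - h y) \<le> L' * norm (x - y)"
    using assms unfolding bounded_lipschitz_def by blast
  then show ?thesis
    by (intro bounded_lipschitzI[of _ "C + C'" "L + L'"])
      (auto simp: add_diff_add distrib_right intro!: norm_triangle_le add_mono)
qed

lemma bounded_lipschitz_sum:
  assumes "\<And>i. i \<in> I \<Longrightarrow> bounded_lipschitz (f i)"
  shows "bounded_lipschitz (\<lambda>x. \<Sum>i\<in>I. f i x)"
  using assms
  by (induction I rule: infinite_finite_induct)
    (auto intro!: bounded_lipschitz_add bounded_lipschitz_const)

lemma bounded_lipschitz_linear:
  assumes "bounded_linear h" "bounded_lipschitz f"
  shows "bounded_lipschitz (\<lambda>x. h (f x))"
proof -
  interpret bounded_linear h by fact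
  obtain K where K: "0 \<le> K" "\<And>x. norm (h x) \<le> norm x * K" using nonneg_bounded by blast
  obtain C L where *: "\<And>x. norm (f x) \<le> C" "\<And>x y. norm (f x - f y) \<le> L * norm (x - y)"
    using assms(2) unfolding bounded_lipschitz_def by blast
  show ?thesis
  proof (rule bounded_lipschitzI)
    show "norm (h (f x)) \<le> C * K" for x
      using order_trans[OF K(2) mult_right_mono[OF *(1) K(1)]] .
    show "norm (h (f x) - h (f y)) \<le> (L * K) * norm (x - y)" for x y
      using order_trans[OF K(2) mult_right_mono[OF *(2) K(1)], of x y] by (simp add: diff mult_ac)
  qed
qed

lemma bounded_lipschitz_prod:
  assumes "bounded_bilinear p" "bounded_lipschitz f" "bounded_lipschitz h"
  shows "bounded_lipschitz (\<lambda>x. p (f x) (h x))"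
proof -
  interpret bounded_bilinear p by fact
  obtain K where K: "0 \<le> K" "\<And>x y. norm (p x y) \<le> norm x * norm y * K" using nonneg_bounded by blast
  obtain C L where f: "0 \<le> C" "0 \<le> L" "\<And>x. norm (f x) \<le> C" "\<And>x y. norm (f x - f y) \<le> L * norm (x - y)"
    using bounded_lipschitzE[OF assms(2)] by metis
  obtain C' L' where h: "0 \<le> C'" "0 \<le> L'" "\<And>x. norm (h x) \<le> C'" "\<And>x y. norm (h x - h y) \<le> L' * norm (x - y)"
    using bounded_lipschitzE[OF assms(3)] by metis
  show ?thesis
  proof (rule bounded_lipschitzI)
    show "norm (p (f x) (h x)) \<le> C * C' * K" for x
      by (rule order_trans[OF K(2)]) (intro mult_right_mono mult_mono f h K norm_ge_zero)
    fix x y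
    have "p (f x) (h x) - p (f y) (h y) = p (f x - f y) (h x) + p (f y) (h x - h y)"
      by (simp add: diff_left diff_right)
    also have "norm \<dots> \<le> (L * norm (x - y)) * C' * K + C * (L' * norm (x - y)) * K"
      by (intro norm_triangle_le add_mono)
        (rule order_trans[OF K(2)], intro mult_right_mono mult_mono f h K norm_ge_zero mult_nonneg_nonneg)+
    finally show "norm (p (f x) (h x) - p (f y) (h y)) \<le> (L * C' * K + C * L' * K) * norm (x - y)"
      by (simp add: algebra_simps)
  qed
qed

lemma bounded_lipschitz_compose:
  assumes "bounded_lipschitz f" "\<And>x y. norm (h x - h y) \<le> K * norm (x - y)"
  shows "bounded_lipschitz (\<lambda>x. f (h x))"
proof -
  obtain C L where f: "0 \<le> C" "0 \<le> L" "\<And>x. norm (f x) \<le> C" "\<And>x y. norm (f x - f y) \<le> L * norm (x - y)"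
    using bounded_lipschitzE[OF assms(1)] by metis
  show ?thesis
  proof (rule bounded_lipschitzI)
    show "norm (f (h x)) \<le> C" for x by (rule f)
    show "norm (f (h x) - f (h y)) \<le> (L * K) * norm (x - y)" for x y
      using order_trans[OF f(4) mult_left_mono[OF assms(2) f(2)]] by (simp add: mult_ac)
  qed
qed

lemma bounded_lipschitz_vec:
  fixes f :: "'a::real_normed_vector \<Rightarrow> real^'n"
  assumes "\<And>k. bounded_lipschitz (\<lambda>x. f x $ k)"
  shows "bounded_lipschitz f"
proof -
  have "bounded_linear (\<lambda>c. c *\<^sub>R axis k (1::real) :: real^'n)" for k
    by (rule bounded_linear_scaleR_left)
  then have "bounded_lipschitz (\<lambda>x. \<Sum>k\<in>UNIV. (f x $ k) *\<^sub>R axis k (1::real) :: real^'n)"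
    by (intro bounded_lipschitz_sum bounded_lipschitz_linear[of "\<lambda>c. c *\<^sub>R axis _ (1::real)"] assms)
  then show ?thesis
    using basis_expansion[where 'a=real and 'n='n] by (simp add: scalar_mult_eq_scaleR)
qed

text \<open>Off K, an open set, f is constant and its derivative vanishes; on K every directional
  derivative is bounded by continuity. Summing the bounds over the basis controls the operator norm,
  and the mean value inequality gives the Lipschitz constant.\<close>

lemma bounded_lipschitz_compact_support:
  fixes f :: "'a::euclidean_space \<Rightarrow> 'b::real_normed_vector"
  assumes d: "\<And>x. (f has_derivative f' x) (at x)"
    and cont: "\<And>v. continuous_on UNIV (\<lambda>x. f' x v)"
    and K: "compact K" and c: "\<And>x. x \<notin> K \<Longrightarrow> f x = c"
  shows "bounded_lipschitz f"
proof -
  have zero: "f' x v = 0" if "x \<notin> K" for x v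
  proof -
    have "((\<lambda>x. c) has_derivative f' x) (at x)"
      by (rule has_derivative_transform_within_open[OF d, of "-K"])
        (use K that c in \<open>auto simp: compact_imp_closed open_Compl\<close>)
    then have "f' x = (\<lambda>v. 0)" using has_derivative_unique has_derivative_const by blast
    then show ?thesis by simp
  qed
  have bound: "\<exists>B\<ge>0. \<forall>x. norm (h x) \<le> B"
    if h: "continuous_on UNIV h" and hc: "\<And>x. x \<notin> K \<Longrightarrow> h x = c'" for h :: "'a \<Rightarrow> 'b" and c'
  proof -
    have "bounded (h ` K)"
      using K h by (intro compact_imp_bounded compact_continuous_image) (auto intro: continuous_on_subset)
    then obtain B where "\<And>x. x \<in> K \<Longrightarrow> norm (h x) \<le> B" by (auto simp: bounded_iff)
    then show ?thesis using hc by (intro exI[of _ "max B (norm c')"]) (metis max.coboundedI1 max.coboundedI2 norm_ge_zero order_refl)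
  qed
  obtain C where C: "\<And>x. norm (f x) \<le> C"
    using bound[OF _ c] d by (meson continuous_at_imp_continuous_on has_derivative_continuous)
  obtain B where B: "\<And>b. 0 \<le> B b" "\<And>b x. norm (f' x b) \<le> B b"
    using bound[OF cont zero] by metis
  have o: "onorm (f' x) \<le> (\<Sum>b\<in>Basis. B b)" for x
  proof (rule onorm_le)
    fix v
    interpret bounded_linear "f' x" using d has_derivative_bounded_linear by blast
    have "f' x v = f' x (\<Sum>b\<in>Basis. (v \<bullet> b) *\<^sub>R b)" by (simp add: euclidean_representation)
    also have "\<dots> = (\<Sum>b\<in>Basis. (v \<bullet> b) *\<^sub>R f' x b)" by (simp add: sum scaleR)
    also have "norm \<dots> \<le> (\<Sum>b\<in>Basis. B b * norm v)"
    proof (rule sum_norm_le)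
      fix b :: 'a assume "b \<in> Basis"
      then show "norm ((v \<bullet> b) *\<^sub>R f' x b) \<le> B b * norm v"
        using mult_mono[OF Basis_le_norm[of b v] B(2)[of x b]] by (simp add: mult.commute)
    qed
    finally show "norm (f' x v) \<le> (\<Sum>b\<in>Basis. B b) * norm v" by (simp add: sum_distrib_right)
  qed
  show ?thesis
    by (rule bounded_lipschitzI[OF C differentiable_bound[of UNIV f f', OF _ _ o]])
      (auto intro: d)
qed

section \<open>Matrices, their inverses, and products with a vanishing factor\<close>

lemma bounded_bilinear_matrix_vector: "bounded_bilinear ((*v) :: real^'n^'m \<Rightarrow> real^'n \<Rightarrow> real^'m)"
  unfolding bilinear_conv_bounded_bilinear[symmetric] bilinear_def
  by (auto intro!: linearI simp: matrix_vector_mult_add_rdistrib matrix_vector_right_distrib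
      scaleR_matrix_vector_assoc[symmetric] matrix_vector_mult_scaleR)

lemma bounded_bilinear_matrix_matrix: "bounded_bilinear ((**) :: real^'n^'m \<Rightarrow> real^'k^'n \<Rightarrow> real^'k^'m)"
  unfolding bilinear_conv_bounded_bilinear[symmetric] bilinear_def
  by (auto intro!: linearI simp: matrix_matrix_mult_def vec_eq_iff sum.distrib algebra_simps sum_distrib_left)

lemma matrix_inv_inverse:
  fixes M :: "real^'n^'n"
  assumes "\<And>v. M *v v = 0 \<Longrightarrow> v = 0"
  shows "matrix_inv M ** M = mat 1" "M ** matrix_inv M = mat 1"
proof -
  have "invertible M"
    using assms invertible_left_inverse matrix_left_invertible_ker by blast
  then have "M ** matrix_inv M = mat 1 \<and> matrix_inv M ** M = mat 1"
    unfolding invertible_def matrix_inv_def by (rule someI_ex)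
  then show "matrix_inv M ** M = mat 1" "M ** matrix_inv M = mat 1" by auto
qed

lemma inner_transpose: "(M *v u) \<bullet> v = u \<bullet> (transpose M *v v)" for M :: "real^'n^'m"
  by (metis dot_lmul_matrix vector_transpose_matrix transpose_transpose)

text \<open>The norm of a matrix is the Euclidean norm of its array of entries, and an operator
  bound controls each entry through the images of the basis vectors. The constant is crude; only its
  independence of M matters.\<close>

lemma matrix_norm_bound:
  fixes M :: "real^'n^'m"
  assumes "\<And>v. norm (M *v v) \<le> c * norm v"
  shows "norm M \<le> real CARD('m) * (real CARD('n) * c)"
proof -
  have e: "\<bar>M $ i $ j\<bar> \<le> c" for i j
    using order_trans[OF component_le_norm_cart assms[of "axis j 1"], of i]
    by (simp add: matrix_vector_mult_basis column_def norm_axis_1)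
  have "norm (M $ i) \<le> real CARD('n) * c" for i
    using order_trans[OF norm_le_l1_cart sum_bounded_above[of UNIV, OF e]] by simp
  then have "(\<Sum>i\<in>UNIV. norm (M $ i)) \<le> real CARD('m) * (real CARD('n) * c)"
    using sum_bounded_above[of UNIV "\<lambda>i. norm (M $ i)"] by simp
  moreover have "norm M \<le> (\<Sum>i\<in>UNIV. norm (M $ i))"
    unfolding norm_vec_def by (rule L2_set_le_sum) simp
  ultimately show ?thesis by linarith
qed

text \<open>Replacing \<open>f y\<close> by \<open>f x\<close> costs a term of size L \<bar>y -
  x\<bar> \<bar>h y\<bar>, which is o(\<bar>y - x\<bar>) because h vanishes at x. So f needs no
  derivative; this will differentiate the inverse of a matrix function that is so far known only to
  be Lipschitz.\<close>

lemma has_derivative_prod_vanishing: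
  assumes p: "bounded_bilinear p" and h: "(h has_derivative h') (at x)" "h x = 0"
    and f: "\<And>y. norm (f y - f x) \<le> L * norm (y - x)"
  shows "((\<lambda>y. p (f y) (h y)) has_derivative (\<lambda>v. p (f x) (h' v))) (at x)"
proof -
  interpret bounded_bilinear p by fact
  obtain K where K: "0 \<le> K" "\<And>x y. norm (p x y) \<le> norm x * norm y * K" using nonneg_bounded by blast
  have "((\<lambda>y. p (f y - f x) (h y)) has_derivative (\<lambda>v. 0)) (at x)"
    unfolding has_derivative_iff_norm
  proof (intro conjI bounded_linear_zero)
    have "((\<lambda>y. L * norm (h y) * K) \<longlongrightarrow> L * norm (h x) * K) (at x)"
      by (intro tendsto_intros has_derivative_continuous[OF h(1), unfolded continuous_at])
    then have "((\<lambda>y. L * norm (h y) * K) \<longlongrightarrow> 0) (at x)" using h by simp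
    then show "((\<lambda>y. norm (p (f y - f x) (h y) - p (f x - f x) (h x) - 0) / norm (y - x)) \<longlongrightarrow> 0) (at x)"
    proof (rule Lim_null_comparison[rotated])
      show "\<forall>\<^sub>F y in at x. norm (norm (p (f y - f x) (h y) - p (f x - f x) (h x) - 0) / norm (y - x))
          \<le> L * norm (h y) * K"
      proof (rule eventually_at_topological[THEN iffD2], intro exI[of _ UNIV] conjI ballI impI)
        fix y assume "y \<noteq> x"
        have "norm (p (f y - f x) (h y)) \<le> (L * norm (y - x)) * norm (h y) * K"
          by (rule order_trans[OF K(2)]) (intro mult_right_mono f K norm_ge_zero)
        then show "norm (norm (p (f y - f x) (h y) - p (f x - f x) (h x) - 0) / norm (y - x)) \<le> L * norm (h y) * K"
          using \<open>y \<noteq> x\<close> h by (simp add: zero_right divide_le_eq mult_ac)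
      qed auto
    qed
  qed
  moreover have "((\<lambda>y. p (f x) (h y)) has_derivative (\<lambda>v. p (f x) (h' v))) (at x)"
    by (rule bounded_linear.has_derivative[OF bounded_linear_right h(1)])
  ultimately have "((\<lambda>y. p (f y - f x) (h y) + p (f x) (h y)) has_derivative (\<lambda>v. 0 + p (f x) (h' v))) (at x)"
    by (rule has_derivative_add)
  then show ?thesis by (simp add: diff_left)
qed

text \<open>Multiplying v by this factor is the radial retraction onto the closed ball of radius
  M.\<close>

definition clamp_factor :: "real \<Rightarrow> 'a::real_normed_vector \<Rightarrow> real" where
  "clamp_factor M v = 1 / max 1 (norm v / M)"

lemma clamp_factor_eq_1: "0 < M \<Longrightarrow> norm v \<le> M \<Longrightarrow> clamp_factor M v = 1"
  by (simp add: clamp_factor_def max_def divide_le_eq)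

text \<open>The factor \<open>clamp_factor M w\<close> is kept on the right so that it can absorb an
  unbounded w: in the estimate of the retraction the difference is multiplied by w, and the clamped
  w has norm at most M.\<close>

lemma clamp_factor_diff:
  assumes "0 < M"
  shows "\<bar>clamp_factor M v - clamp_factor M w\<bar> \<le> clamp_factor M v * clamp_factor M w * (norm (v - w) / M)"
proof -
  let ?m = "\<lambda>v :: 'a. max 1 (norm v / M)"
  have "\<bar>?m w - ?m v\<bar> \<le> \<bar>norm w / M - norm v / M\<bar>" by (simp add: max_def)
  also have "\<dots> = \<bar>norm w - norm v\<bar> / M" using assms by (simp add: diff_divide_distrib[symmetric])
  also have "\<dots> \<le> norm (v - w) / M"
    using assms by (intro divide_right_mono) (metis norm_minus_commute norm_triangle_ineq3, simp)
  finally have *: "\<bar>?m w - ?m v\<bar> \<le> norm (v - w) / M" .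
  have p: "0 < ?m v" "0 < ?m w" by auto
  have "clamp_factor M v - clamp_factor M w = (?m w - ?m v) / (?m v * ?m w)"
    using p by (simp add: clamp_factor_def divide_simps del: less_max_iff_disj)
  then have "\<bar>clamp_factor M v - clamp_factor M w\<bar> = \<bar>?m w - ?m v\<bar> / (?m v * ?m w)"
    using p by (simp add: abs_mult)
  also have "\<dots> \<le> norm (v - w) / M / (?m v * ?m w)"
    using p by (intro divide_right_mono *) auto
  finally show ?thesis by (simp add: clamp_factor_def mult_ac)
qed

lemma clamp_factor_bounds: "0 < clamp_factor M v" "clamp_factor M v \<le> 1"
  by (auto simp: clamp_factor_def max_def)

lemma norm_clamp: "0 < M \<Longrightarrow> norm (clamp_factor M v *\<^sub>R v) \<le> M"
  by (auto simp: clamp_factor_def max_def divide_le_eq field_simps)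

lemma bounded_lipschitz_clamp_factor:
  assumes "0 < M"
  shows "bounded_lipschitz (clamp_factor M)"
proof (rule bounded_lipschitzI)
  show "norm (clamp_factor M v) \<le> 1" for v :: 'a
    using clamp_factor_bounds[of M v] by simp
  fix v w :: 'a
  have "clamp_factor M v * clamp_factor M w \<le> 1"
    using clamp_factor_bounds[of M v] clamp_factor_bounds[of M w] by (simp add: mult_le_one)
  then have "clamp_factor M v * clamp_factor M w * (norm (v - w) / M) \<le> 1 * (norm (v - w) / M)"
    using assms by (intro mult_right_mono) auto
  then show "norm (clamp_factor M v - clamp_factor M w) \<le> (1 / M) * norm (v - w)"
    using clamp_factor_diff[OF assms, of v w] by simp
qed

lemma bounded_lipschitz_clamp:
  assumes "0 < M"
  shows "bounded_lipschitz (\<lambda>v. clamp_factor M v *\<^sub>R v)"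
proof (rule bounded_lipschitzI[OF norm_clamp[OF assms]])
  fix v w :: 'a
  let ?c = "clamp_factor M"
  have "?c v *\<^sub>R v - ?c w *\<^sub>R w = ?c v *\<^sub>R (v - w) + (?c v - ?c w) *\<^sub>R w"
    by (simp add: algebra_simps)
  also have "norm \<dots> \<le> 1 * norm (v - w) + 1 * norm (v - w)"
  proof (intro norm_triangle_le add_mono)
    show "norm (?c v *\<^sub>R (v - w)) \<le> 1 * norm (v - w)"
      using clamp_factor_bounds[of M v] by (simp add: mult_left_le_one_le)
    have "norm ((?c v - ?c w) *\<^sub>R w) \<le> ?c v * ?c w * (norm (v - w) / M) * norm w"
      using mult_right_mono[OF clamp_factor_diff[OF assms, of v w] norm_ge_zero[of w]] by simp
    also have "\<dots> = ?c v * (norm (v - w) / M) * norm (?c w *\<^sub>R w)"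
      using clamp_factor_bounds[of M w] by simp
    also have "\<dots> \<le> 1 * (norm (v - w) / M) * M"
      using assms clamp_factor_bounds[of M v] norm_clamp[OF assms, of w]
      by (intro mult_mono) (auto simp: divide_nonneg_pos)
    finally show "norm ((?c v - ?c w) *\<^sub>R w) \<le> 1 * norm (v - w)" using assms by simp
  qed
  finally show "norm (?c v *\<^sub>R v - ?c w *\<^sub>R w) \<le> 2 * norm (v - w)" by simp
qed

section \<open>Compactly supported perturbations of the flat metric\<close>

locale perturbed_metric =
  fixes g :: "real \<Rightarrow> real^'n \<Rightarrow> real^'n^'n" and R T :: real
  assumes R_pos: "0 < R"
    and family: "smooth_metric_family g"
    and flat: "\<And>t z. R \<le> norm z \<or> T \<le> \<bar>t\<bar> \<Longrightarrow> g t z = mat 1"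
begin

definition G :: "real \<times> (real^'n) \<Rightarrow> real^'n^'n" where
  "G x = g (fst x) (snd x)"

definition dG :: "real \<times> (real^'n) \<Rightarrow> real \<times> (real^'n) \<Rightarrow> real^'n^'n" where
  "dG x v = frechet_derivative G (at x) v"

definition A :: "real \<times> (real^'n) \<Rightarrow> real^'n^'n" where
  "A x = matrix_inv (G x)"

text \<open>As the derivative of A is - A dG A, this vector at v = A \<zeta> is minus the spatial
  gradient of the dual form \<zeta> \<bullet> A \<zeta>. Writing it through dG exhibits it as built
  from bounded Lipschitz factors.\<close>

definition force :: "real \<times> (real^'n) \<Rightarrow> real^'n \<Rightarrow> real^'n" where
  "force x v = (\<chi> k. v \<bullet> (dG x (0, axis k 1) *v v))"

lemma smooth_G: "smooth G"
proof -
  have "(\<lambda>(t, z). g t z) = G" by (auto simp: G_def)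
  then show ?thesis using family by (simp add: smooth_metric_family_def)
qed

lemma G_has_derivative: "(G has_derivative dG x) (at x)"
proof -
  have "higher_differentiable G (Suc 0)" using smooth_G smooth_def by blast
  then have "G differentiable (at x)" unfolding higher_differentiable.simps by blast
  then show ?thesis unfolding dG_def frechet_derivative_works .
qed

lemma dG_linear: "bounded_linear (dG x)"
  using G_has_derivative has_derivative_bounded_linear by blast

lemma dG_differentiable:
  "((\<lambda>x. dG x v) has_derivative frechet_derivative (\<lambda>x. dG x v) (at x)) (at x)"
  "continuous_on UNIV (\<lambda>x. frechet_derivative (\<lambda>x. dG x v) (at x) w)"
proof -
  have "higher_differentiable G (Suc (Suc 0))" using smooth_G smooth_def by blast
  then have *: "(\<lambda>x. dG x v) differentiable (at x)" 
      "continuous_on UNIV (\<lambda>x. frechet_derivative (\<lambda>x. dG x v) (at x) w)" for x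
    unfolding higher_differentiable.simps dG_def by blast+
  show "((\<lambda>x. dG x v) has_derivative frechet_derivative (\<lambda>x. dG x v) (at x)) (at x)"
    using *(1) frechet_derivative_works by blast
  show "continuous_on UNIV (\<lambda>x. frechet_derivative (\<lambda>x. dG x v) (at x) w)" by (rule *)
qed

lemma dG_continuous: "continuous_on UNIV (\<lambda>x. dG x v)"
  using dG_differentiable(1) by (meson continuous_at_imp_continuous_on has_derivative_continuous)

lemma dG_eq_0_open:
  assumes "open S" "x \<in> S" "\<And>y. y \<in> S \<Longrightarrow> G y = mat 1"
  shows "dG x v = 0"
proof -
  have "((\<lambda>x. mat 1) has_derivative dG x) (at x)"
    by (rule has_derivative_transform_within_open[OF G_has_derivative assms])
  then have "dG x = (\<lambda>v. 0)" using has_derivative_unique has_derivative_const by blast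
  then show ?thesis by simp
qed

lemma dG_late: "T < \<bar>fst x\<bar> \<Longrightarrow> dG x v = 0"
proof (rule dG_eq_0_open)
  show "open {x. T < \<bar>fst x\<bar>}" by (intro open_Collect_less continuous_intros)
qed (auto simp: G_def flat)

lemma dG_outside_open: "R < norm (snd x) \<Longrightarrow> dG x v = 0"
proof (rule dG_eq_0_open)
  show "open {x. R < norm (snd x)}" by (intro open_Collect_less continuous_intros)
qed (auto simp: G_def flat)

text \<open>On the sphere of radius R the metric is known to be flat only from one side, so the
  open-set argument fails there. The derivative vanishes at the points (1 + \<epsilon>) z just
  outside and is continuous.\<close>

lemma dG_outside: 
  assumes "R \<le> norm (snd x)"
  shows "dG x v = 0"
proof -
  have "((\<lambda>\<epsilon>. dG (fst x, (1 + \<epsilon>) *\<^sub>R snd x) v) \<longlongrightarrow> dG (fst x, (1 + 0) *\<^sub>R snd x) v) (at_right 0)"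
    by (intro continuous_on_tendsto_compose[OF dG_continuous] tendsto_intros) auto
  moreover have "\<forall>\<^sub>F \<epsilon> :: real in at_right 0. dG (fst x, (1 + \<epsilon>) *\<^sub>R snd x) v = 0"
    using eventually_at_right_less[of 0]
  proof eventually_elim
    case (elim \<epsilon>)
    have "0 < \<epsilon> * norm (snd x)" using elim assms R_pos by (intro mult_pos_pos) auto
    then have "R < (1 + \<epsilon>) * norm (snd x)" using assms by (simp add: distrib_right)
    then show ?case using elim by (intro dG_outside_open) simp
  qed
  ultimately have "((\<lambda>\<epsilon>::real. 0) \<longlongrightarrow> dG (fst x, (1 + 0) *\<^sub>R snd x) v) (at_right 0)"
    using tendsto_cong by force
  then show ?thesis using tendsto_unique[OF _ _ tendsto_const] by (metis add_0_right fst_conv prod.collapse scaleR_one trivial_limit_at_right_real)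
qed

text \<open>The absolute value makes K nonempty whatever the sign of T, as the minimum taken in
  \<open>G_elliptic\<close> requires.\<close>

definition K :: "(real \<times> (real^'n)) set" where
  "K = {-\<bar>T\<bar>..\<bar>T\<bar>} \<times> cball 0 R"

lemma compact_K: "compact K"
  unfolding K_def by (intro compact_Times) auto

lemma notin_K: "x \<notin> K \<Longrightarrow> R < norm (snd x) \<or> T < \<bar>fst x\<bar>"
  by (cases x) (auto simp: K_def)

lemma G_outside_K: "x \<notin> K \<Longrightarrow> G x = mat 1"
  using notin_K[of x] flat[of "snd x" "fst x"] by (auto simp: G_def)

lemma bounded_lipschitz_G: "bounded_lipschitz G"
  by (rule bounded_lipschitz_compact_support[OF G_has_derivative dG_continuous compact_K G_outside_K])

lemma bounded_lipschitz_dG: "bounded_lipschitz (\<lambda>x. dG x v)"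
  by (rule bounded_lipschitz_compact_support[OF dG_differentiable compact_K])
    (use notin_K dG_late dG_outside_open in blast)

section \<open>Uniform ellipticity and regularity of the dual metric\<close>

lemma G_sym: "transpose (G x) = G x"
  using family by (simp add: smooth_metric_family_def riemannian_metric_def G_def)

lemma G_pos: "v \<noteq> 0 \<Longrightarrow> 0 < v \<bullet> (G x *v v)"
  using family by (simp add: smooth_metric_family_def riemannian_metric_def G_def)

text \<open>The form has a positive minimum over K times the unit sphere; off K it is the Euclidean
  form, whence the minimum with 1.\<close>

lemma G_elliptic:
  obtains m where "0 < m" "\<And>x v. m * (norm v)\<^sup>2 \<le> v \<bullet> (G x *v v)"
proof -
  have cG: "continuous_on S G" for S
    using G_has_derivative by (meson continuous_at_imp_continuous_on has_derivative_continuous)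
  have "compact (K \<times> sphere 0 (1::real) :: ((real \<times> (real^'n)) \<times> (real^'n)) set)" 
    by (intro compact_Times compact_K) auto
  moreover have "((0, 0), axis undefined 1 :: real^'n) \<in> K \<times> sphere 0 1"
    using R_pos by (auto simp: K_def norm_axis_1 dist_norm)
  moreover have "continuous_on (K \<times> sphere 0 1) (\<lambda>p. snd p \<bullet> (G (fst p) *v snd p))"
    by (intro continuous_intros bounded_bilinear.continuous_on[OF bounded_bilinear_matrix_vector]
      continuous_on_compose2[OF cG[of UNIV]]) auto
  ultimately obtain p where p: "p \<in> K \<times> sphere 0 1"
    "\<And>r. r \<in> K \<times> sphere 0 1 \<Longrightarrow> snd p \<bullet> (G (fst p) *v snd p) \<le> snd r \<bullet> (G (fst r) *v snd r)"
    using continuous_attains_inf[of "K \<times> sphere 0 1"] by blast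
  define m where "m = min 1 (snd p \<bullet> (G (fst p) *v snd p))"
  have "snd p \<noteq> 0" using p(1) by auto
  then have "0 < m" using G_pos[of "snd p" "fst p"] by (simp add: m_def)
  moreover have "m * (norm v)\<^sup>2 \<le> v \<bullet> (G x *v v)" for x v
  proof (cases "v = 0 \<or> x \<notin> K")
    case True
    have "m * (v \<bullet> v) \<le> 1 * (v \<bullet> v)" by (intro mult_right_mono) (auto simp: m_def)
    then show ?thesis using True by (auto simp: G_outside_K power2_norm_eq_inner)
  next
    case False
    then have "m \<le> (v /\<^sub>R norm v) \<bullet> (G x *v (v /\<^sub>R norm v))"
      using p(2)[of "(x, v /\<^sub>R norm v)"] by (auto simp: m_def)
    also have "\<dots> = (v \<bullet> (G x *v v)) / (norm v)\<^sup>2"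
      by (simp add: matrix_vector_mult_scaleR power2_eq_square divide_inverse)
    finally show ?thesis using False by (simp add: le_divide_eq)
  qed
  ultimately show ?thesis using that by blast
qed

lemma A_G: "A x ** G x = mat 1" and G_A: "G x ** A x = mat 1"
proof -
  have "G x *v v = 0 \<Longrightarrow> v = 0" for v using G_pos[of v x] by fastforce
  then show "A x ** G x = mat 1" "G x ** A x = mat 1"
    unfolding A_def by (intro matrix_inv_inverse; blast)+
qed

lemma A_G_vec [simp]: "A x *v (G x *v v) = v" and G_A_vec [simp]: "G x *v (A x *v v) = v"
  by (simp_all add: matrix_vector_mul_assoc A_G G_A)

lemma A_sym: "transpose (A x) = A x"
proof -
  have "transpose (A x) ** G x = mat 1"
    by (metis G_A G_sym matrix_transpose_mul transpose_mat)
  then have "transpose (A x) ** G x ** A x = mat 1 ** A x" by simp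
  then show ?thesis by (simp add: G_A flip: matrix_mul_assoc)
qed

lemma A_inner: "(A x *v u) \<bullet> v = u \<bullet> (A x *v v)"
  by (simp add: inner_transpose A_sym)

text \<open>This resolvent identity transfers regularity from G to its inverse: with a bound on A it
  yields the Lipschitz property, and with that property the derivative.\<close>

lemma A_diff: "A y - A x = - (A y ** (G y - G x) ** A x)"
  by (simp add: bounded_bilinear.diff_left[OF bounded_bilinear_matrix_matrix]
      bounded_bilinear.diff_right[OF bounded_bilinear_matrix_matrix] A_G G_A flip: matrix_mul_assoc)

lemma A_outside: "R \<le> norm (snd x) \<Longrightarrow> A x = mat 1"
proof -
  assume "R \<le> norm (snd x)"
  then have "G x = mat 1" by (simp add: G_def flat)
  then show ?thesis using A_G[of x] by simp
qed

lemma bounded_lipschitz_A: "bounded_lipschitz A"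
proof -
  obtain m where m: "0 < m" "\<And>x v. m * (norm v)\<^sup>2 \<le> v \<bullet> (G x *v v)" using G_elliptic by blast
  have "norm (A x *v v) \<le> (1/m) * norm v" for x v
  proof -
    have "m * (norm (A x *v v))\<^sup>2 \<le> norm (A x *v v) * norm v"
      using order_trans[OF m(2) norm_cauchy_schwarz, of "A x *v v" x] by simp
    then have "m * norm (A x *v v) \<le> norm v"
      using m(1) by (cases "norm (A x *v v) = 0") (auto simp: power2_eq_square mult_ac)
    then show ?thesis using m(1) by (simp add: le_divide_eq mult.commute)
  qed
  from matrix_norm_bound[OF this] obtain C where C: "\<And>x. norm (A x) \<le> C" by blast
  have C0: "0 \<le> C" using C[of 0] norm_ge_zero order_trans by blast
  interpret bounded_bilinear "(**) :: real^'n^'n \<Rightarrow> real^'n^'n \<Rightarrow> real^'n^'n"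
    by (rule bounded_bilinear_matrix_matrix)
  obtain k where k: "0 \<le> k" "\<And>(M :: real^'n^'n) (N :: real^'n^'n). norm (M ** N) \<le> norm M * norm N * k"
    using nonneg_bounded by metis
  obtain B L where L: "0 \<le> L" "\<And>x y. norm (G x - G y) \<le> L * norm (x - y)"
    using bounded_lipschitzE[OF bounded_lipschitz_G] by metis
  show ?thesis
  proof (rule bounded_lipschitzI[OF C])
    fix x y
    have "norm (A x - A y) \<le> norm (A x) * norm (G x - G y) * k * norm (A y) * k"
      unfolding A_diff[of x y] norm_minus_cancel
      by (rule order_trans[OF k(2)]) (intro mult_right_mono k norm_ge_zero)
    also have "\<dots> \<le> C * (L * norm (x - y)) * k * C * k"
      by (intro mult_mono mult_right_mono C L k C0 mult_nonneg_nonneg norm_ge_zero order_refl)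
    finally show "norm (A x - A y) \<le> (C * L * k * C * k) * norm (x - y)" by (simp add: mult_ac)
  qed
qed

text \<open>In the resolvent identity the factor \<open>G y - G x\<close> vanishes at y = x, so the
  other factor A y may be frozen at x; its Lipschitz property suffices for this.\<close>

lemma A_has_derivative: "(A has_derivative (\<lambda>v. - (A x ** dG x v ** A x))) (at x)"
proof -
  obtain B L where L: "0 \<le> L" "\<And>x y. norm (A x - A y) \<le> L * norm (x - y)"
    using bounded_lipschitzE[OF bounded_lipschitz_A] by metis
  have "((\<lambda>y. A y ** (G y - G x)) has_derivative (\<lambda>v. A x ** dG x v)) (at x)"
    by (rule has_derivative_prod_vanishing[OF bounded_bilinear_matrix_matrix _ _ L(2)])
      (auto intro!: derivative_eq_intros G_has_derivative)
  from bounded_linear.has_derivative[OF bounded_bilinear.bounded_linear_left[OF bounded_bilinear_matrix_matrix, of "A x"] this]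
  have "((\<lambda>y. A x - A y ** (G y - G x) ** A x) has_derivative (\<lambda>v. 0 - A x ** dG x v ** A x)) (at x)"
    by (intro has_derivative_diff has_derivative_const)
  moreover have "A x - A y ** (G y - G x) ** A x = A y" for y
    using A_diff[of y x] by (simp add: algebra_simps)
  ultimately show ?thesis by simp
qed

text \<open>With u = A v one has v \<bullet> A v = u \<bullet> G u, which is at least m
  \<bar>u\<bar> squared, while v = G u gives \<bar>v\<bar> at most C \<bar>u\<bar>. The summand 1 in
  C makes it positive.\<close>

lemma A_elliptic:
  obtains m where "0 < m" "\<And>x v. m * (norm v)\<^sup>2 \<le> v \<bullet> (A x *v v)"
proof -
  obtain m where m: "0 < m" "\<And>x v. m * (norm v)\<^sup>2 \<le> v \<bullet> (G x *v v)" using G_elliptic by blast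
  obtain B L where B: "0 \<le> B" "\<And>x. norm (G x) \<le> B"
    using bounded_lipschitzE[OF bounded_lipschitz_G] by metis
  interpret bounded_bilinear "(*v) :: real^'n^'n \<Rightarrow> real^'n \<Rightarrow> real^'n"
    by (rule bounded_bilinear_matrix_vector)
  obtain k where k: "0 < k" "\<And>(M :: real^'n^'n) v. norm (M *v v) \<le> norm M * norm v * k"
    using pos_bounded by metis
  define C where "C = (B + 1) * k"
  have C: "0 < C" using B k by (simp add: C_def)
  have "m / C\<^sup>2 * (norm v)\<^sup>2 \<le> v \<bullet> (A x *v v)" for x v
  proof -
    have "norm v \<le> norm (G x) * norm (A x *v v) * k" using k(2)[of "G x" "A x *v v"] by simp
    also have "\<dots> \<le> (B + 1) * norm (A x *v v) * k"
      using B(2)[of x] k by (intro mult_right_mono) auto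
    finally have "(norm v)\<^sup>2 \<le> (C * norm (A x *v v))\<^sup>2"
      by (intro power_mono) (auto simp: C_def mult_ac)
    then have "m * (norm v)\<^sup>2 \<le> C\<^sup>2 * (m * (norm (A x *v v))\<^sup>2)"
      using m(1) by (simp add: power_mult_distrib)
    also have "\<dots> \<le> C\<^sup>2 * (v \<bullet> (A x *v v))"
      using m(2)[of "A x *v v" x] by (intro mult_left_mono) (auto simp: inner_commute)
    finally show ?thesis using C by (simp add: divide_le_eq mult.commute)
  qed
  then show ?thesis using that[of "m / C\<^sup>2"] m C by simp
qed

end

section \<open>The rescaled Hamiltonian flow\<close>

lemma bounded_lipschitz_compose_linear:
  assumes "bounded_lipschitz f" "bounded_linear h"
  shows "bounded_lipschitz (\<lambda>x. f (h x))"
proof -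
  interpret bounded_linear h by fact
  obtain K where "\<And>x. norm (h x) \<le> norm x * K" using bounded by blast
  then have "norm (h x - h y) \<le> K * norm (x - y)" for x y by (metis diff mult.commute)
  then show ?thesis by (rule bounded_lipschitz_compose[OF assms(1)])
qed

lemma norm_snd_le': "norm (snd X) \<le> norm X"
  by (metis norm_snd_le prod.collapse)

lemma sum_le_norm_square:
  fixes z v :: "'a::real_inner"
  assumes "0 \<le> c * (z \<bullet> v)"
  shows "norm z \<le> norm (z + c *\<^sub>R v)"
proof -
  have "(norm (z + c *\<^sub>R v))\<^sup>2 = (norm z)\<^sup>2 + 2 * (c * (z \<bullet> v)) + (c * norm v)\<^sup>2"
    unfolding power2_norm_eq_inner power_mult_distrib
    by (simp add: inner_add_left inner_add_right inner_commute[of v z] power2_eq_square algebra_simps)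
  then have "(norm z)\<^sup>2 \<le> (norm (z + c *\<^sub>R v))\<^sup>2"
    using assms by (simp add: add_nonneg_nonneg)
  then show ?thesis by (rule power2_le_imp_le) simp
qed

context perturbed_metric
begin

lemma dG_scale: "dG x (c *\<^sub>R v) = c *\<^sub>R dG x v"
  using dG_linear by (simp add: linear_simps)

lemma force_inner: "force x v \<bullet> w = v \<bullet> (dG x (0, w) *v v)"
proof -
  interpret bounded_linear "dG x" by (rule dG_linear)
  interpret bilin: bounded_bilinear "(*v) :: real^'n^'n \<Rightarrow> real^'n \<Rightarrow> real^'n"
    by (rule bounded_bilinear_matrix_vector)
  have "(0, w) = (\<Sum>k\<in>UNIV. w $ k *\<^sub>R (0 :: real, axis k 1 :: real^'n))"
  proof -
    have "w = (\<Sum>k\<in>UNIV. w $ k *\<^sub>R axis k 1)"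
      using basis_expansion[of w] by (simp add: scalar_mult_eq_scaleR)
    then show ?thesis by (intro prod_eqI) (simp_all add: fst_sum snd_sum)
  qed
  then have "dG x (0, w) = (\<Sum>k\<in>UNIV. w $ k *\<^sub>R dG x (0, axis k 1))"
    by (simp only: sum scaleR)
  then have "v \<bullet> (dG x (0, w) *v v) = (\<Sum>k\<in>UNIV. w $ k * (v \<bullet> (dG x (0, axis k 1) *v v)))"
    by (simp only: bilin.sum_left bilin.scaleR_left inner_sum_right inner_scaleR_right)
  then show ?thesis by (simp add: force_def inner_vec_def mult.commute)
qed

lemma force_scale: "force x (c *\<^sub>R v) = c\<^sup>2 *\<^sub>R force x v"
  by (simp add: force_def vec_eq_iff matrix_vector_mult_scaleR power2_eq_square)

lemma force_outside: "R \<le> norm (snd x) \<Longrightarrow> force x v = 0"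
  by (simp add: force_def dG_outside vec_eq_iff)

lemma path_has_vector_derivative:
  assumes "(t has_real_derivative \<epsilon>) (at r)" "(z has_vector_derivative w) (at r)"
    and "(f has_derivative f') (at (t r, z r))"
  shows "((\<lambda>r. f (t r, z r)) has_vector_derivative f' (\<epsilon>, w)) (at r)"
proof -
  have "((\<lambda>r. (t r, z r)) has_vector_derivative (\<epsilon>, w)) (at r)"
    using assms(1,2) by (intro has_vector_derivative_Pair) (simp_all add: has_real_derivative_iff_has_vector_derivative)
  from vector_derivative_diff_chain_within[OF this, of f f'] show ?thesis
    using assms(3) by (simp add: o_def has_derivative_at_withinI)
qed

text \<open>The momentum equation makes \<open>\<theta> \<bullet> A \<theta>\<close> vary only through the explicit time dependence of the
  metric; a common factor \<open>a\<close> in the two equations does not matter.\<close>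

lemma energy_has_derivative:
  assumes t: "(t has_real_derivative \<epsilon>) (at r)"
    and z: "(z has_vector_derivative a *\<^sub>R (A (t r, z r) *v \<theta> r)) (at r)"
    and \<theta>: "(\<theta> has_vector_derivative (a / 2) *\<^sub>R force (t r, z r) (A (t r, z r) *v \<theta> r)) (at r)"
  shows "((\<lambda>r. \<theta> r \<bullet> (A (t r, z r) *v \<theta> r)) has_real_derivative
     - \<epsilon> * ((A (t r, z r) *v \<theta> r) \<bullet> (dG (t r, z r) (1, 0) *v (A (t r, z r) *v \<theta> r)))) (at r)"
proof -
  define x where "x = (t r, z r)"
  define v where "v = A x *v \<theta> r"
  interpret bounded_linear "dG x" by (rule dG_linear)
  interpret bilin: bounded_bilinear "(*v) :: real^'n^'n \<Rightarrow> real^'n \<Rightarrow> real^'n"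
    by (rule bounded_bilinear_matrix_vector)
  have "((\<lambda>r. A (t r, z r)) has_vector_derivative - (A x ** dG x (\<epsilon>, a *\<^sub>R v) ** A x)) (at r)"
    using path_has_vector_derivative[OF t z A_has_derivative] by (simp add: x_def v_def)
  from bounded_bilinear.has_vector_derivative[OF bounded_bilinear_inner \<theta>
      bilin.has_vector_derivative[OF this \<theta>]]
  have *: "((\<lambda>r. \<theta> r \<bullet> (A (t r, z r) *v \<theta> r)) has_vector_derivative
     (\<theta> r \<bullet> (A x *v ((a / 2) *\<^sub>R force x v) + (- (A x ** dG x (\<epsilon>, a *\<^sub>R v) ** A x)) *v \<theta> r)
       + ((a / 2) *\<^sub>R force x v) \<bullet> v)) (at r)"
    by (simp add: x_def v_def)
  have "dG x (\<epsilon>, a *\<^sub>R v) = dG x (\<epsilon> *\<^sub>R (1, 0) + a *\<^sub>R (0, v))" by simp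
  then have dG': "dG x (\<epsilon>, a *\<^sub>R v) = \<epsilon> *\<^sub>R dG x (1, 0) + a *\<^sub>R dG x (0, v)"
    by (simp only: add scaleR)
  have "\<theta> r \<bullet> ((A x ** dG x (\<epsilon>, a *\<^sub>R v) ** A x) *v \<theta> r) = v \<bullet> (dG x (\<epsilon>, a *\<^sub>R v) *v v)"
    by (simp add: v_def A_inner flip: matrix_vector_mul_assoc)
  also have "\<dots> = \<epsilon> * (v \<bullet> (dG x (1, 0) *v v)) + a * (force x v \<bullet> v)"
    by (simp add: dG' force_inner bilin.add_left bilin.scaleR_left inner_add_right)
  \<comment> \<open>Differentiating the two occurrences of \<theta> gives two equal halves of a
    (force \<bullet> v). They cancel the spatial part of the derivative of A, so only its time part
    survives.\<close>
  finally have "\<theta> r \<bullet> (A x *v ((a / 2) *\<^sub>R force x v) + (- (A x ** dG x (\<epsilon>, a *\<^sub>R v) ** A x)) *v \<theta> r)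
       + ((a / 2) *\<^sub>R force x v) \<bullet> v = - \<epsilon> * (v \<bullet> (dG x (1, 0) *v v))"
    by (simp add: bilin.minus_left inner_add_right inner_diff_right matrix_vector_mult_scaleR)
      (simp add: v_def A_inner inner_commute[of "force _ _"] algebra_simps)
  with * show ?thesis
    by (simp add: has_real_derivative_iff_has_vector_derivative x_def v_def)
qed

text \<open>One constant has to serve all \<epsilon> including 0 and all pairs of times. The
  variable factor a admits both the true equations, with a = 1, and the clamped ones, for which it
  is the square of the clamp factor.\<close>

definition momentum_growth :: "real \<Rightarrow> bool" where
  "momentum_growth B \<longleftrightarrow> 1 \<le> B \<and> (\<forall>\<epsilon> t z \<theta> a r s. 0 \<le> \<epsilon> \<longrightarrow>
     (\<forall>r. (t has_real_derivative \<epsilon>) (at r) \<and>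
       (z has_vector_derivative a r *\<^sub>R (A (t r, z r) *v \<theta> r)) (at r) \<and>
       (\<theta> has_vector_derivative (a r / 2) *\<^sub>R force (t r, z r) (A (t r, z r) *v \<theta> r)) (at r)) \<longrightarrow>
     norm (\<theta> r) \<le> B * norm (\<theta> s))"

text \<open>Since the metric is static for \<open>\<bar>t\<bar> > T\<close>, the logarithm of the energy changes at a rate at most
  \<open>\<epsilon> \<beta> / (1 + t\<^sup>2)\<close>; weighting the energy by \<open>exp (\<plusminus> \<beta> * arctan t)\<close> gives a bound that is uniform in
  time and in \<open>\<epsilon>\<close>.\<close>

lemma momentum_growth_exists: "\<exists>B. momentum_growth B"
proof -
  obtain m where m: "0 < m" "\<And>x v. m * (norm v)\<^sup>2 \<le> v \<bullet> (A x *v v)" using A_elliptic by blast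
  interpret bilin: bounded_bilinear "(*v) :: real^'n^'n \<Rightarrow> real^'n \<Rightarrow> real^'n"
    by (rule bounded_bilinear_matrix_vector)
  obtain k where k: "0 \<le> k" "\<And>(M :: real^'n^'n) v. norm (M *v v) \<le> norm M * norm v * k"
    using bilin.nonneg_bounded by metis
  obtain C where C: "0 \<le> C" "\<And>x. norm (A x) \<le> C"
    using bounded_lipschitzE[OF bounded_lipschitz_A] by metis
  obtain D where D: "0 \<le> D" "\<And>x. norm (dG x (1, 0)) \<le> D"
    using bounded_lipschitzE[OF bounded_lipschitz_dG] by metis
  have bA: "norm (A x *v v) \<le> C * k * norm v" for x v
    using order_trans[OF k(2) mult_right_mono[OF mult_right_mono[OF C(2)] k(1)], of v x] by (simp add: mult_ac)
  have bE: "v \<bullet> (A x *v v) \<le> C * k * (norm v)\<^sup>2" for x v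
    using order_trans[OF norm_cauchy_schwarz[of v "A x *v v"] mult_left_mono[OF bA[of x v] norm_ge_zero[of v]]]
    by (simp add: power2_eq_square mult_ac)
  \<comment> \<open>The explicit time dependence acts only for \<bar>t\<bar> \<le> T, where (1 +
    T^2) / (1 + t^2) is at least 1. This factor turns the constant bound on the rate into a multiple
    of the derivative of arctan.\<close>
  define \<beta> where "\<beta> = D * k * (C * k)\<^sup>2 / m * (1 + T\<^sup>2)"
  have \<beta>: "0 \<le> \<beta>" using D C k m by (simp add: \<beta>_def)
  have drift: "\<bar>(A x *v v) \<bullet> (dG x (1, 0) *v (A x *v v))\<bar> \<le> \<beta> / (1 + (fst x)\<^sup>2) * (v \<bullet> (A x *v v))" for x v
  proof (cases "T < \<bar>fst x\<bar>")
    case True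
    have "0 \<le> v \<bullet> (A x *v v)" using order_trans[OF _ m(2)] m(1) by simp
    then show ?thesis using True \<beta> by (simp add: dG_late)
  next
    case False
    let ?u = "A x *v v"
    have "norm (dG x (1, 0) *v ?u) \<le> D * norm ?u * k"
      by (rule order_trans[OF k(2)]) (intro mult_right_mono D k norm_ge_zero)
    then have "\<bar>?u \<bullet> (dG x (1, 0) *v ?u)\<bar> \<le> norm ?u * (D * norm ?u * k)"
      by (intro order_trans[OF Cauchy_Schwarz_ineq2] mult_left_mono) auto
    also have "\<dots> = D * k * (norm ?u)\<^sup>2" by (simp add: power2_eq_square)
    also have "\<dots> \<le> D * k * (C * k * norm v)\<^sup>2"
      using D k by (intro mult_left_mono power_mono bA) auto
    also have "\<dots> = D * k * (C * k)\<^sup>2 / m * (m * (norm v)\<^sup>2)" using m by (simp add: power_mult_distrib)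
    also have "\<dots> \<le> D * k * (C * k)\<^sup>2 / m * (v \<bullet> ?u)"
      using D k m by (intro mult_left_mono) auto
    also have "\<dots> \<le> \<beta> / (1 + (fst x)\<^sup>2) * (v \<bullet> ?u)"
    proof (rule mult_right_mono)
      have "\<bar>fst x\<bar>\<^sup>2 \<le> T\<^sup>2" using False by (intro power_mono) auto
      then have "1 \<le> (1 + T\<^sup>2) / (1 + (fst x)\<^sup>2)" by (simp add: le_divide_eq add_pos_nonneg)
      from mult_left_mono[OF this, of "D * k * (C * k)\<^sup>2 / m"]
      show "D * k * (C * k)\<^sup>2 / m \<le> \<beta> / (1 + (fst x)\<^sup>2)" using D k m by (simp add: \<beta>_def)
      show "0 \<le> v \<bullet> ?u" using order_trans[OF _ m(2)] m(1) by simp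
    qed
    finally show ?thesis .
  qed
  \<comment> \<open>C k / m is the ratio of the upper and lower bounds comparing the energy with the
    squared momentum, and \<pi> bounds the variation of arctan. The summand 1 ensures that B is at
    least 1.\<close>
  define B where "B = sqrt (C * k / m * exp (\<beta> * pi)) + 1"
  have B: "1 \<le> B" "C * k / m * exp (\<beta> * pi) \<le> B\<^sup>2"
  proof -
    have "0 \<le> C * k / m * exp (\<beta> * pi)" using C k m by simp
    then show "1 \<le> B" "C * k / m * exp (\<beta> * pi) \<le> B\<^sup>2" by (auto simp: B_def power2_sum)
  qed
  have "norm (\<theta> r) \<le> B * norm (\<theta> s)"
    if \<epsilon>: "0 \<le> \<epsilon>" and t: "\<And>r. (t has_real_derivative \<epsilon>) (at r)"
      and z: "\<And>r. (z has_vector_derivative a r *\<^sub>R (A (t r, z r) *v \<theta> r)) (at r)"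
      and \<theta>: "\<And>r. (\<theta> has_vector_derivative (a r / 2) *\<^sub>R force (t r, z r) (A (t r, z r) *v \<theta> r)) (at r)"
    for \<epsilon> t z \<theta> a r s
  proof -
    define E where "E r = \<theta> r \<bullet> (A (t r, z r) *v \<theta> r)" for r
    define E' where "E' r = - \<epsilon> * ((A (t r, z r) *v \<theta> r) \<bullet> (dG (t r, z r) (1, 0) *v (A (t r, z r) *v \<theta> r)))" for r
    have dE: "(E has_real_derivative E' r) (at r)" for r
      using energy_has_derivative[OF t z \<theta>] by (simp add: E_def[abs_def] E'_def)
    have E0: "0 \<le> E r" for r
      using order_trans[OF _ m(2)] m(1) by (simp add: E_def)
    have bE': "\<bar>E' r\<bar> \<le> \<epsilon> * (\<beta> / (1 + (t r)\<^sup>2) * E r)" for r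
      using mult_left_mono[OF drift[of "(t r, z r)" "\<theta> r"] \<epsilon>] \<epsilon> by (simp add: E'_def E_def abs_mult)
    have expo: "((\<lambda>r. E r * exp (\<sigma> * \<beta> * arctan (t r))) has_real_derivative
        (E' r + \<sigma> * (\<epsilon> * (\<beta> / (1 + (t r)\<^sup>2) * E r))) * exp (\<sigma> * \<beta> * arctan (t r))) (at r)" for r \<sigma>
      by (auto intro!: derivative_eq_intros dE t simp: field_simps add_pos_nonneg add_nonneg_eq_0_iff)
    have "E r \<le> E s * exp (\<beta> * pi)"
    proof (cases "s \<le> r")
      case True
      have "E r * exp (- \<beta> * arctan (t r)) \<le> E s * exp (- \<beta> * arctan (t s))"
      proof (rule DERIV_nonpos_imp_nonincreasing[OF True])
        fix u
        have "(E' u + (-1) * (\<epsilon> * (\<beta> / (1 + (t u)\<^sup>2) * E u))) * exp (-1 * \<beta> * arctan (t u)) \<le> 0"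
          using bE'[of u] by (intro mult_nonpos_nonneg) auto
        then show "\<exists>y. ((\<lambda>r. E r * exp (- \<beta> * arctan (t r))) has_real_derivative y) (at u) \<and> y \<le> 0"
          using expo[of "-1" u] by auto
      qed
      from mult_right_mono[OF this, of "exp (\<beta> * arctan (t r))"]
      have "E r \<le> E s * exp (\<beta> * (arctan (t r) - arctan (t s)))"
        by (simp add: mult.assoc flip: exp_add) (simp add: algebra_simps)
      also have "\<dots> \<le> E s * exp (\<beta> * pi)"
        using arctan_bounded[of "t r"] arctan_bounded[of "t s"] \<beta> E0[of s]
        by (intro mult_left_mono) (auto intro: mult_left_mono)
      finally show ?thesis .
    next
      case False
      then have "r \<le> s" by simp
      have "E r * exp (\<beta> * arctan (t r)) \<le> E s * exp (\<beta> * arctan (t s))"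
      proof (rule DERIV_nonneg_imp_nondecreasing[OF \<open>r \<le> s\<close>])
        fix u
        have "0 \<le> (E' u + 1 * (\<epsilon> * (\<beta> / (1 + (t u)\<^sup>2) * E u))) * exp (1 * \<beta> * arctan (t u))"
          using bE'[of u] by (intro mult_nonneg_nonneg) auto
        then show "\<exists>y. ((\<lambda>r. E r * exp (\<beta> * arctan (t r))) has_real_derivative y) (at u) \<and> 0 \<le> y"
          using expo[of 1 u] by auto
      qed
      from mult_right_mono[OF this, of "exp (- \<beta> * arctan (t r))"]
      have "E r \<le> E s * exp (\<beta> * (arctan (t s) - arctan (t r)))"
        by (simp add: mult.assoc flip: exp_add) (simp add: algebra_simps)
      also have "\<dots> \<le> E s * exp (\<beta> * pi)"
        using arctan_bounded[of "t r"] arctan_bounded[of "t s"] \<beta> E0[of s]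
        by (intro mult_left_mono) (auto intro: mult_left_mono)
      finally show ?thesis .
    qed
    also have "\<dots> \<le> C * k * (norm (\<theta> s))\<^sup>2 * exp (\<beta> * pi)"
      unfolding E_def by (intro mult_right_mono bE) auto
    finally have "m * (norm (\<theta> r))\<^sup>2 \<le> C * k * (norm (\<theta> s))\<^sup>2 * exp (\<beta> * pi)"
      using order_trans[OF m(2)] by (simp add: E_def)
    then have "(norm (\<theta> r))\<^sup>2 \<le> C * k / m * exp (\<beta> * pi) * (norm (\<theta> s))\<^sup>2"
      using m(1) by (simp add: le_divide_eq mult_ac)
    also have "\<dots> \<le> B\<^sup>2 * (norm (\<theta> s))\<^sup>2" by (intro mult_right_mono B) auto
    finally have "(norm (\<theta> r))\<^sup>2 \<le> (B * norm (\<theta> s))\<^sup>2" by (simp add: power_mult_distrib)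
    then show ?thesis by (rule power2_le_imp_le) (use B in auto)
  qed
  then have "momentum_growth B" unfolding momentum_growth_def using B(1) by blast
  then show ?thesis ..
qed

text \<open>For \<open>\<epsilon> = 0\<close> these are the geodesics of \<open>g t0\<close>, for \<open>\<epsilon> > 0\<close> the rescaled bicharacteristics.\<close>

definition ham_at :: "real \<Rightarrow> real \<Rightarrow> (real \<Rightarrow> real^'n) \<Rightarrow> (real \<Rightarrow> real^'n) \<Rightarrow> real \<Rightarrow> bool" where
  "ham_at \<epsilon> t0 z \<theta> r \<longleftrightarrow>
     (z has_vector_derivative A (t0 + \<epsilon> * r, z r) *v \<theta> r) (at r) \<and>
     (\<theta> has_vector_derivative (1/2) *\<^sub>R force (t0 + \<epsilon> * r, z r) (A (t0 + \<epsilon> * r, z r) *v \<theta> r)) (at r)"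

definition ham :: "real \<Rightarrow> real \<Rightarrow> (real \<Rightarrow> real^'n) \<Rightarrow> (real \<Rightarrow> real^'n) \<Rightarrow> bool" where
  "ham \<epsilon> t0 z \<theta> \<longleftrightarrow> (\<forall>r. ham_at \<epsilon> t0 z \<theta> r)"

text \<open>The Hamiltonian field for the state \<open>(z, \<theta>, t, \<epsilon>)\<close>, made globally Lipschitz by
  clamping the momentum to the ball of radius \<open>M\<close>.\<close>

definition field :: "real \<Rightarrow> (real^'n) \<times> (real^'n) \<times> real \<times> real \<Rightarrow> (real^'n) \<times> (real^'n) \<times> real \<times> real" where
  "field M = (\<lambda>(z, \<theta>, t, \<epsilon>).
     (clamp_factor M \<theta> *\<^sub>R (A (t, z) *v (clamp_factor M \<theta> *\<^sub>R \<theta>)),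
      (1/2) *\<^sub>R force (t, z) (A (t, z) *v (clamp_factor M \<theta> *\<^sub>R \<theta>)), \<epsilon>, 0))"

text \<open>The two curved components are products of bounded Lipschitz functions once the momentum
  is clamped. The component \<epsilon> is unbounded but linear and contributes the 1 in the
  constant.\<close>

lemma field_lipschitz:
  assumes "0 < M"
  obtains L where "\<And>X Y. norm (field M X - field M Y) \<le> L * norm (X - Y)"
proof -
  let ?x = "\<lambda>X :: (real^'n) \<times> (real^'n) \<times> real \<times> real. (fst (snd (snd X)), fst X)"
  let ?th = "\<lambda>X :: (real^'n) \<times> (real^'n) \<times> real \<times> real. fst (snd X)"
  have lin: "bounded_linear ?x" "bounded_linear ?th"
    by (intro bounded_linear_Pair bounded_linear_intros)+
  have blA: "bounded_lipschitz (\<lambda>X. A (?x X))"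
    by (rule bounded_lipschitz_compose_linear[OF bounded_lipschitz_A lin(1)])
  have blD: "bounded_lipschitz (\<lambda>X. dG (?x X) w)" for w
    by (rule bounded_lipschitz_compose_linear[OF bounded_lipschitz_dG lin(1)])
  have blc: "bounded_lipschitz (\<lambda>X. clamp_factor M (?th X))"
    by (rule bounded_lipschitz_compose_linear[OF bounded_lipschitz_clamp_factor[OF assms] lin(2)])
  have blt: "bounded_lipschitz (\<lambda>X. clamp_factor M (?th X) *\<^sub>R ?th X)"
    by (rule bounded_lipschitz_compose_linear[OF bounded_lipschitz_clamp[OF assms] lin(2)])
  have blv: "bounded_lipschitz (\<lambda>X. A (?x X) *v (clamp_factor M (?th X) *\<^sub>R ?th X))"
    by (intro bounded_lipschitz_prod[OF bounded_bilinear_matrix_vector] blA blt)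
  define f1 where "f1 X = clamp_factor M (?th X) *\<^sub>R (A (?x X) *v (clamp_factor M (?th X) *\<^sub>R ?th X))" for X
  define f2 where "f2 X = (1/2::real) *\<^sub>R force (?x X) (A (?x X) *v (clamp_factor M (?th X) *\<^sub>R ?th X))" for X
  have 1: "bounded_lipschitz f1"
    unfolding f1_def by (intro bounded_lipschitz_prod[OF bounded_bilinear_scaleR] blc blv)
  have "bounded_lipschitz (\<lambda>X. force (?x X) (A (?x X) *v (clamp_factor M (?th X) *\<^sub>R ?th X)))"
    by (intro bounded_lipschitz_vec)
      (simp only: force_def vec_lambda_beta,
       intro bounded_lipschitz_prod[OF bounded_bilinear_inner]
        bounded_lipschitz_prod[OF bounded_bilinear_matrix_vector] blv blD)
  then have 2: "bounded_lipschitz f2"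
    unfolding f2_def by (rule bounded_lipschitz_linear[OF bounded_linear_scaleR_right])
  obtain L1 where L1: "\<And>X Y. norm (f1 X - f1 Y) \<le> L1 * norm (X - Y)"
    using bounded_lipschitzE[OF 1] by metis
  obtain L2 where L2: "\<And>X Y. norm (f2 X - f2 Y) \<le> L2 * norm (X - Y)"
    using bounded_lipschitzE[OF 2] by metis
  have f: "field M X = (f1 X, f2 X, snd (snd (snd X)), 0)" for X
    by (simp add: field_def f1_def f2_def case_prod_beta)
  have "norm (field M X - field M Y) \<le> (L1 + L2 + 1) * norm (X - Y)" for X Y
  proof -
    have "norm (field M X - field M Y) \<le>
        norm (f1 X - f1 Y) + (norm (f2 X - f2 Y) + (norm (snd (snd (snd X)) - snd (snd (snd Y))) + norm (0::real)))"
      by (simp only: f diff_Pair) (intro order_trans[OF norm_Pair_le] add_mono order_refl, simp)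
    also have "norm (snd (snd (snd X)) - snd (snd (snd Y))) \<le> norm (X - Y)"
      by (simp only: snd_diff[symmetric]) (rule order_trans[OF norm_snd_le' order_trans[OF norm_snd_le' norm_snd_le']])
    finally show ?thesis using L1[of X Y] L2[of X Y] by (simp add: algebra_simps)
  qed
  then show ?thesis using that by blast
qed

text \<open>Carrying t and \<epsilon> as state variables makes the system autonomous and turns
  dependence on the parameters \<open>t0\<close> and \<epsilon> into dependence on initial data. The
  limit \<epsilon> = 0 thus becomes regular.\<close>

lemma ham_at_imp_field:
  assumes "ham_at \<epsilon> t0 z \<theta> r" "norm (\<theta> r) \<le> M" "0 < M"
  shows "((\<lambda>r. (z r, \<theta> r, t0 + \<epsilon> * r, \<epsilon>)) has_vector_derivative
    field M (z r, \<theta> r, t0 + \<epsilon> * r, \<epsilon>)) (at r)"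
proof -
  have "((\<lambda>r. t0 + \<epsilon> * r) has_vector_derivative \<epsilon>) (at r)"
    unfolding has_real_derivative_iff_has_vector_derivative[symmetric]
    by (auto intro!: derivative_eq_intros)
  moreover have "field M (z r, \<theta> r, t0 + \<epsilon> * r, \<epsilon>) =
      (A (t0 + \<epsilon> * r, z r) *v \<theta> r,
       (1/2) *\<^sub>R force (t0 + \<epsilon> * r, z r) (A (t0 + \<epsilon> * r, z r) *v \<theta> r), \<epsilon>, 0)"
    using assms by (simp add: field_def clamp_factor_eq_1)
  ultimately show ?thesis
    using assms(1) unfolding ham_at_def
    by (auto intro!: has_vector_derivative_Pair has_vector_derivative_const)
qed

lemma ham_momentum_bound:
  assumes "momentum_growth B" "0 \<le> \<epsilon>" "ham \<epsilon> t0 z \<theta>"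
  shows "norm (\<theta> r) \<le> B * norm (\<theta> s)"
proof -
  have "((\<lambda>r. t0 + \<epsilon> * r) has_real_derivative \<epsilon>) (at r)" for r
    by (auto intro!: derivative_eq_intros)
  then show ?thesis
    using assms(1)[unfolded momentum_growth_def, THEN conjunct2, rule_format,
        of \<epsilon> "\<lambda>r. t0 + \<epsilon> * r" z "\<lambda>r. 1" \<theta>] assms(2,3)
    by (simp add: ham_def ham_at_def)
qed

text \<open>The clamped field has a global solution. The energy estimate applies to it as well and
  keeps its momentum below the clamping radius, so the clamp never acts.\<close>

lemma ham_exists:
  assumes \<epsilon>: "0 \<le> \<epsilon>"
  obtains z \<theta> where "ham \<epsilon> t0 z \<theta>" "z s = z0" "\<theta> s = \<theta>0"
proof -
  obtain B where B: "momentum_growth B" using momentum_growth_exists ..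
  then have B1: "1 \<le> B" by (simp add: momentum_growth_def)
  define M where "M = B * norm \<theta>0 + 1"
  have M: "0 < M" using B1 by (simp add: M_def add_nonneg_pos)
  obtain L where L: "\<And>X Y. norm (field M X - field M Y) \<le> L * norm (X - Y)"
    using field_lipschitz[OF M] by blast
  obtain X where X: "X s = (z0, \<theta>0, t0 + \<epsilon> * s, \<epsilon>)" "\<And>r. (X has_vector_derivative field M (X r)) (at r)"
    using ode_global_solution[OF L] by metis
  define z where "z r = fst (X r)" for r
  define \<theta> where "\<theta> r = fst (snd (X r))" for r
  define t where "t r = fst (snd (snd (X r)))" for r
  define e where "e r = snd (snd (snd (X r)))" for r
  note proj = bounded_linear.has_vector_derivative[OF _ X(2)]
  have dz: "(z has_vector_derivative clamp_factor M (\<theta> r) *\<^sub>R (A (t r, z r) *v (clamp_factor M (\<theta> r) *\<^sub>R \<theta> r))) (at r)" for r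
    using proj[OF bounded_linear_fst, of r] by (simp add: z_def[abs_def] field_def t_def \<theta>_def case_prod_beta)
  have d\<theta>: "(\<theta> has_vector_derivative (1/2) *\<^sub>R force (t r, z r) (A (t r, z r) *v (clamp_factor M (\<theta> r) *\<^sub>R \<theta> r))) (at r)" for r
    using proj[OF bounded_linear_compose[OF bounded_linear_fst bounded_linear_snd], of r]
    by (simp add: z_def \<theta>_def[abs_def] field_def t_def case_prod_beta)
  have dt: "(t has_real_derivative e r) (at r)" for r
    using proj[OF bounded_linear_compose[OF bounded_linear_fst bounded_linear_compose[OF bounded_linear_snd bounded_linear_snd]], of r]
    by (simp add: t_def[abs_def] field_def e_def case_prod_beta has_real_derivative_iff_has_vector_derivative)
  have de: "(e has_real_derivative 0) (at r)" for r
    using proj[OF bounded_linear_compose[OF bounded_linear_snd bounded_linear_compose[OF bounded_linear_snd bounded_linear_snd]], of r]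
    by (simp add: e_def[abs_def] field_def case_prod_beta has_real_derivative_iff_has_vector_derivative)
  have e: "e r = \<epsilon>" for r
    using DERIV_isconst_all[of e r s] de X(1) by (auto simp: e_def)
  have "((\<lambda>r. t r - \<epsilon> * r) has_real_derivative 0) (at r)" for r
    using dt[of r] by (auto intro!: derivative_eq_intros simp: e)
  then have "t r - \<epsilon> * r = t s - \<epsilon> * s" for r
    using DERIV_isconst_all[of "\<lambda>r. t r - \<epsilon> * r" r s] by blast
  then have t: "t r = t0 + \<epsilon> * r" for r using X(1) by (simp add: t_def algebra_simps)
  \<comment> \<open>In \<open>field\<close> the position component carries an additional clamp
    factor, and \<open>force\<close> is quadratic. Hence both clamped equations are the true ones
    times the same squared factor, which is the form that \<open>momentum_growth\<close>
    covers.\<close>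
  have "norm (\<theta> r) \<le> B * norm (\<theta> s)" for r
    using B[unfolded momentum_growth_def, THEN conjunct2, rule_format,
        of \<epsilon> t z "\<lambda>r. (clamp_factor M (\<theta> r))\<^sup>2" \<theta>] \<epsilon> dt dz d\<theta>
    by (simp add: e matrix_vector_mult_scaleR force_scale power2_eq_square)
  then have "norm (\<theta> r) \<le> M" for r
    using X(1) by (simp add: M_def \<theta>_def add_increasing2)
  then have "clamp_factor M (\<theta> r) = 1" for r by (rule clamp_factor_eq_1[OF M])
  then have "ham \<epsilon> t0 z \<theta>" using dz d\<theta> t by (simp add: ham_def ham_at_def)
  then show ?thesis using that X(1) by (simp add: z_def \<theta>_def)
qed

text \<open>Both curves need to solve the equations and obey the momentum bound only between s and
  r. There the clamped field agrees with the true one, so a local piece of a solution can be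
  compared with a global one.\<close>

definition dependence_constant :: "real \<Rightarrow> real \<Rightarrow> bool" where
  "dependence_constant M L \<longleftrightarrow> (\<forall>\<epsilon> \<epsilon>' t0 t0' z z' \<theta> \<theta>' r s.
     (\<forall>u\<in>closed_segment s r. ham_at \<epsilon> t0 z \<theta> u \<and> norm (\<theta> u) \<le> M) \<longrightarrow>
     (\<forall>u\<in>closed_segment s r. ham_at \<epsilon>' t0' z' \<theta>' u \<and> norm (\<theta>' u) \<le> M) \<longrightarrow>
     norm ((z r, \<theta> r) - (z' r, \<theta>' r)) \<le>
       norm ((z s, \<theta> s, t0 + \<epsilon> * s, \<epsilon>) - (z' s, \<theta>' s, t0' + \<epsilon>' * s, \<epsilon>')) * exp (L * \<bar>r - s\<bar>))"

lemma dependence_constant_exists: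
  assumes "0 < M"
  shows "\<exists>L. dependence_constant M L"
proof -
  obtain L where L: "\<And>X Y. norm (field M X - field M Y) \<le> L * norm (X - Y)"
    using field_lipschitz[OF assms] by blast
  have "norm ((z r, \<theta> r) - (z' r, \<theta>' r)) \<le>
         norm ((z s, \<theta> s, t0 + \<epsilon> * s, \<epsilon>) - (z' s, \<theta>' s, t0' + \<epsilon>' * s, \<epsilon>')) * exp (L * \<bar>r - s\<bar>)"
    if 1: "\<And>u. u \<in> closed_segment s r \<Longrightarrow> ham_at \<epsilon> t0 z \<theta> u \<and> norm (\<theta> u) \<le> M"
      and 2: "\<And>u. u \<in> closed_segment s r \<Longrightarrow> ham_at \<epsilon>' t0' z' \<theta>' u \<and> norm (\<theta>' u) \<le> M"
    for \<epsilon> \<epsilon>' t0 t0' z z' \<theta> \<theta>' r s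
  proof -
    have "norm ((z r, \<theta> r) - (z' r, \<theta>' r)) \<le>
        norm ((z r, \<theta> r, t0 + \<epsilon> * r, \<epsilon>) - (z' r, \<theta>' r, t0' + \<epsilon>' * r, \<epsilon>'))"
      by (simp add: norm_Pair)
    also have "\<dots> \<le> norm ((z s, \<theta> s, t0 + \<epsilon> * s, \<epsilon>) - (z' s, \<theta>' s, t0' + \<epsilon>' * s, \<epsilon>')) * exp (L * \<bar>r - s\<bar>)"
      by (rule ode_dependence[OF L]) (use 1 2 assms ham_at_imp_field in blast)+
    finally show ?thesis .
  qed
  then have "dependence_constant M L" unfolding dependence_constant_def by blast
  then show ?thesis ..
qed

text \<open>A momentum bound at one time propagates to all times by \<open>momentum_growth\<close>.
  So the rate L depends on P alone and is uniform along sequences of rays.\<close>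

lemma ham_dependence:
  "\<exists>L. \<forall>\<epsilon> \<epsilon>' t0 t0' z z' \<theta> \<theta>' r s. 0 \<le> \<epsilon> \<longrightarrow> 0 \<le> \<epsilon>' \<longrightarrow> ham \<epsilon> t0 z \<theta> \<longrightarrow> ham \<epsilon>' t0' z' \<theta>' \<longrightarrow>
     norm (\<theta> s) \<le> P \<longrightarrow> norm (\<theta>' s) \<le> P \<longrightarrow>
     norm ((z r, \<theta> r) - (z' r, \<theta>' r)) \<le>
       norm ((z s, \<theta> s, t0 + \<epsilon> * s, \<epsilon>) - (z' s, \<theta>' s, t0' + \<epsilon>' * s, \<epsilon>')) * exp (L * \<bar>r - s\<bar>)"
proof -
  obtain B where B: "momentum_growth B" using momentum_growth_exists ..
  then have B1: "1 \<le> B" by (simp add: momentum_growth_def)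
  have M: "0 < B * \<bar>P\<bar> + 1" using B1 by (simp add: add_nonneg_pos)
  have *: "norm (\<theta> u) \<le> B * \<bar>P\<bar> + 1" if "0 \<le> \<epsilon>" "ham \<epsilon> t0 z \<theta>" "norm (\<theta> s) \<le> P" for \<epsilon> t0 z \<theta> u s
  proof -
    have "norm (\<theta> u) \<le> B * norm (\<theta> s)" using ham_momentum_bound[OF B] that by blast
    also have "\<dots> \<le> B * \<bar>P\<bar>" using B1 that by (intro mult_left_mono) auto
    finally show ?thesis by simp
  qed
  obtain L where L: "dependence_constant (B * \<bar>P\<bar> + 1) L" using dependence_constant_exists[OF M] ..
  show ?thesis
    by (intro exI[of _ L] allI impI L[unfolded dependence_constant_def, rule_format])
      (use * ham_def in blast)+
qed

lemma ham_unique: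
  assumes "0 \<le> \<epsilon>" "ham \<epsilon> t0 z \<theta>" "ham \<epsilon> t0 z' \<theta>'" "z s = z' s" "\<theta> s = \<theta>' s"
  shows "z = z'" "\<theta> = \<theta>'"
proof -
  obtain L where L: "\<forall>\<epsilon> \<epsilon>' t0 t0' z z' \<theta> \<theta>' r s. 0 \<le> \<epsilon> \<longrightarrow> 0 \<le> \<epsilon>' \<longrightarrow> ham \<epsilon> t0 z \<theta> \<longrightarrow> ham \<epsilon>' t0' z' \<theta>' \<longrightarrow>
     norm (\<theta> s) \<le> P \<longrightarrow> norm (\<theta>' s) \<le> P \<longrightarrow>
     norm ((z r, \<theta> r) - (z' r, \<theta>' r)) \<le>
       norm ((z s, \<theta> s, t0 + \<epsilon> * s, \<epsilon>) - (z' s, \<theta>' s, t0' + \<epsilon>' * s, \<epsilon>')) * exp (L * \<bar>r - s\<bar>)"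
    if "P = norm (\<theta> s)" for P
    using ham_dependence[of "norm (\<theta> s)"] by metis
  have "(z r, \<theta> r) = (z' r, \<theta>' r)" for r
    using L[OF refl, rule_format, OF assms(1,1,2,3), of s r] assms(4,5) by (simp add: zero_prod_def)
  then show "z = z'" "\<theta> = \<theta>'" by auto
qed

text \<open>Along the segment the straight line never comes closer to the origin than at s, so it
  stays in the flat region and solves the equations; continuous dependence identifies it with the
  ray. The sign condition covers the future of an outgoing point and the past of an incoming
  one.\<close>

lemma ham_free:
  assumes \<epsilon>: "0 \<le> \<epsilon>" and h: "ham \<epsilon> t0 z \<theta>"
    and out: "R \<le> norm (z s)" "0 \<le> (r - s) * (z s \<bullet> \<theta> s)"
  shows "z r = z s + (r - s) *\<^sub>R \<theta> s" "\<theta> r = \<theta> s"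
proof -
  define l where "l u = z s + (u - s) *\<^sub>R \<theta> s" for u
  have seg: "ham_at \<epsilon> t0 l (\<lambda>u. \<theta> s) u" if u: "u \<in> closed_segment s r" for u
  proof -
    obtain c where c: "0 \<le> c" "u - s = c * (r - s)"
    proof -
      obtain c where "0 \<le> c" "u = (1 - c) *\<^sub>R s + c *\<^sub>R r" using u by (auto simp: closed_segment_def)
      then show ?thesis by (intro that[of c]) (auto simp: algebra_simps)
    qed
    have "0 \<le> (u - s) * (z s \<bullet> \<theta> s)"
      using mult_nonneg_nonneg[OF c(1) out(2)] by (simp add: c(2) mult.assoc)
    then have "R \<le> norm (l u)"
      using sum_le_norm_square[of "u - s" "z s" "\<theta> s"] out(1) by (simp add: l_def)
    then have "A (t0 + \<epsilon> * u, l u) = mat 1" "force (t0 + \<epsilon> * u, l u) v = 0" for v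
      by (auto intro: A_outside force_outside)
    moreover have "(l has_vector_derivative \<theta> s) (at u)"
      unfolding l_def by (auto intro!: derivative_eq_intros)
    ultimately show ?thesis by (simp add: ham_at_def)
  qed
  obtain B where B: "momentum_growth B" using momentum_growth_exists ..
  then have B1: "1 \<le> B" by (simp add: momentum_growth_def)
  define M where "M = B * norm (\<theta> s) + 1"
  have M: "0 < M" using B1 by (simp add: M_def add_nonneg_pos)
  obtain L where L: "dependence_constant M L" using dependence_constant_exists[OF M] ..
  have "norm (\<theta> u) \<le> M" for u using ham_momentum_bound[OF B \<epsilon> h, of u s] by (simp add: M_def)
  then have "norm ((z r, \<theta> r) - (l r, \<theta> s)) \<le>
      norm ((z s, \<theta> s, t0 + \<epsilon> * s, \<epsilon>) - (l s, \<theta> s, t0 + \<epsilon> * s, \<epsilon>)) * exp (L * \<bar>r - s\<bar>)"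
    using h seg by (intro L[unfolded dependence_constant_def, rule_format]) (auto simp: ham_def)
  then have "norm ((z r, \<theta> r) - (l r, \<theta> s)) \<le> 0" by (simp add: l_def)
  then show "z r = z s + (r - s) *\<^sub>R \<theta> s" "\<theta> r = \<theta> s" by (auto simp: l_def zero_prod_def)
qed

end

section \<open>Geodesics\<close>

context perturbed_metric
begin

lemma G_space_derivative: "((\<lambda>z. G (t, z)) has_derivative (\<lambda>w. dG (t, z) (0, w))) (at z)"
proof -
  have "((\<lambda>z. (t, z)) has_derivative (\<lambda>w. (0, w))) (at z)"
    by (auto intro!: derivative_eq_intros)
  from has_derivative_compose[OF this G_has_derivative] show ?thesis .
qed

lemma partial_deriv_metric:
  "partial_deriv i (\<lambda>x. g t x $ j $ l) z = dG (t, z) (0, axis i 1) $ j $ l"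
proof -
  from bounded_linear.has_derivative[OF bounded_linear_vec_nth[of l]
      bounded_linear.has_derivative[OF bounded_linear_vec_nth[of j] G_space_derivative[of t z]]]
  have "((\<lambda>x. g t x $ j $ l) has_derivative (\<lambda>w. dG (t, z) (0, w) $ j $ l)) (at z)"
    by (simp add: G_def)
  from fun_cong[OF frechet_derivative_at[OF this], of "axis i 1"] show ?thesis
    by (simp add: partial_deriv_def)
qed

lemma dG_space_sym: "dG (t, z) (0, axis i 1) $ j $ l = dG (t, z) (0, axis i 1) $ l $ j"
proof -
  have "g t x $ j $ l = g t x $ l $ j" for x
    using arg_cong[OF G_sym[of "(t, x)"], of "\<lambda>M. M $ l $ j"] by (simp add: G_def transpose_def)
  then have "(\<lambda>x. g t x $ j $ l) = (\<lambda>x. g t x $ l $ j)" by blast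
  then show ?thesis unfolding partial_deriv_metric[symmetric] by simp
qed

text \<open>Contracted with v twice, the first two derivative terms of the Christoffel symbol give
  the same vector dG(v) v after exchanging i and j, and the third gives the force.\<close>

lemma geodesic_acceleration:
  "(\<chi> k. - (\<Sum>i\<in>UNIV. \<Sum>j\<in>UNIV. christoffel (g t) z k i j * v $ i * v $ j)) =
     - (A (t, z) *v (dG (t, z) (0, v) *v v - (1/2) *\<^sub>R force (t, z) v))"
proof -
  define P where "P i j l = dG (t, z) (0, axis i 1) $ j $ l" for i j l
  have P_sym: "P i j l = P i l j" for i j l unfolding P_def by (rule dG_space_sym)
  define a where "a = A (t, z)"
  have chr: "christoffel (g t) z k i j = (1/2) * (\<Sum>l\<in>UNIV. a $ k $ l * (P i j l + P j i l - P l i j))" for k i j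
    by (simp add: christoffel_def partial_deriv_metric P_def a_def A_def G_def)
  define S where "S l = (\<Sum>i\<in>UNIV. \<Sum>j\<in>UNIV. P i j l * v $ i * v $ j)" for l
  define F where "F l = (\<Sum>i\<in>UNIV. \<Sum>j\<in>UNIV. P l i j * v $ i * v $ j)" for l
  have S': "(\<Sum>i\<in>UNIV. \<Sum>j\<in>UNIV. P j i l * v $ i * v $ j) = S l" for l
    unfolding S_def by (subst sum.swap) (simp add: mult_ac)
  have "(dG (t, z) (0, v) *v v) $ l = S l" for l
  proof -
    interpret bounded_linear "dG (t, z)" by (rule dG_linear)
    have "(0, v) = (\<Sum>k\<in>UNIV. v $ k *\<^sub>R (0 :: real, axis k 1 :: real^'n))"
    proof -
      have "v = (\<Sum>k\<in>UNIV. v $ k *\<^sub>R axis k 1)"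
        using basis_expansion[of v] by (simp add: scalar_mult_eq_scaleR)
      then show ?thesis by (intro prod_eqI) (simp_all add: fst_sum snd_sum)
    qed
    then have d: "dG (t, z) (0, v) = (\<Sum>k\<in>UNIV. v $ k *\<^sub>R dG (t, z) (0, axis k 1))"
      by (simp only: sum scaleR)
    have "(dG (t, z) (0, v) *v v) $ l = (\<Sum>j\<in>UNIV. (\<Sum>i\<in>UNIV. v $ i * P i l j) * v $ j)"
      by (simp add: matrix_vector_mult_def d P_def)
    also have "\<dots> = (\<Sum>i\<in>UNIV. \<Sum>j\<in>UNIV. P i l j * v $ i * v $ j)"
      unfolding sum_distrib_right by (subst sum.swap) (simp add: mult_ac)
    finally show ?thesis by (simp add: S_def P_sym[of _ l])
  qed
  moreover have "force (t, z) v $ l = F l" for l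
    by (simp add: force_def F_def P_def inner_vec_def matrix_vector_mult_def sum_distrib_left mult_ac)
  ultimately have rhs: "(A (t, z) *v (dG (t, z) (0, v) *v v - (1/2) *\<^sub>R force (t, z) v)) $ k =
      (\<Sum>l\<in>UNIV. a $ k $ l * (S l - F l / 2))" for k
    unfolding matrix_vector_mult_def[of "A (t, z)"] a_def by simp
  have lhs: "(\<Sum>i\<in>UNIV. \<Sum>j\<in>UNIV. christoffel (g t) z k i j * v $ i * v $ j) =
      (\<Sum>l\<in>UNIV. a $ k $ l * (S l - F l / 2))" for k
  proof -
    have "(\<Sum>i\<in>UNIV. \<Sum>j\<in>UNIV. christoffel (g t) z k i j * v $ i * v $ j) =
        (\<Sum>i\<in>UNIV. \<Sum>j\<in>UNIV. \<Sum>l\<in>UNIV. a $ k $ l * (1/2) * (P i j l + P j i l - P l i j) * v $ i * v $ j)"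
      by (simp add: chr sum_distrib_left sum_distrib_right mult_ac)
    also have "\<dots> = (\<Sum>i\<in>UNIV. \<Sum>l\<in>UNIV. \<Sum>j\<in>UNIV. a $ k $ l * (1/2) * (P i j l + P j i l - P l i j) * v $ i * v $ j)"
      by (intro sum.cong refl sum.swap)
    also have "\<dots> = (\<Sum>l\<in>UNIV. \<Sum>i\<in>UNIV. \<Sum>j\<in>UNIV. a $ k $ l * (1/2) * (P i j l + P j i l - P l i j) * v $ i * v $ j)"
      by (rule sum.swap)
    also have "\<dots> = (\<Sum>l\<in>UNIV. a $ k $ l * (1/2) * (\<Sum>i\<in>UNIV. \<Sum>j\<in>UNIV.
        P i j l * v $ i * v $ j + P j i l * v $ i * v $ j - P l i j * v $ i * v $ j))"
      unfolding sum_distrib_left by (intro sum.cong refl) (simp add: algebra_simps)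
    also have "\<dots> = (\<Sum>l\<in>UNIV. a $ k $ l * (1/2) * (S l + S l - F l))"
      by (simp only: sum.distrib sum_subtractf S_def[symmetric] S' F_def[symmetric])
    finally show ?thesis by (simp add: field_simps)
  qed
  show ?thesis
    by (simp only: vec_eq_iff vec_lambda_beta lhs vector_uminus_component rhs) simp
qed

text \<open>This is the Legendre transform. In the derivative of G c' the term dG(c') c' cancels the
  one in the geodesic acceleration, and half the force remains.\<close>

lemma geodesic_imp_ham:
  assumes "geodesic (g t) c"
  shows "ham 0 t c (\<lambda>s. G (t, c s) *v velocity c s)"
  unfolding ham_def ham_at_def
proof (intro allI conjI)
  fix s
  have dc: "(c has_vector_derivative velocity c s) (at s)"
    using assms by (simp add: geodesic_def velocity_def vector_derivative_works)
  then show "(c has_vector_derivative A (t + 0 * s, c s) *v (G (t, c s) *v velocity c s)) (at s)" by simp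
  have dv: "(velocity c has_vector_derivative
      - (A (t, c s) *v (dG (t, c s) (0, velocity c s) *v velocity c s - (1/2) *\<^sub>R force (t, c s) (velocity c s)))) (at s)"
    using assms by (simp add: geodesic_def flip: geodesic_acceleration)
  have "((\<lambda>s. G (t, c s)) has_vector_derivative dG (t, c s) (0, velocity c s)) (at s)"
    using path_has_vector_derivative[OF _ dc, of "\<lambda>s. t" 0 G] G_has_derivative by auto
  from bounded_bilinear.has_vector_derivative[OF bounded_bilinear_matrix_vector this dv]
  show "((\<lambda>s. G (t, c s) *v velocity c s) has_vector_derivative
      (1/2) *\<^sub>R force (t + 0 * s, c s) (A (t + 0 * s, c s) *v (G (t, c s) *v velocity c s))) (at s)"
    by (simp add: bounded_bilinear.minus_right[OF bounded_bilinear_matrix_vector])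
qed

lemma ham_imp_geodesic:
  assumes "ham 0 t c \<theta>"
  shows "geodesic (g t) c" "velocity c s = A (t, c s) *v \<theta> s"
proof -
  have dc: "(c has_vector_derivative A (t, c s) *v \<theta> s) (at s)"
    and d\<theta>: "(\<theta> has_vector_derivative (1/2) *\<^sub>R force (t, c s) (A (t, c s) *v \<theta> s)) (at s)" for s
    using assms by (simp_all add: ham_def ham_at_def)
  show v: "velocity c s = A (t, c s) *v \<theta> s" for s
    unfolding velocity_def by (rule vector_derivative_at[OF dc])
  then have v': "velocity c = (\<lambda>s. A (t, c s) *v \<theta> s)" by blast
  have "(velocity c has_vector_derivative
      - (A (t, c s) *v (dG (t, c s) (0, velocity c s) *v velocity c s - (1/2) *\<^sub>R force (t, c s) (velocity c s)))) (at s)" for s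
  proof -
    have "((\<lambda>s. A (t, c s)) has_vector_derivative - (A (t, c s) ** dG (t, c s) (0, velocity c s) ** A (t, c s))) (at s)"
      using path_has_vector_derivative[OF _ dc A_has_derivative, of "\<lambda>s. t" 0] by (simp add: v)
    from bounded_bilinear.has_vector_derivative[OF bounded_bilinear_matrix_vector this d\<theta>]
    show ?thesis
      by (simp add: v' bounded_bilinear.minus_left[OF bounded_bilinear_matrix_vector]
          matrix_vector_mult_diff_distrib flip: matrix_vector_mul_assoc)
  qed
  then show "geodesic (g t) c"
    unfolding geodesic_def geodesic_acceleration
    using dc differentiableI_vector by blast
qed

lemma geodesic_from_ham:
  obtains \<theta> where "ham 0 t (geodesic_from (g t) z v) \<theta>" "geodesic_from (g t) z v 0 = z" "\<theta> 0 = v"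
proof -
  obtain c \<theta> where h: "ham 0 t c \<theta>" "c 0 = z" "\<theta> 0 = v"
    by (rule ham_exists[of 0 t 0 z v]) auto
  have "geodesic_from (g t) z v = c"
    unfolding geodesic_from_def
  proof (rule the_equality)
    show "geodesic (g t) c \<and> c 0 = z \<and> velocity c 0 = matrix_inv (g t z) *v v"
      using ham_imp_geodesic[OF h(1)] h(2,3) by (simp add: A_def G_def)
    fix c' assume c': "geodesic (g t) c' \<and> c' 0 = z \<and> velocity c' 0 = matrix_inv (g t z) *v v"
    have "velocity c' 0 = A (t, z) *v v" using c' by (simp add: A_def G_def)
    then have "G (t, c' 0) *v velocity c' 0 = v" using c' by simp
    then show "c' = c"
      using ham_unique(1)[OF order_refl geodesic_imp_ham[of t c'] h(1), of 0] c' h by simp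
  qed
  then show ?thesis using that h by blast
qed

lemma ham_energy_constant:
  assumes "ham 0 t c \<theta>"
  shows "\<theta> r \<bullet> (A (t, c r) *v \<theta> r) = \<theta> s \<bullet> (A (t, c s) *v \<theta> s)"
proof -
  have "((\<lambda>r. \<theta> r \<bullet> (A (t, c r) *v \<theta> r)) has_real_derivative 0) (at r)" for r
    using energy_has_derivative[of "\<lambda>r. t" 0 r c 1 \<theta>] assms by (simp add: ham_def ham_at_def)
  then show ?thesis
    using DERIV_isconst_all[of "\<lambda>r. \<theta> r \<bullet> (A (t, c r) *v \<theta> r)" r s] by blast
qed

text \<open>With f the squared distance from the origin, the inward start makes f drop below its
  initial value, and non-trapping makes it return. Before the first return f stays below its value
  at the exit, so it cannot be strictly decreasing there and the velocity does not point inward;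
  tangential exit remains possible. The energy is constant and equal to 1, so length is parameter
  time.\<close>

lemma geodesic_exit:
  assumes nt: "nontrapping (g t)" and z: "norm z = R" and v: "norm v = 1" "z \<bullet> v < 0"
    and h: "ham 0 t (geodesic_from (g t) z v) \<theta>" "geodesic_from (g t) z v 0 = z" "\<theta> 0 = v"
  defines "c \<equiv> geodesic_from (g t) z v"
  defines "l \<equiv> exit_time R c"
  shows "norm (c l) = R" "0 \<le> c l \<bullet> \<theta> l" "norm (\<theta> l) = 1" "curve_length (g t) c 0 l = l" "0 < l"
proof -
  note h = h[folded c_def]
  have A1: "A (t, c s) = mat 1" if "R \<le> norm (c s)" for s using that by (simp add: A_outside)
  have energy: "\<theta> s \<bullet> (A (t, c s) *v \<theta> s) = 1" for s
    using ham_energy_constant[OF h(1), of s 0] h A1[of 0] z v by (simp flip: power2_norm_eq_inner)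
  have dc: "(c has_vector_derivative A (t, c s) *v \<theta> s) (at s)" for s
    using h(1) by (simp add: ham_def ham_at_def)
  then have cc: "continuous_on S c" for S
    by (meson continuous_at_imp_continuous_on continuous_on_subset has_vector_derivative_continuous top_greatest)
  define f where "f s = c s \<bullet> c s" for s
  have df: "(f has_real_derivative 2 * (c s \<bullet> (A (t, c s) *v \<theta> s))) (at s)" for s
    unfolding f_def has_field_derivative_def
    by (rule derivative_eq_intros dc[unfolded has_vector_derivative_def] refl)+
      (auto simp: inner_commute)
  have norm_f: "norm (c s) < R \<longleftrightarrow> f s < R\<^sup>2" for s
    unfolding f_def power2_norm_eq_inner[symmetric]
    using R_pos by (auto intro: power_strict_mono power2_less_imp_less)
  define S where "S = {s. 0 < s \<and> c s \<notin> ball 0 R}"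
  have S: "s \<in> S \<longleftrightarrow> 0 < s \<and> R \<le> norm (c s)" for s by (auto simp: S_def)
  have "2 * (c 0 \<bullet> (A (t, c 0) *v \<theta> 0)) < 0" using A1[of 0] h z v by simp
  then obtain d where d: "0 < d" "\<And>r. 0 < r \<Longrightarrow> r < d \<Longrightarrow> f r < f 0"
    using DERIV_neg_dec_right[OF df] by (metis add_0)
  have f0: "f 0 = R\<^sup>2" using h z by (simp add: f_def flip: power2_norm_eq_inner)
  \<comment> \<open>The condition 0 < s is not closed. As the curve is strictly inside for 0 < s < d
    it may be replaced by d \<le> s, so that the infimum is attained.\<close>
  have S': "S = {s. d \<le> s \<and> R \<le> norm (c s)}"
  proof (intro set_eqI iffI)
    fix s assume "s \<in> S"
    then have "0 < s" "\<not> f s < R\<^sup>2" by (auto simp: S simp flip: norm_f)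
    then show "s \<in> {s. d \<le> s \<and> R \<le> norm (c s)}" using d(2)[of s] f0 \<open>s \<in> S\<close> S by force
  qed (use d in \<open>auto simp: S\<close>)
  have "closed S"
    unfolding S' by (intro closed_Collect_conj closed_Collect_le continuous_intros cc)
  moreover have "S \<noteq> {}"
  proof -
    have "velocity c 0 \<noteq> 0" using ham_imp_geodesic(2)[OF h(1), of 0] A1[of 0] h z v by auto
    then have "\<forall>\<^sub>F s in at_top. c s \<notin> cball 0 R"
      using nt[unfolded nontrapping_def, rule_format, of c "cball 0 R"] ham_imp_geodesic(1)[OF h(1)] by simp
    then obtain N where "\<And>s. N \<le> s \<Longrightarrow> c s \<notin> cball 0 R"
      unfolding eventually_at_top_linorder by metis
    from this[of "max N 1"] have "max N 1 \<in> S" by (simp add: S)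
    then show ?thesis by blast
  qed
  moreover have bdd: "bdd_below S" by (auto simp: S' intro!: bdd_belowI[of _ d])
  ultimately have "l \<in> S"
    unfolding l_def exit_time_def S_def[symmetric] by (intro closed_contains_Inf)
  then have l: "0 < l" "R \<le> norm (c l)" by (auto simp: S)
  then show "0 < l" by blast
  have before: "f s < R\<^sup>2" if "0 < s" "s < l" for s
  proof -
    have "l = Inf S" unfolding l_def exit_time_def S_def ..
    then have "s \<notin> S" using that cInf_lower[OF _ bdd, of s] by auto
    then show ?thesis using that by (auto simp: S simp flip: norm_f)
  qed
  have near: "\<forall>\<^sub>F s in at_left l. f s < R\<^sup>2"
    using eventually_at_left_real[OF l(1)] by eventually_elim (auto intro: before)
  have "(f \<longlongrightarrow> f l) (at_left l)"
    using DERIV_isCont[OF df[of l]] by (simp add: isCont_def filterlim_at_split)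
  then have "f l \<le> R\<^sup>2"
    by (rule tendsto_upperbound[OF _ eventually_mono[OF near less_imp_le]]) auto
  then have "norm (c l) \<le> R"
    unfolding f_def power2_norm_eq_inner[symmetric] using R_pos by (rule power2_le_imp_le[OF _ less_imp_le])
  with l show nl: "norm (c l) = R" by simp
  show "0 \<le> c l \<bullet> \<theta> l"
  proof (rule ccontr)
    assume "\<not> ?thesis"
    then have "2 * (c l \<bullet> (A (t, c l) *v \<theta> l)) < 0" using A1[of l] l by simp
    then obtain d where d: "0 < d" "\<And>r. 0 < r \<Longrightarrow> r < d \<Longrightarrow> f l < f (l - r)"
      using DERIV_neg_dec_left[OF df] by metis
    have "f l < f (l - min (d/2) (l/2))" using d l by (intro d) auto
    moreover have "f (l - min (d/2) (l/2)) < R\<^sup>2" using d l by (intro before) auto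
    moreover have "f l = R\<^sup>2" using nl by (simp add: f_def flip: power2_norm_eq_inner)
    ultimately show False by simp
  qed
  show "norm (\<theta> l) = 1"
    using energy[of l] A1[of l] l by (simp add: norm_eq_1)
  have "velocity c s \<bullet> (g t (c s) *v velocity c s) = 1" for s
  proof -
    have "g t (c s) *v velocity c s = \<theta> s"
      using G_A_vec[of "(t, c s)"] by (simp add: ham_imp_geodesic(2)[OF h(1)] G_def)
    then show ?thesis using energy[of s] by (simp add: ham_imp_geodesic(2)[OF h(1)] inner_commute)
  qed
  then show "curve_length (g t) c 0 l = l" using l by (simp add: curve_length_def)
qed

end

section \<open>Bicharacteristics and the scattering map\<close>

lemma norm_orthogonal_diff:
  assumes "norm y = 1" "e \<bullet> y = 0"
  shows "(norm (a *\<^sub>R y - e))\<^sup>2 = a\<^sup>2 + (norm e)\<^sup>2"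
  using norm_add_Pythagorean[of "a *\<^sub>R y" "- e"] assms
  by (simp add: orthogonal_def inner_commute)

lemma filterlim_affine:
  fixes c d :: real
  assumes "0 < c"
  shows "filterlim (\<lambda>s. c * s + d) at_bot at_bot" "filterlim (\<lambda>s. c * s + d) at_top at_top"
proof -
  show "filterlim (\<lambda>s. c * s + d) at_bot at_bot"
    unfolding filterlim_at_bot
  proof
    fix Z
    show "\<forall>\<^sub>F s in at_bot. c * s + d \<le> Z"
      using eventually_le_at_bot[of "(Z - d) / c"]
      by eventually_elim (use assms in \<open>simp add: field_simps\<close>)
  qed
  show "filterlim (\<lambda>s. c * s + d) at_top at_top"
    unfolding filterlim_at_top
  proof
    fix Z
    show "\<forall>\<^sub>F s in at_top. Z \<le> c * s + d"
      using eventually_ge_at_top[of "(Z - d) / c"]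
      by eventually_elim (use assms in \<open>simp add: field_simps\<close>)
  qed
qed

context perturbed_metric
begin

lemma symbol_p_eq: "symbol_p g z t \<zeta> \<tau> = \<tau> + \<zeta> \<bullet> (A (t, z) *v \<zeta>)"
  by (simp add: symbol_p_def A_def G_def)

lemma grad_eqI:
  assumes "(f has_derivative (\<lambda>h. v \<bullet> h)) (at x)"
  shows "grad f x = v"
  using frechet_derivative_at[OF assms] 
  by (simp add: grad_def partial_deriv_def vec_eq_iff inner_axis flip: frechet_derivative_at[OF assms])

lemma grad_symbol_covector: "grad (\<lambda>w. symbol_p g z t w \<tau>) \<zeta> = 2 *\<^sub>R (A (t, z) *v \<zeta>)"
proof (rule grad_eqI)
  have "((\<lambda>w. \<tau> + w \<bullet> (A (t, z) *v w)) has_derivative (\<lambda>h. 0 + (\<zeta> \<bullet> (A (t, z) *v h) + h \<bullet> (A (t, z) *v \<zeta>)))) (at \<zeta>)"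
    using has_derivative_add[OF has_derivative_const[of \<tau>] has_derivative_inner[OF has_derivative_ident
        bounded_linear.has_derivative[OF matrix_vector_mul_bounded_linear[of "A (t, z)"] has_derivative_ident]]] .
  then show "((\<lambda>w. symbol_p g z t w \<tau>) has_derivative (\<lambda>h. (2 *\<^sub>R (A (t, z) *v \<zeta>)) \<bullet> h)) (at \<zeta>)"
    unfolding symbol_p_eq
  proof (rule has_derivative_eq_rhs, intro ext)
    fix h
    show "0 + (\<zeta> \<bullet> (A (t, z) *v h) + h \<bullet> (A (t, z) *v \<zeta>)) = (2 *\<^sub>R (A (t, z) *v \<zeta>)) \<bullet> h"
      using A_inner[of "(t, z)" \<zeta> h] inner_commute[of h "A (t, z) *v \<zeta>"] by simp
  qed
qed

lemma symbol_derivative: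
  "((\<lambda>x. \<tau> + \<zeta> \<bullet> (A x *v \<zeta>)) has_derivative (\<lambda>h. - ((A x *v \<zeta>) \<bullet> (dG x h *v (A x *v \<zeta>))))) (at x)"
proof -
  interpret bilin: bounded_bilinear "(*v) :: real^'n^'n \<Rightarrow> real^'n \<Rightarrow> real^'n"
    by (rule bounded_bilinear_matrix_vector)
  have "((\<lambda>x. \<tau> + \<zeta> \<bullet> (A x *v \<zeta>)) has_derivative
      (\<lambda>h. 0 + \<zeta> \<bullet> ((- (A x ** dG x h ** A x)) *v \<zeta>))) (at x)"
    using has_derivative_add[OF has_derivative_const[of \<tau>]
      bounded_linear.has_derivative[OF bounded_linear_inner_right[of \<zeta>]
        bounded_linear.has_derivative[OF bilin.bounded_linear_left[of \<zeta>] A_has_derivative[of x]]]] .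
  then show ?thesis
    by (rule has_derivative_eq_rhs)
      (auto simp: bilin.minus_left A_inner simp flip: matrix_vector_mul_assoc)
qed

lemma grad_symbol_position: "grad (\<lambda>w. symbol_p g w t \<zeta> \<tau>) z = - force (t, z) (A (t, z) *v \<zeta>)"
proof (rule grad_eqI)
  have "((\<lambda>w. (t, w)) has_derivative (\<lambda>h. (0, h))) (at z)"
    by (auto intro!: derivative_eq_intros)
  from has_derivative_compose[OF this symbol_derivative]
  show "((\<lambda>w. symbol_p g w t \<zeta> \<tau>) has_derivative (\<lambda>h. (- force (t, z) (A (t, z) *v \<zeta>)) \<bullet> h)) (at z)"
    by (simp add: symbol_p_eq force_inner)
qed

lemma deriv_symbol_tau: "deriv (\<lambda>r. symbol_p g z t \<zeta> r) \<tau> = 1"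
  by (rule DERIV_imp_deriv) (auto simp: symbol_p_eq intro!: derivative_eq_intros)

lemma deriv_symbol_time:
  "deriv (\<lambda>r. symbol_p g z r \<zeta> \<tau>) t = - ((A (t, z) *v \<zeta>) \<bullet> (dG (t, z) (1, 0) *v (A (t, z) *v \<zeta>)))"
proof (rule DERIV_imp_deriv)
  have "((\<lambda>r. (r, z)) has_derivative (\<lambda>h. (h, 0))) (at t)"
    by (auto intro!: derivative_eq_intros)
  from has_derivative_compose[OF this symbol_derivative]
  have "((\<lambda>r. symbol_p g z r \<zeta> \<tau>) has_derivative
     (\<lambda>h. - ((A (t, z) *v \<zeta>) \<bullet> (dG (t, z) (h, 0) *v (A (t, z) *v \<zeta>))))) (at t)"
    by (simp add: symbol_p_eq)
  moreover have "- ((A (t, z) *v \<zeta>) \<bullet> (dG (t, z) (h, 0) *v (A (t, z) *v \<zeta>))) =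
      - ((A (t, z) *v \<zeta>) \<bullet> (dG (t, z) (1, 0) *v (A (t, z) *v \<zeta>))) * h" for h
  proof -
    have h: "dG (t, z) (h, 0) = h *\<^sub>R dG (t, z) (1, 0)"
      using dG_scale[of "(t, z)" h "(1, 0)"] by simp
    show ?thesis
      by (subst h) (simp add: bounded_bilinear.scaleR_left[OF bounded_bilinear_matrix_vector])
  qed
  ultimately show "((\<lambda>r. symbol_p g z r \<zeta> \<tau>) has_real_derivative
     - ((A (t, z) *v \<zeta>) \<bullet> (dG (t, z) (1, 0) *v (A (t, z) *v \<zeta>)))) (at t)"
    unfolding has_field_derivative_def by (rule has_derivative_eq_rhs[OF _ ext])
qed

lemma null_bicharacteristic_iff:
  "null_bicharacteristic g z t \<zeta> \<tau> \<longleftrightarrow>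
     (\<forall>s. \<tau> s = - (\<zeta> s \<bullet> (A (t s, z s) *v \<zeta> s)) \<and>
       (z has_vector_derivative 2 *\<^sub>R (A (t s, z s) *v \<zeta> s)) (at s) \<and>
       (\<zeta> has_vector_derivative force (t s, z s) (A (t s, z s) *v \<zeta> s)) (at s) \<and>
       (t has_real_derivative 1) (at s) \<and>
       (\<tau> has_real_derivative (A (t s, z s) *v \<zeta> s) \<bullet> (dG (t s, z s) (1, 0) *v (A (t s, z s) *v \<zeta> s))) (at s))"
  unfolding null_bicharacteristic_def grad_symbol_covector grad_symbol_position deriv_symbol_tau
    deriv_symbol_time minus_minus
  by (simp only: symbol_p_eq eq_neg_iff_add_eq_0)

text \<open>The shift \<open>t0 - t 0\<close> makes the physical time equal to \<open>t0\<close> +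
  \<epsilon> r. The factor 2 \<epsilon> on the momentum fits both equations because the velocity is
  linear and the force quadratic in it.\<close>

lemma bicharacteristic_imp_ham:
  assumes "null_bicharacteristic g z t \<zeta> \<tau>"
  shows "t s = s + t 0"
    and "ham \<epsilon> t0 (\<lambda>r. z (\<epsilon> * r + (t0 - t 0))) (\<lambda>r. (2 * \<epsilon>) *\<^sub>R \<zeta> (\<epsilon> * r + (t0 - t 0)))"
proof -
  note b = assms[unfolded null_bicharacteristic_iff, rule_format]
  have "((\<lambda>s. t s - s) has_real_derivative 0) (at s)" for s
    using b by (auto intro!: derivative_eq_intros)
  then have t': "t s - s = t 0 - 0" for s
    using DERIV_isconst_all[of "\<lambda>s. t s - s" s 0] by blast
  show t: "t s = s + t 0" for s using t'[of s] by linarith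
  show "ham \<epsilon> t0 (\<lambda>r. z (\<epsilon> * r + (t0 - t 0))) (\<lambda>r. (2 * \<epsilon>) *\<^sub>R \<zeta> (\<epsilon> * r + (t0 - t 0)))"
    unfolding ham_def ham_at_def
  proof (intro allI conjI)
    fix r
    define u where "u = \<epsilon> * r + (t0 - t 0)"
    have tu: "t u = t0 + \<epsilon> * r" by (simp add: u_def t[of "\<epsilon> * r + (t0 - t 0)"])
    have dz: "(z has_vector_derivative 2 *\<^sub>R (A (t u, z u) *v \<zeta> u)) (at u)"
      and d\<zeta>: "(\<zeta> has_vector_derivative force (t u, z u) (A (t u, z u) *v \<zeta> u)) (at u)" using b by blast+
    show "((\<lambda>r. z (\<epsilon> * r + (t0 - t 0))) has_vector_derivative
        A (t0 + \<epsilon> * r, z (\<epsilon> * r + (t0 - t 0))) *v ((2 * \<epsilon>) *\<^sub>R \<zeta> (\<epsilon> * r + (t0 - t 0)))) (at r)"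
      using has_vector_derivative_affine[OF dz[unfolded u_def]]
      by (simp add: u_def[symmetric] tu matrix_vector_mult_scaleR mult.commute)
    have "((\<lambda>r. (2 * \<epsilon>) *\<^sub>R \<zeta> (\<epsilon> * r + (t0 - t 0))) has_vector_derivative
        (2 * \<epsilon>) *\<^sub>R (\<epsilon> *\<^sub>R force (t u, z u) (A (t u, z u) *v \<zeta> u))) (at r)"
      using bounded_linear.has_vector_derivative[OF bounded_linear_scaleR_right
          has_vector_derivative_affine[OF d\<zeta>[unfolded u_def]], of "2 * \<epsilon>"] by (simp add: u_def)
    then show "((\<lambda>r. (2 * \<epsilon>) *\<^sub>R \<zeta> (\<epsilon> * r + (t0 - t 0))) has_vector_derivative
        (1/2) *\<^sub>R force (t0 + \<epsilon> * r, z (\<epsilon> * r + (t0 - t 0)))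
          (A (t0 + \<epsilon> * r, z (\<epsilon> * r + (t0 - t 0))) *v ((2 * \<epsilon>) *\<^sub>R \<zeta> (\<epsilon> * r + (t0 - t 0))))) (at r)"
      by (simp add: u_def[symmetric] tu matrix_vector_mult_scaleR force_scale power2_eq_square mult_ac)
  qed
qed

lemma ham_imp_bicharacteristic:
  assumes h: "ham \<epsilon> t0 z \<theta>" and \<epsilon>: "0 < \<epsilon>"
  defines "a \<equiv> \<lambda>s. (1/\<epsilon>) * s + (- t0 / \<epsilon>)"
  obtains \<tau> where "null_bicharacteristic g (\<lambda>s. z (a s)) (\<lambda>s. s) (\<lambda>s. (1 / (2 * \<epsilon>)) *\<^sub>R \<theta> (a s)) \<tau>"
proof -
  define \<zeta> where "\<zeta> s = (1 / (2 * \<epsilon>)) *\<^sub>R \<theta> (a s)" for s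
  have a: "t0 + \<epsilon> * a s = s" for s using \<epsilon> by (simp add: a_def field_simps)
  have dz: "((\<lambda>s. z (a s)) has_vector_derivative 2 *\<^sub>R (A (s, z (a s)) *v \<zeta> s)) (at s)" for s
  proof -
    have "(z has_vector_derivative A (s, z (a s)) *v \<theta> (a s)) (at (a s))"
      using h[unfolded ham_def ham_at_def, rule_format, of "a s"] by (simp add: a)
    from has_vector_derivative_affine[OF this[unfolded a_def]] show ?thesis
      using \<epsilon> by (simp add: a_def \<zeta>_def matrix_vector_mult_scaleR)
  qed
  have d\<zeta>: "(\<zeta> has_vector_derivative force (s, z (a s)) (A (s, z (a s)) *v \<zeta> s)) (at s)" for s
  proof -
    have "(\<theta> has_vector_derivative (1/2) *\<^sub>R force (s, z (a s)) (A (s, z (a s)) *v \<theta> (a s))) (at (a s))"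
      using h[unfolded ham_def ham_at_def, rule_format, of "a s"] by (simp add: a)
    from bounded_linear.has_vector_derivative[OF bounded_linear_scaleR_right
        has_vector_derivative_affine[OF this[unfolded a_def]], of "1 / (2 * \<epsilon>)"]
    show ?thesis
      using \<epsilon> unfolding \<zeta>_def a_def[symmetric]
      by (simp add: matrix_vector_mult_scaleR force_scale power2_eq_square a_def)
  qed
  have "null_bicharacteristic g (\<lambda>s. z (a s)) (\<lambda>s. s) \<zeta> (\<lambda>s. - (\<zeta> s \<bullet> (A (s, z (a s)) *v \<zeta> s)))"
    unfolding null_bicharacteristic_iff
  proof (intro allI conjI refl dz d\<zeta>)
    fix s
    show t: "((\<lambda>s. s) has_real_derivative 1) (at s)" by simp
    \<comment> \<open>The equation for \<tau> is the energy identity with unit rate of time and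
      common factor 2, since \<tau> is minus the energy on the characteristic set.\<close>
    from DERIV_minus[OF energy_has_derivative[of "\<lambda>s. s" 1 s "\<lambda>s. z (a s)" 2 \<zeta>, OF t dz]] d\<zeta>
    show "((\<lambda>s. - (\<zeta> s \<bullet> (A (s, z (a s)) *v \<zeta> s))) has_real_derivative
        (A (s, z (a s)) *v \<zeta> s) \<bullet> (dG (s, z (a s)) (1, 0) *v (A (s, z (a s)) *v \<zeta> s))) (at s)"
      by simp
  qed
  then show ?thesis using that by (simp add: \<zeta>_def[abs_def])
qed

text \<open>The bicharacteristic issuing from \<open>(Z, Z')\<close> in the time \<open>r\<close> for which the incoming
  motion has unit speed: with \<open>\<epsilon> = 1 / (2 * \<bar>Z\<bar>)\<close> the line is \<open>r y - \<eta>\<close>, \<open>t = - \<xi> / 2 + \<epsilon> r\<close>.\<close>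

definition incoming :: "(real^'n) \<times> (real^'n) \<Rightarrow> (real \<Rightarrow> real^'n) \<Rightarrow> (real \<Rightarrow> real^'n) \<Rightarrow> bool" where
  "incoming w z \<theta> \<longleftrightarrow> ham (bdf w / 2) (- xi_1c w / 2) z \<theta> \<and>
     z (- R) = (- R) *\<^sub>R angle w - eta_1c w \<and> \<theta> (- R) = angle w"

lemma incoming_exists: "\<exists>z \<theta>. incoming w z \<theta>"
  unfolding incoming_def
  by (rule ham_exists[of "bdf w / 2" "- xi_1c w / 2" "- R" "(- R) *\<^sub>R angle w - eta_1c w" "angle w"])
    (auto simp: bdf_def)

lemma norm_angle: "fst w \<noteq> 0 \<Longrightarrow> norm (angle w) = 1"
  by (simp add: angle_def)

lemma eta_orthogonal: "fst w \<noteq> 0 \<Longrightarrow> eta_1c w \<bullet> angle w = 0"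
  using norm_angle[of w] by (simp add: eta_1c_def inner_diff_left norm_eq_1)

lemma angle_scale: "fst w \<noteq> 0 \<Longrightarrow> bdf w *\<^sub>R fst w = angle w"
  by (simp add: angle_def bdf_def divide_inverse)

text \<open>The time origin - \<xi> / 2 is the moment of closest approach to the origin: it removes
  the component of the covector along \<open>angle w\<close>, and - \<eta> is the point reached at r
  = 0.\<close>

lemma line_parameter:
  assumes "fst w \<noteq> 0"
  shows "(2 * (- xi_1c w / 2 + bdf w / 2 * r)) *\<^sub>R fst w - snd w = r *\<^sub>R angle w - eta_1c w"
proof -
  have "(2 * (- xi_1c w / 2 + bdf w / 2 * r)) *\<^sub>R fst w = (snd w \<bullet> angle w + r) *\<^sub>R (bdf w *\<^sub>R fst w)"
    by (simp add: xi_1c_def algebra_simps)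
  then show ?thesis by (simp only: angle_scale[OF assms]) (simp add: eta_1c_def algebra_simps)
qed

text \<open>Since \<eta> is orthogonal to the direction of motion, at r = - R the point on the line
  is at distance at least R from the origin and moves inward; its whole past is therefore
  free.\<close>

lemma incoming_free:
  assumes "incoming w z \<theta>" "fst w \<noteq> 0" "r \<le> - R"
  shows "z r = r *\<^sub>R angle w - eta_1c w" "\<theta> r = angle w"
proof -
  let ?y = "angle w"
  note i = assms(1)[unfolded incoming_def]
  have y: "?y \<bullet> ?y = 1" "?y \<bullet> eta_1c w = 0"
    using norm_angle[OF assms(2)] eta_orthogonal[OF assms(2)] by (auto simp: norm_eq_1 inner_commute)
  have z: "z (- R) = (- R) *\<^sub>R ?y - eta_1c w" "\<theta> (- R) = ?y" using i by blast+
  have "R\<^sup>2 \<le> (norm (z (- R)))\<^sup>2"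
    unfolding z norm_orthogonal_diff[OF norm_angle[OF assms(2)] eta_orthogonal[OF assms(2)]] by simp
  then have "R \<le> norm (z (- R))" by (rule power2_le_imp_le) simp
  moreover have "0 \<le> (r - (- R)) * (z (- R) \<bullet> \<theta> (- R))"
  proof -
    have "z (- R) \<bullet> \<theta> (- R) = - R" unfolding z using y(1) eta_orthogonal[OF assms(2)] by (simp add: inner_diff_left)
    then show ?thesis using assms(3) R_pos by (simp add: mult_nonpos_nonneg)
  qed
  moreover have "0 \<le> bdf w / 2" by (simp add: bdf_def)
  ultimately show "z r = r *\<^sub>R ?y - eta_1c w" "\<theta> r = ?y"
    using ham_free[of "bdf w / 2" "- xi_1c w / 2" z \<theta> "- R" r] i by (auto simp: algebra_simps)
qed

text \<open>A bicharacteristic with incoming asymptotics w, suitably rescaled, agrees with the ray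
  at one early time and hence everywhere. The relation thus becomes a statement about the future of
  a single ray.\<close>

lemma scatters_to_iff:
  assumes i: "incoming w z \<theta>" and w: "fst w \<noteq> 0"
  shows "scatters_to g w w' \<longleftrightarrow>
    (\<forall>\<^sub>F r in at_top. \<theta> r = bdf w *\<^sub>R fst w' \<and>
       z r = (2 * (- xi_1c w / 2 + bdf w / 2 * r)) *\<^sub>R fst w' - snd w')"
    (is "_ \<longleftrightarrow> ?asym w'")
proof
  define \<epsilon> where "\<epsilon> = bdf w / 2"
  define t0 where "t0 = - xi_1c w / 2"
  have \<epsilon>: "0 < \<epsilon>" using w by (simp add: \<epsilon>_def bdf_def)
  note h = i[unfolded incoming_def, folded \<epsilon>_def t0_def]
  {
    assume a: "?asym w'"
    define a where "a s = (1/\<epsilon>) * s + (- t0 / \<epsilon>)" for s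
    obtain \<tau> where \<tau>: "null_bicharacteristic g (\<lambda>s. z (a s)) (\<lambda>s. s) (\<lambda>s. (1 / (2 * \<epsilon>)) *\<^sub>R \<theta> (a s)) \<tau>"
      using ham_imp_bicharacteristic[OF h[THEN conjunct1] \<epsilon>] unfolding a_def by blast
    have eq: "2 * (t0 + \<epsilon> * a s) = 2 * s" "2 * t0 + 2 * (\<epsilon> * a s) = 2 * s" for s
      using \<epsilon> by (simp_all add: a_def field_simps)
    have eq': "bdf w * a s - xi_1c w = 2 * s" for s
      using eq(2)[of s] by (simp add: t0_def \<epsilon>_def)
    have "filterlim a at_bot at_bot" "filterlim a at_top at_top"
      unfolding a_def using \<epsilon> by (intro filterlim_affine; simp)+
    show "scatters_to g w w'"
      unfolding scatters_to_def
    proof (intro exI conjI, rule \<tau>)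
      have "\<forall>\<^sub>F r in at_bot. \<theta> r = (2 * \<epsilon>) *\<^sub>R fst w \<and> z r = (2 * (t0 + \<epsilon> * r)) *\<^sub>R fst w - snd w"
        using eventually_le_at_bot[of "- R"]
      proof eventually_elim
        case (elim r)
        show ?case
          using incoming_free[OF i w elim] line_parameter[OF w, of r] angle_scale[OF w]
          unfolding \<epsilon>_def t0_def by simp
      qed
      from eventually_compose_filterlim[OF this \<open>filterlim a at_bot at_bot\<close>]
      show "\<forall>\<^sub>F s in at_bot. (1 / (2 * \<epsilon>)) *\<^sub>R \<theta> (a s) = fst w \<and> z (a s) = (2 * s) *\<^sub>R fst w - snd w"
        by (rule eventually_mono) (use \<epsilon> in \<open>simp add: eq\<close>)
      from eventually_compose_filterlim[OF a \<open>filterlim a at_top at_top\<close>]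
      show "\<forall>\<^sub>F s in at_top. (1 / (2 * \<epsilon>)) *\<^sub>R \<theta> (a s) = fst w' \<and> z (a s) = (2 * s) *\<^sub>R fst w' - snd w'"
        by (rule eventually_mono) (use \<epsilon> in \<open>simp add: \<epsilon>_def eq'\<close>)
    qed
  }
  assume "scatters_to g w w'"
  then obtain z' t \<zeta> \<tau> where b: "null_bicharacteristic g z' t \<zeta> \<tau>"
    "\<forall>\<^sub>F s in at_bot. \<zeta> s = fst w \<and> z' s = (2 * t s) *\<^sub>R fst w - snd w"
    "\<forall>\<^sub>F s in at_top. \<zeta> s = fst w' \<and> z' s = (2 * t s) *\<^sub>R fst w' - snd w'"
    unfolding scatters_to_def by blast
  define a where "a r = \<epsilon> * r + (t0 - t 0)" for r
  have lim: "filterlim a at_bot at_bot" "filterlim a at_top at_top"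
    unfolding a_def using \<epsilon> by (intro filterlim_affine; simp)+
  have ta: "t (a r) = t0 + \<epsilon> * r" for r
    using bicharacteristic_imp_ham(1)[OF b(1), of "a r"] by (simp add: a_def)
  have h': "ham \<epsilon> t0 (\<lambda>r. z' (a r)) (\<lambda>r. (2 * \<epsilon>) *\<^sub>R \<zeta> (a r))"
    unfolding a_def by (rule bicharacteristic_imp_ham(2)[OF b(1)])
  have "\<forall>\<^sub>F r in at_bot. (\<zeta> (a r) = fst w \<and> z' (a r) = (2 * t (a r)) *\<^sub>R fst w - snd w) \<and> r \<le> - R"
    using eventually_compose_filterlim[OF b(2) lim(1)] eventually_le_at_bot by (rule eventually_conj)
  \<comment> \<open>At such a time both rays lie on their common incoming line at the same physical
    time, so uniqueness applies.\<close>
  then obtain r0 where r0: "\<zeta> (a r0) = fst w" "z' (a r0) = (2 * t (a r0)) *\<^sub>R fst w - snd w" "r0 \<le> - R"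
    using eventually_happens'[OF trivial_limit_at_bot_linorder] by blast
  have eq1: "z r0 = z' (a r0)"
    using r0(2) incoming_free(1)[OF i w r0(3)] line_parameter[OF w, of r0] by (simp add: ta \<epsilon>_def t0_def)
  have eq2: "\<theta> r0 = (2 * \<epsilon>) *\<^sub>R \<zeta> (a r0)"
    using incoming_free(2)[OF i w r0(3)] angle_scale[OF w] by (simp add: r0(1) \<epsilon>_def)
  note eqs = ham_unique[OF less_imp_le[OF \<epsilon>] conjunct1[OF h] h' eq1 eq2]
  show "?asym w'"
  proof (rule eventually_mono[OF eventually_compose_filterlim[OF b(3) lim(2)]])
    fix r assume r: "\<zeta> (a r) = fst w' \<and> z' (a r) = (2 * t (a r)) *\<^sub>R fst w' - snd w'"
    have "\<theta> r = (2 * \<epsilon>) *\<^sub>R fst w'" "z r = (2 * (t0 + \<epsilon> * r)) *\<^sub>R fst w' - snd w'"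
      using fun_cong[OF eqs(1), of r] fun_cong[OF eqs(2), of r] r ta[of r] by simp_all
    then show "\<theta> r = bdf w *\<^sub>R fst w' \<and>
        z r = (2 * (- xi_1c w / 2 + bdf w / 2 * r)) *\<^sub>R fst w' - snd w'"
      by (simp add: \<epsilon>_def t0_def)
  qed
qed

text \<open>After r the motion is free, and comparing the free line with 2 t Z - Z' at any single
  later time determines Z and Z'. This also shows that the description by \<open>THE\<close> has
  exactly one solution.\<close>

lemma scattering_map_eq:
  assumes i: "incoming w z \<theta>" and w: "fst w \<noteq> 0"
    and out: "R \<le> norm (z r)" "0 \<le> z r \<bullet> \<theta> r"
  shows "scattering_map g w = (\<theta> r /\<^sub>R bdf w, (r - xi_1c w / bdf w) *\<^sub>R \<theta> r - z r)"
proof -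
  have b: "0 < bdf w" using w by (simp add: bdf_def)
  have free: "z u = z r + (u - r) *\<^sub>R \<theta> r" "\<theta> u = \<theta> r" if "r \<le> u" for u
    using ham_free[of "bdf w / 2" "- xi_1c w / 2" z \<theta> r u] i out that b by (auto simp: incoming_def)
  have iff: "\<theta> u = bdf w *\<^sub>R fst w' \<and> z u = (2 * (- xi_1c w / 2 + bdf w / 2 * u)) *\<^sub>R fst w' - snd w' \<longleftrightarrow>
      w' = (\<theta> r /\<^sub>R bdf w, (r - xi_1c w / bdf w) *\<^sub>R \<theta> r - z r)" if u: "r \<le> u" for u w'
  proof -
    have "\<theta> u = bdf w *\<^sub>R fst w' \<longleftrightarrow> fst w' = \<theta> r /\<^sub>R bdf w"
      using b free[OF u] by (auto simp: divideR_right)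
    moreover have "z u = (2 * (- xi_1c w / 2 + bdf w / 2 * u)) *\<^sub>R (\<theta> r /\<^sub>R bdf w) - snd w' \<longleftrightarrow>
        snd w' = (r - xi_1c w / bdf w) *\<^sub>R \<theta> r - z r"
    proof -
      have eq: "(2 * (- xi_1c w / 2 + bdf w / 2 * u)) *\<^sub>R (\<theta> r /\<^sub>R bdf w) = (u - xi_1c w / bdf w) *\<^sub>R \<theta> r"
      proof -
        have "2 * (- xi_1c w / 2 + bdf w / 2 * u) * inverse (bdf w) = u - xi_1c w / bdf w"
          using b by (simp add: field_simps)
        then show ?thesis by (simp only: scaleR_scaleR)
      qed
      show ?thesis by (subst eq, subst free(1)[OF u]) (auto simp: algebra_simps)
    qed
    ultimately show ?thesis by (cases w') auto
  qed
  have "scatters_to g w w' \<longleftrightarrow> w' = (\<theta> r /\<^sub>R bdf w, (r - xi_1c w / bdf w) *\<^sub>R \<theta> r - z r)" for w'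
  proof -
    have "scatters_to g w w' \<longleftrightarrow>
        (\<forall>\<^sub>F u :: real in at_top. w' = (\<theta> r /\<^sub>R bdf w, (r - xi_1c w / bdf w) *\<^sub>R \<theta> r - z r))"
      unfolding scatters_to_iff[OF i w]
      by (intro eventually_cong[OF eventually_ge_at_top[of r]]) (rule iff)
    then show ?thesis by simp
  qed
  then have "scatters_to g w = (\<lambda>w'. w' = (\<theta> r /\<^sub>R bdf w, (r - xi_1c w / bdf w) *\<^sub>R \<theta> r - z r))"
    by blast
  then show ?thesis unfolding scattering_map_def by simp
qed

end

section \<open>High-frequency limits\<close>

lemma tendsto_radial:
  fixes f :: "'b \<Rightarrow> 'a::real_normed_vector"
  assumes "(f \<longlongrightarrow> q) F"
  shows "((\<lambda>k. radial (f k)) \<longlongrightarrow> radial q) F"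
proof -
  have "sqrt (1 + (norm q)\<^sup>2) \<noteq> 0"
    by (simp add: add_nonneg_eq_0_iff)
  then show ?thesis unfolding radial_def by (intro tendsto_intros assms)
qed

definition unradial :: "'a::real_normed_vector \<Rightarrow> 'a" where
  "unradial r = r /\<^sub>R sqrt (1 - (norm r)\<^sup>2)"

lemma radial_gap: "1 - (norm (radial q))\<^sup>2 = 1 / (1 + (norm q)\<^sup>2)"
proof -
  have p: "0 < 1 + (norm q)\<^sup>2" by (simp add: add_pos_nonneg)
  then have "(norm (radial q))\<^sup>2 = (norm q)\<^sup>2 / (1 + (norm q)\<^sup>2)"
    by (simp add: radial_def power_mult_distrib divide_inverse power_inverse)
  then show ?thesis using p by (simp add: field_simps)
qed

lemma unradial_radial: "unradial (radial q) = q"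
proof -
  have p: "0 < 1 + (norm q)\<^sup>2" by (simp add: add_pos_nonneg)
  have "unradial (radial q) = radial q /\<^sub>R sqrt (1 / (1 + (norm q)\<^sup>2))"
    unfolding unradial_def radial_gap ..
  also have "\<dots> = q" using p by (simp add: radial_def real_sqrt_divide)
  finally show ?thesis .
qed

lemma radial_inject: "radial p = radial q \<longleftrightarrow> p = q"
  by (metis unradial_radial)

text \<open>The limit lies in the open ball, away from fibre infinity, where the inverse
  \<open>unradial\<close> is continuous.\<close>

lemma tendsto_radialD:
  assumes "((\<lambda>k. radial (f k)) \<longlongrightarrow> radial q) F"
  shows "(f \<longlongrightarrow> q) F"
proof -
  have "0 < 1 + (norm q)\<^sup>2" by (simp add: add_pos_nonneg)
  then have "sqrt (1 - (norm (radial q))\<^sup>2) \<noteq> 0" unfolding radial_gap by simp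
  then have "((\<lambda>k. unradial (radial (f k))) \<longlongrightarrow> unradial (radial q)) F"
    unfolding unradial_def by (intro tendsto_intros assms)
  then show ?thesis by (simp add: unradial_radial)
qed

lemma closure_sequential_first_countable:
  fixes S :: "'a::{first_countable_topology,t1_space} set"
  shows "x \<in> closure S \<longleftrightarrow> (\<exists>f. (\<forall>n::nat. f n \<in> S) \<and> f \<longlonglongrightarrow> x)"
proof
  assume "x \<in> closure S"
  then consider "x \<in> S" | "x islimpt S" by (auto simp: closure_def)
  then show "\<exists>f. (\<forall>n::nat. f n \<in> S) \<and> f \<longlonglongrightarrow> x"
  proof cases
    case 1
    then show ?thesis by (intro exI[of _ "\<lambda>n. x"]) auto
  next
    case 2
    then show ?thesis unfolding islimpt_sequential by blast
  qed
next
  assume "\<exists>f. (\<forall>n::nat. f n \<in> S) \<and> f \<longlonglongrightarrow> x"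
  then obtain f where f: "\<forall>n::nat. f n \<in> S" "f \<longlonglongrightarrow> x" by blast
  show "x \<in> closure S"
    by (rule Lim_in_closed_set[OF closed_closure always_eventually _ f(2)])
      (use f(1) closure_subset[of S] in auto)
qed

lemma coords_neg:
  "bdf (fst w, - snd w) = bdf w" "angle (fst w, - snd w) = angle w"
  "xi_1c (fst w, - snd w) = - xi_1c w" "eta_1c (fst w, - snd w) = - eta_1c w"
  by (simp_all add: bdf_def angle_def xi_1c_def eta_1c_def)

text \<open>The pair \<open>v\<close> is the value of the scattering map on \<open>w\<close>, with \<open>b = bdf w\<close> and \<open>\<xi> = xi_1c w\<close>, when the
  rescaled ray is outgoing at time \<open>r\<close> with position \<open>z\<close> and momentum \<open>\<theta>\<close>.\<close>

lemma outgoing_coords: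
  fixes z \<theta> :: "real^'n" and r \<xi> :: real
  assumes b: "0 < b" and \<theta>: "\<theta> \<noteq> 0"
  defines "v \<equiv> (\<theta> /\<^sub>R b, (r - \<xi> / b) *\<^sub>R \<theta> - z)" and "y \<equiv> \<theta> /\<^sub>R norm \<theta>"
  shows "fst v \<noteq> 0" "bdf v = b / norm \<theta>" "angle v = y"
    "xi_1c v = \<xi> - b * r + b / norm \<theta> * (z \<bullet> y)"
    "eta_1c v = - (z - (z \<bullet> y) *\<^sub>R y)"
    "(xi_1c v - \<xi>) / bdf v = z \<bullet> y - r * norm \<theta>"
proof -
  show "fst v \<noteq> 0" using b \<theta> by (simp add: v_def)
  show bdf: "bdf v = b / norm \<theta>" using b by (simp add: bdf_def v_def divide_inverse)
  show ang: "angle v = y"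
    using b by (simp add: angle_def v_def y_def field_simps)
  have \<theta>y: "\<theta> = norm \<theta> *\<^sub>R y" and yy: "y \<bullet> y = 1"
    using \<theta> by (simp_all add: y_def dot_square_norm power2_eq_square)
  have dot: "snd v \<bullet> y = (r - \<xi> / b) * norm \<theta> - z \<bullet> y"
    by (subst v_def, subst \<theta>y) (simp add: inner_diff_left yy)
  show xi: "xi_1c v = \<xi> - b * r + b / norm \<theta> * (z \<bullet> y)"
    unfolding xi_1c_def bdf ang dot using b \<theta> by (simp add: field_simps)
  have "snd v = ((r - \<xi> / b) * norm \<theta>) *\<^sub>R y - z"
    by (subst v_def, subst (1) \<theta>y) simp
  then show "eta_1c v = - (z - (z \<bullet> y) *\<^sub>R y)"
    unfolding eta_1c_def ang dot by (simp add: algebra_simps)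
  show "(xi_1c v - \<xi>) / bdf v = z \<bullet> y - r * norm \<theta>"
    unfolding xi bdf using b \<theta> by (simp add: field_simps)
qed

text \<open>The graph is parametrised by incoming data; the twist appears as the reversed covector
  in the right factor.\<close>

definition graph_point :: "(real \<Rightarrow> real^'n \<Rightarrow> real^'n^'n) \<Rightarrow> (real^'n) \<times> (real^'n) \<Rightarrow> 'n lens_1c \<times> ereal" where
  "graph_point g w = (\<lambda>q. (lift_b q, ereal (N1 q))) (scattering_map g w, (fst w, - snd w))"

definition boundary_point ::
  "real \<Rightarrow> real^'n \<Rightarrow> real^'n \<Rightarrow> real^'n \<Rightarrow> real^'n \<Rightarrow> real \<Rightarrow> 'n lens_1c \<times> ereal" where
  "boundary_point t z0 y0 z1 y1 l =
     (((0, y1, radial (- 2 * t, - (z1 - (z1 \<bullet> y1) *\<^sub>R y1))),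
       (0, y0, radial (2 * t, z0 - (z0 \<bullet> y0) *\<^sub>R y0)), 1),
      ereal (z1 \<bullet> y1 - z0 \<bullet> y0 - l))"

context perturbed_metric
begin

lemma metric_outside: "R \<le> norm z \<Longrightarrow> matrix_inv (g t z) = mat 1"
  using A_outside[of "(t, z)"] by (simp add: A_def G_def)

lemma inward_iff:
  "(z, v) \<in> inward_unit_covectors (g t) R \<longleftrightarrow> norm z = R \<and> norm v = 1 \<and> z \<bullet> v < 0"
  by (auto simp: inward_unit_covectors_def metric_outside norm_eq_1 inner_commute)

text \<open>At r = - R the states of the rays, including time and \<epsilon>, converge to that of
  the geodesic with \<epsilon> = 0. The unit incoming momenta give one dependence constant for the
  whole sequence.\<close>

lemma incoming_tendsto:
  assumes c: "ham 0 t c \<theta>" "c (- R) = (- R) *\<^sub>R y - \<eta>" "\<theta> (- R) = y"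
    and w: "\<And>k::nat. fst (w k) \<noteq> 0" "\<And>k. incoming (w k) (zs k) (\<theta>s k)"
    and lim: "(\<lambda>k. bdf (w k)) \<longlonglongrightarrow> 0" "(\<lambda>k. angle (w k)) \<longlonglongrightarrow> y"
      "(\<lambda>k. xi_1c (w k)) \<longlonglongrightarrow> - 2 * t" "(\<lambda>k. eta_1c (w k)) \<longlonglongrightarrow> \<eta>"
  shows "(\<lambda>k. zs k r) \<longlonglongrightarrow> c r" "(\<lambda>k. \<theta>s k r) \<longlonglongrightarrow> \<theta> r"
proof -
  have na: "norm (angle (w k)) = 1" for k using norm_angle[OF w(1)] .
  have ny: "norm y = 1"
    using LIMSEQ_unique[OF tendsto_norm[OF lim(2)], of 1] na by simp
  obtain L where L: "\<forall>\<epsilon> \<epsilon>' t0 t0' z z' \<theta> \<theta>' r s. 0 \<le> \<epsilon> \<longrightarrow> 0 \<le> \<epsilon>' \<longrightarrow> ham \<epsilon> t0 z \<theta> \<longrightarrow> ham \<epsilon>' t0' z' \<theta>' \<longrightarrow>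
     norm (\<theta> s) \<le> 1 \<longrightarrow> norm (\<theta>' s) \<le> 1 \<longrightarrow>
     norm ((z r, \<theta> r) - (z' r, \<theta>' r)) \<le>
       norm ((z s, \<theta> s, t0 + \<epsilon> * s, \<epsilon>) - (z' s, \<theta>' s, t0' + \<epsilon>' * s, \<epsilon>')) * exp (L * \<bar>r - s\<bar>)"
    using ham_dependence[of 1] ..
  define D where "D k = (((- R) *\<^sub>R angle (w k) - eta_1c (w k), angle (w k),
        - xi_1c (w k) / 2 + bdf (w k) / 2 * (- R), bdf (w k) / 2) - ((- R) *\<^sub>R y - \<eta>, y, t + 0 * (- R), 0))" for k
  have "(\<lambda>k. D k) \<longlonglongrightarrow> (((- R) *\<^sub>R y - \<eta>, y, - (- 2 * t) / 2 + 0 / 2 * (- R), 0 / 2) - ((- R) *\<^sub>R y - \<eta>, y, t + 0 * (- R), 0))"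
    unfolding D_def by (intro tendsto_intros lim) auto
  then have "(\<lambda>k. norm (D k) * exp (L * \<bar>r - (- R)\<bar>)) \<longlonglongrightarrow> norm (0 :: (real^'n) \<times> (real^'n) \<times> real \<times> real) * exp (L * \<bar>r - (- R)\<bar>)"
    by (intro tendsto_intros) (simp add: zero_prod_def)
  then have lim0: "(\<lambda>k. norm (D k) * exp (L * \<bar>r - (- R)\<bar>)) \<longlonglongrightarrow> 0" by simp
  have bound: "norm ((zs k r, \<theta>s k r) - (c r, \<theta> r)) \<le> norm (D k) * exp (L * \<bar>r - (- R)\<bar>)" for k
  proof -
    have h: "ham (bdf (w k) / 2) (- xi_1c (w k) / 2) (zs k) (\<theta>s k)"
      and z: "zs k (- R) = (- R) *\<^sub>R angle (w k) - eta_1c (w k)" and th: "\<theta>s k (- R) = angle (w k)"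
      using w(2)[of k] unfolding incoming_def by blast+
    have b: "0 \<le> bdf (w k) / 2" by (simp add: bdf_def)
    have n: "norm (\<theta>s k (- R)) \<le> 1" "norm (\<theta> (- R)) \<le> 1" using na ny by (simp_all add: th c(3))
    show ?thesis
      using L[rule_format, OF b order_refl h c(1) n, of r] unfolding z th c(2,3) D_def .
  qed
  have "(\<lambda>k. (zs k r, \<theta>s k r) - (c r, \<theta> r)) \<longlonglongrightarrow> 0"
    by (rule Lim_null_comparison[OF _ lim0]) (use bound in simp)
  then have "(\<lambda>k. (zs k r, \<theta>s k r)) \<longlonglongrightarrow> (c r, \<theta> r)" by (rule LIM_zero_cancel)
  from tendsto_fst[OF this] tendsto_snd[OF this]
  show "(\<lambda>k. zs k r) \<longlonglongrightarrow> c r" "(\<lambda>k. \<theta>s k r) \<longlonglongrightarrow> \<theta> r" by simp_all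
qed

text \<open>The exit data are chosen before the sequence. This uniformity allows the statement to be
  applied both to an explicit sequence and to one about which only convergence is known.\<close>

lemma scattering_limit:
  assumes nt: "nontrapping (g t)" and z0: "norm z0 = R" and y0: "norm y0 = 1" "z0 \<bullet> y0 < 0"
  obtains z1 y1 where "norm z1 = R" "norm y1 = 1" "0 \<le> z1 \<bullet> y1"
    "\<And>w. (\<And>k::nat. fst (w k) \<noteq> 0) \<Longrightarrow> (\<lambda>k. bdf (w k)) \<longlonglongrightarrow> 0 \<Longrightarrow> (\<lambda>k. angle (w k)) \<longlonglongrightarrow> y0 \<Longrightarrow>
       (\<lambda>k. xi_1c (w k)) \<longlonglongrightarrow> - 2 * t \<Longrightarrow> (\<lambda>k. eta_1c (w k)) \<longlonglongrightarrow> - (z0 - (z0 \<bullet> y0) *\<^sub>R y0) \<Longrightarrow>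
       (\<forall>\<^sub>F k in sequentially. fst (scattering_map g (w k)) \<noteq> 0) \<and>
       (\<lambda>k. graph_point g (w k)) \<longlonglongrightarrow> boundary_point t z0 y0 z1 y1 (lens_length (g t) R (z0, y0))"
proof -
  define c where "c = geodesic_from (g t) z0 y0"
  obtain \<theta> where h: "ham 0 t c \<theta>" "c 0 = z0" "\<theta> 0 = y0"
    using geodesic_from_ham[of t z0 y0] unfolding c_def by blast
  define l where "l = exit_time R c"
  note exit = geodesic_exit[OF nt z0 y0 h[unfolded c_def], folded c_def, folded l_def]
  define z1 where "z1 = c l"
  define y1 where "y1 = \<theta> l"
  have len: "lens_length (g t) R (z0, y0) = l"
    using exit(4) by (simp add: lens_length_def inward_iff z0 y0 c_def[symmetric] l_def[symmetric])
  \<comment> \<open>The incoming line is parametrised from its closest approach to the origin, so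
    \<open>z0\<close> is reached at r = - b, whereas the geodesic starts there at 0. As b is at most
    R, the reference time - R does not come after the entry.\<close>
  define b where "b = - (z0 \<bullet> y0)"
  define \<eta> where "\<eta> = - (z0 - (z0 \<bullet> y0) *\<^sub>R y0)"
  have b: "0 < b" "b \<le> R"
    using y0 z0 Cauchy_Schwarz_ineq2[of z0 y0] by (auto simp: b_def)
  define C where "C r = c (r + b)" for r
  define \<Theta> where "\<Theta> r = \<theta> (r + b)" for r
  have hC: "ham 0 t C \<Theta>"
    unfolding ham_def
  proof
    fix r
    have "ham_at 0 t c \<theta> (1 * r + b)" using h(1) unfolding ham_def ..
    then show "ham_at 0 t C \<Theta> r"
      unfolding ham_at_def C_def[abs_def] \<Theta>_def[abs_def]
      using has_vector_derivative_affine[of c _ 1 r b] has_vector_derivative_affine[of \<theta> _ 1 r b] by simp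
  qed
  have C0: "C (- R) = (- R) *\<^sub>R y0 - \<eta>" "\<Theta> (- R) = y0"
  proof -
    have "0 \<le> (- R + b - 0) * (c 0 \<bullet> \<theta> 0)" using b y0 h by (simp add: mult_nonpos_nonpos)
    moreover have "R \<le> norm (c 0)" using h z0 by simp
    ultimately show "C (- R) = (- R) *\<^sub>R y0 - \<eta>" "\<Theta> (- R) = y0"
      using ham_free[OF order_refl h(1), of 0 "- R + b"] h by (simp_all add: C_def \<Theta>_def \<eta>_def b_def algebra_simps)
  qed
  \<comment> \<open>The exit happens at l - b. There the distance is exactly R and the motion may be
    tangential; after a further distance R both inequalities are strict and hold for nearby rays
    too.\<close>
  define r1 where "r1 = l - b + R"
  have C1: "C r1 = z1 + R *\<^sub>R y1" "\<Theta> r1 = y1"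
    using ham_free[OF order_refl h(1), of l "l + R"] exit R_pos
    by (simp_all add: C_def \<Theta>_def r1_def z1_def y1_def)
  have yy: "y1 \<bullet> y1 = 1" and zy: "0 \<le> z1 \<bullet> y1" and nz: "norm z1 = R" and ny: "norm y1 = 1"
    using exit by (simp_all add: y1_def z1_def norm_eq_1)
  have pos: "0 < C r1 \<bullet> \<Theta> r1" using R_pos zy by (simp add: C1 inner_add_left yy)
  have big: "R < norm (C r1)"
  proof -
    have "(norm (C r1))\<^sup>2 = R\<^sup>2 + 2 * R * (z1 \<bullet> y1) + R\<^sup>2"
    proof -
      have "z1 \<bullet> z1 = R * R" using nz by (simp add: power2_eq_square flip: power2_norm_eq_inner)
      then show ?thesis
        unfolding C1 power2_norm_eq_inner
        by (simp add: inner_add_left inner_add_right inner_commute[of y1 z1] yy power2_eq_square algebra_simps)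
    qed
    then have "R\<^sup>2 < (norm (C r1))\<^sup>2"
      using zero_less_power[OF R_pos, of 2] mult_nonneg_nonneg[OF less_imp_le[OF R_pos] zy] by linarith
    then show ?thesis by (rule power2_less_imp_less) simp
  qed
  have "(\<forall>\<^sub>F k in sequentially. fst (scattering_map g (w k)) \<noteq> 0) \<and>
      (\<lambda>k. graph_point g (w k)) \<longlonglongrightarrow> boundary_point t z0 y0 z1 y1 l"
    if w: "\<And>k::nat. fst (w k) \<noteq> 0"
      and lim: "(\<lambda>k. bdf (w k)) \<longlonglongrightarrow> 0" "(\<lambda>k. angle (w k)) \<longlonglongrightarrow> y0"
        "(\<lambda>k. xi_1c (w k)) \<longlonglongrightarrow> - 2 * t" "(\<lambda>k. eta_1c (w k)) \<longlonglongrightarrow> - (z0 - (z0 \<bullet> y0) *\<^sub>R y0)"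
    for w
  proof -
    have "\<forall>k. \<exists>zs \<theta>s. incoming (w k) zs \<theta>s" using incoming_exists by blast
    then obtain zs \<theta>s where i: "\<And>k. incoming (w k) (zs k) (\<theta>s k)" by metis
    define z where "z k = zs k r1" for k
    define th where "th k = \<theta>s k r1" for k
    note lims = incoming_tendsto[OF hC C0 w i lim(1-3) lim(4)[folded \<eta>_def], of r1]
    have limz: "z \<longlonglongrightarrow> C r1" and limth: "th \<longlonglongrightarrow> y1"
      using lims by (simp_all add: z_def[abs_def] th_def[abs_def] C1)
    have "\<forall>\<^sub>F k in sequentially. R < norm (z k)"
      by (rule order_tendstoD(1)[OF tendsto_norm[OF limz] big])
    moreover have "\<forall>\<^sub>F k in sequentially. 0 < z k \<bullet> th k"
      by (rule order_tendstoD(1)[OF tendsto_inner[OF limz limth]]) (use pos C1 in simp)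
    ultimately have good: "\<forall>\<^sub>F k in sequentially. R < norm (z k) \<and> 0 < z k \<bullet> th k"
      by (rule eventually_conj)
    define y where "y k = th k /\<^sub>R norm (th k)" for k
    define v where "v k = (th k /\<^sub>R bdf (w k), (r1 - xi_1c (w k) / bdf (w k)) *\<^sub>R th k - z k)" for k
    have bw: "0 < bdf (w k)" for k using w by (simp add: bdf_def)
    have sc: "scattering_map g (w k) = v k" if "R < norm (z k) \<and> 0 < z k \<bullet> th k" for k
      using scattering_map_eq[OF i w, of k r1] that by (simp add: v_def z_def th_def)
    have th0: "th k \<noteq> 0" if "R < norm (z k) \<and> 0 < z k \<bullet> th k" for k using that by auto
    define P where "P k = (((bdf (w k) / norm (th k), y k,
          radial (xi_1c (w k) - bdf (w k) * r1 + bdf (w k) / norm (th k) * (z k \<bullet> y k), - (z k - (z k \<bullet> y k) *\<^sub>R y k))),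
        (bdf (w k), angle (w k), radial (- xi_1c (w k), - eta_1c (w k))), ereal (1 / norm (th k))),
        ereal (z k \<bullet> y k - r1 * norm (th k)))" for k
    have P: "graph_point g (w k) = P k" if "R < norm (z k) \<and> 0 < z k \<bullet> th k" for k
    proof -
      note oc = outgoing_coords[OF bw th0[OF that], of k r1 "xi_1c (w k)" "z k", folded v_def y_def]
      have ratio: "bdf (v k) / bdf (w k) = 1 / norm (th k)" unfolding oc(2) using bw[of k] by simp
      have "N1 (v k, (fst (w k), - snd (w k))) = z k \<bullet> y k - r1 * norm (th k)"
        unfolding N1_def prod.case coords_neg add_uminus_conv_diff by (rule oc(6))
      moreover have "lift_b (v k, (fst (w k), - snd (w k))) = fst (P k)"
        unfolding lift_b_def prod.case coords_1c_def coords_neg ratio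
        by (simp only: oc(2-5) P_def fst_conv)
      ultimately show ?thesis
        by (simp add: graph_point_def sc[OF that] P_def)
    qed
    have limn: "(\<lambda>k. norm (th k)) \<longlonglongrightarrow> 1" using tendsto_norm[OF limth] ny by simp
    have limy: "y \<longlonglongrightarrow> y1"
      unfolding y_def[abs_def] using tendsto_scaleR[OF tendsto_inverse[OF limn] limth] by simp
    have e1: "C r1 \<bullet> y1 = z1 \<bullet> y1 + R" by (simp add: C1 inner_add_left yy)
    have e2: "C r1 - (C r1 \<bullet> y1) *\<^sub>R y1 = z1 - (z1 \<bullet> y1) *\<^sub>R y1"
      by (simp add: e1) (simp add: C1 algebra_simps)
    \<comment> \<open>The extra distance R cancels, so the limit of \<open>N1\<close> does not
      depend on where beyond the exit it is read off.\<close>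
    have e3: "C r1 \<bullet> y1 - r1 * 1 = z1 \<bullet> y1 - z0 \<bullet> y0 - l"
      unfolding e1 by (simp add: r1_def b_def)
    have "P \<longlonglongrightarrow> (((0 / 1, y1, radial (- 2 * t - 0 * r1 + 0 / 1 * (C r1 \<bullet> y1), - (C r1 - (C r1 \<bullet> y1) *\<^sub>R y1))),
        (0, y0, radial (- (- 2 * t), - (- (z0 - (z0 \<bullet> y0) *\<^sub>R y0)))), ereal (1 / 1)), ereal (C r1 \<bullet> y1 - r1 * 1))"
      unfolding P_def[abs_def]
      by (intro tendsto_Pair tendsto_radial tendsto_ereal tendsto_intros lim limn limy limz) simp_all
    also have "(((0 / 1, y1, radial (- 2 * t - 0 * r1 + 0 / 1 * (C r1 \<bullet> y1), - (C r1 - (C r1 \<bullet> y1) *\<^sub>R y1))),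
        (0, y0, radial (- (- 2 * t), - (- (z0 - (z0 \<bullet> y0) *\<^sub>R y0)))), ereal (1 / 1)), ereal (C r1 \<bullet> y1 - r1 * 1)) =
        boundary_point t z0 y0 z1 y1 l"
      unfolding e2 e3 by (simp add: boundary_point_def one_ereal_def)
    finally have "P \<longlonglongrightarrow> boundary_point t z0 y0 z1 y1 l" .
    moreover have "\<forall>\<^sub>F k in sequentially. P k = graph_point g (w k)"
      using good by (rule eventually_mono) (simp add: P)
    ultimately have "(\<lambda>k. graph_point g (w k)) \<longlonglongrightarrow> boundary_point t z0 y0 z1 y1 l"
      by (rule Lim_transform_eventually)
    moreover have "\<forall>\<^sub>F k in sequentially. fst (scattering_map g (w k)) \<noteq> 0"
      using good
    proof (rule eventually_mono)
      fix k assume k: "R < norm (z k) \<and> 0 < z k \<bullet> th k"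
      show "fst (scattering_map g (w k)) \<noteq> 0"
        using th0[OF k] bw[of k] unfolding sc[OF k] v_def by simp
    qed
    ultimately show ?thesis by blast
  qed
  then show ?thesis using that[of z1 y1] nz ny zy len by simp
qed

end

section \<open>From points of the boundary lift to lengths\<close>

lemma boundary_lift_sequential:
  "P \<in> boundary_lift g \<longleftrightarrow> over_front_face (fst P) \<and>
     (\<exists>w. (\<forall>k::nat. fst (w k) \<noteq> 0 \<and> fst (scattering_map g (w k)) \<noteq> 0) \<and> (\<lambda>k. graph_point g (w k)) \<longlonglongrightarrow> P)"
  (is "_ \<longleftrightarrow> _ \<and> ?seq")
proof -
  define S where "S = (\<lambda>q. (lift_b q, ereal (N1 q))) `
       {(w1, w2) \<in> twisted_graph g. fst w1 \<noteq> 0 \<and> fst w2 \<noteq> 0}"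
  have S: "x \<in> S \<longleftrightarrow> (\<exists>w. fst w \<noteq> 0 \<and> fst (scattering_map g w) \<noteq> 0 \<and> x = graph_point g w)" for x
  proof
    assume "x \<in> S"
    then obtain w2 where w: "x = (\<lambda>q. (lift_b q, ereal (N1 q))) (scattering_map g (fst w2, - snd w2), w2)"
      "fst w2 \<noteq> 0" "fst (scattering_map g (fst w2, - snd w2)) \<noteq> 0"
      by (auto simp: S_def twisted_graph_def)
    then show "\<exists>w. fst w \<noteq> 0 \<and> fst (scattering_map g w) \<noteq> 0 \<and> x = graph_point g w"
      by (intro exI[of _ "(fst w2, - snd w2)"]) (simp add: graph_point_def)
  next
    assume "\<exists>w. fst w \<noteq> 0 \<and> fst (scattering_map g w) \<noteq> 0 \<and> x = graph_point g w"
    then show "x \<in> S"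
      unfolding S_def graph_point_def by (force simp: twisted_graph_def)
  qed
  have "P \<in> closure S \<longleftrightarrow> ?seq"
    unfolding closure_sequential_first_countable S
  proof
    assume "\<exists>f. (\<forall>n. \<exists>w. fst w \<noteq> 0 \<and> fst (scattering_map g w) \<noteq> 0 \<and> f n = graph_point g w) \<and> f \<longlonglongrightarrow> P"
    then obtain f w where "\<forall>n. fst (w n) \<noteq> 0 \<and> fst (scattering_map g (w n)) \<noteq> 0 \<and> f n = graph_point g (w n)" "f \<longlonglongrightarrow> P"
      by metis
    moreover from this have "f = (\<lambda>n. graph_point g (w n))" by blast
    ultimately show ?seq by blast
  next
    assume ?seq
    then obtain w where "\<forall>k::nat. fst (w k) \<noteq> 0 \<and> fst (scattering_map g (w k)) \<noteq> 0"
      "(\<lambda>k. graph_point g (w k)) \<longlonglongrightarrow> P" by auto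
    then show "\<exists>f. (\<forall>n. \<exists>w. fst w \<noteq> 0 \<and> fst (scattering_map g w) \<noteq> 0 \<and> f n = graph_point g w) \<and> f \<longlonglongrightarrow> P"
      by (intro exI[of _ "\<lambda>k. graph_point g (w k)"] conjI allI) (blast, assumption)
  qed
  then show ?thesis
    by (auto simp: boundary_lift_def S_def[symmetric] case_prod_beta)
qed

text \<open>All incoming data are read off the right factor, whose fibre coordinate has its limit at
  a finite point.\<close>

lemma graph_point_tendstoD:
  assumes "((\<lambda>k. graph_point g (w k)) \<longlongrightarrow> boundary_point t z0 y0 z1 y1 l) F"
  shows "((\<lambda>k. bdf (w k)) \<longlongrightarrow> 0) F" "((\<lambda>k. angle (w k)) \<longlongrightarrow> y0) F"
    "((\<lambda>k. xi_1c (w k)) \<longlongrightarrow> - 2 * t) F" "((\<lambda>k. eta_1c (w k)) \<longlongrightarrow> - (z0 - (z0 \<bullet> y0) *\<^sub>R y0)) F"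
proof -
  have "((\<lambda>k. (bdf (w k), angle (w k), radial (- xi_1c (w k), - eta_1c (w k)))) \<longlongrightarrow>
      (0, y0, radial (2 * t, z0 - (z0 \<bullet> y0) *\<^sub>R y0))) F"
    using tendsto_fst[OF tendsto_snd[OF tendsto_fst[OF assms]]]
    by (simp add: graph_point_def lift_b_def coords_1c_def coords_neg boundary_point_def)
  note 1 = tendsto_fst[OF this] tendsto_fst[OF tendsto_snd[OF this]] tendsto_snd[OF tendsto_snd[OF this]]
  show "((\<lambda>k. bdf (w k)) \<longlongrightarrow> 0) F" "((\<lambda>k. angle (w k)) \<longlongrightarrow> y0) F" using 1 by simp_all
  have "((\<lambda>k. (- xi_1c (w k), - eta_1c (w k))) \<longlongrightarrow> (2 * t, z0 - (z0 \<bullet> y0) *\<^sub>R y0)) F"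
    by (rule tendsto_radialD) (use 1(3) in simp)
  from tendsto_minus[OF tendsto_fst[OF this]] tendsto_minus[OF tendsto_snd[OF this]]
  show "((\<lambda>k. xi_1c (w k)) \<longlongrightarrow> - 2 * t) F" "((\<lambda>k. eta_1c (w k)) \<longlongrightarrow> - (z0 - (z0 \<bullet> y0) *\<^sub>R y0)) F" by simp_all
qed

lemma boundary_point_length:
  assumes "boundary_point t z0 y0 z1 y1 l = boundary_point t z0 y0 z1' y1' l'"
    and "norm z1 = norm z1'" "norm y1 = 1" "0 \<le> z1 \<bullet> y1" "0 \<le> z1' \<bullet> y1'"
  shows "l = l'"
proof -
  have y: "y1 = y1'" and p: "z1 - (z1 \<bullet> y1) *\<^sub>R y1 = z1' - (z1' \<bullet> y1') *\<^sub>R y1'"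
    and N: "z1 \<bullet> y1 - l = z1' \<bullet> y1' - l'"
    using assms(1)
    unfolding boundary_point_def prod.inject radial_inject neg_equal_iff_equal ereal.inject
    by (blast, blast, linarith)
  have split: "(norm z)\<^sup>2 = (z \<bullet> y1)\<^sup>2 + (norm (z - (z \<bullet> y1) *\<^sub>R y1))\<^sup>2" for z
  proof -
    have "y1 \<bullet> y1 = 1" using assms(3) by (simp add: norm_eq_1)
    then have "(norm ((z \<bullet> y1) *\<^sub>R y1 - ((z \<bullet> y1) *\<^sub>R y1 - z)))\<^sup>2 = (z \<bullet> y1)\<^sup>2 + (norm ((z \<bullet> y1) *\<^sub>R y1 - z))\<^sup>2"
      using assms(3) by (intro norm_orthogonal_diff) (auto simp: inner_diff_left)
    then show ?thesis by (simp add: norm_minus_commute)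
  qed
  have "(z1 \<bullet> y1)\<^sup>2 = (z1' \<bullet> y1)\<^sup>2"
    using split[of z1] split[of z1'] assms(2) p y by simp
  then have "z1 \<bullet> y1 = z1' \<bullet> y1'" using assms(4,5) y by (simp add: power2_eq_iff_nonneg)
  then show ?thesis using N by simp
qed

theorem theorem9p3:
  fixes g1 g2 :: "real \<Rightarrow> real^'n \<Rightarrow> real^'n^'n" and R T :: real
  assumes "0 < R"
    and "smooth_metric_family g1" and "smooth_metric_family g2"
    and "\<And>t. nontrapping (g1 t)" and "\<And>t. nontrapping (g2 t)"
    and "\<And>t z. norm z \<ge> R \<or> \<bar>t\<bar> \<ge> T \<Longrightarrow> g1 t z = mat 1"
    and "\<And>t z. norm z \<ge> R \<or> \<bar>t\<bar> \<ge> T \<Longrightarrow> g2 t z = mat 1"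
    and "microlocally_lens_equivalent g1 g2"
  shows "\<forall>t. lens_length (g1 t) R = lens_length (g2 t) R"
proof
  fix t
  interpret m1: perturbed_metric g1 R T using assms by unfold_locales auto
  interpret m2: perturbed_metric g2 R T using assms by unfold_locales auto
  have inward: "inward_unit_covectors (g1 t) R = inward_unit_covectors (g2 t) R"
    by (auto simp: m1.inward_iff m2.inward_iff)
  have "lens_length (g1 t) R (z0, y0) = lens_length (g2 t) R (z0, y0)" for z0 y0
  proof (cases "(z0, y0) \<in> inward_unit_covectors (g1 t) R")
    \<comment> \<open>Outside the common domain both restricted functions take the same default
      value.\<close>
    case False
    then show ?thesis using inward by (simp add: lens_length_def)
  next
    case True
    then have z0: "norm z0 = R" and y0: "norm y0 = 1" "z0 \<bullet> y0 < 0" by (auto simp: m1.inward_iff)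
    obtain z1 y1 where 1: "norm z1 = R" "norm y1 = 1" "0 \<le> z1 \<bullet> y1"
      "\<And>w. (\<And>k::nat. fst (w k) \<noteq> 0) \<Longrightarrow> (\<lambda>k. bdf (w k)) \<longlonglongrightarrow> 0 \<Longrightarrow> (\<lambda>k. angle (w k)) \<longlonglongrightarrow> y0 \<Longrightarrow>
       (\<lambda>k. xi_1c (w k)) \<longlonglongrightarrow> - 2 * t \<Longrightarrow> (\<lambda>k. eta_1c (w k)) \<longlonglongrightarrow> - (z0 - (z0 \<bullet> y0) *\<^sub>R y0) \<Longrightarrow>
       (\<forall>\<^sub>F k in sequentially. fst (scattering_map g1 (w k)) \<noteq> 0) \<and>
       (\<lambda>k. graph_point g1 (w k)) \<longlonglongrightarrow> boundary_point t z0 y0 z1 y1 (lens_length (g1 t) R (z0, y0))"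
      using m1.scattering_limit[OF assms(4) z0 y0] by metis
    obtain z1' y1' where 2: "norm z1' = R" "norm y1' = 1" "0 \<le> z1' \<bullet> y1'"
      "\<And>w. (\<And>k::nat. fst (w k) \<noteq> 0) \<Longrightarrow> (\<lambda>k. bdf (w k)) \<longlonglongrightarrow> 0 \<Longrightarrow> (\<lambda>k. angle (w k)) \<longlonglongrightarrow> y0 \<Longrightarrow>
       (\<lambda>k. xi_1c (w k)) \<longlonglongrightarrow> - 2 * t \<Longrightarrow> (\<lambda>k. eta_1c (w k)) \<longlonglongrightarrow> - (z0 - (z0 \<bullet> y0) *\<^sub>R y0) \<Longrightarrow>
       (\<forall>\<^sub>F k in sequentially. fst (scattering_map g2 (w k)) \<noteq> 0) \<and>
       (\<lambda>k. graph_point g2 (w k)) \<longlonglongrightarrow> boundary_point t z0 y0 z1' y1' (lens_length (g2 t) R (z0, y0))"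
      using m2.scattering_limit[OF assms(5) z0 y0] by metis
    let ?P = "boundary_point t z0 y0 z1 y1 (lens_length (g1 t) R (z0, y0))"
    \<comment> \<open>The free motion of w k at time s is at 2 (s - t) (k + 1) y0 + z0. It passes
      through \<open>z0\<close> at time t in direction \<open>y0\<close>, ever faster as k
      grows.\<close>
    define w where "w k = (real (Suc k) *\<^sub>R y0, (2 * t * real (Suc k)) *\<^sub>R y0 - z0)" for k
    have wb: "bdf (w k) = 1 / real (Suc k)" for k using y0 by (simp add: bdf_def w_def)
    have wa: "angle (w k) = y0" for k using y0 by (simp add: angle_def w_def)
    have ws: "snd (w k) \<bullet> y0 = 2 * t * real (Suc k) - z0 \<bullet> y0" for k
      using y0 by (simp add: w_def inner_diff_left norm_eq_1)
    have wx: "xi_1c (w k) = - 2 * t + 1 / real (Suc k) * (z0 \<bullet> y0)" for k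
      unfolding xi_1c_def wb wa ws by (simp add: field_simps)
    have we: "eta_1c (w k) = - (z0 - (z0 \<bullet> y0) *\<^sub>R y0)" for k
      unfolding eta_1c_def wa ws by (simp add: w_def algebra_simps)
    have w0: "fst (w k) \<noteq> 0" for k using y0 by (auto simp: w_def)
    have inv: "(\<lambda>k. 1 / real (Suc k)) \<longlonglongrightarrow> 0"
      using LIMSEQ_inverse_real_of_nat by (simp add: inverse_eq_divide)
    have "(\<lambda>k. xi_1c (w k)) \<longlonglongrightarrow> - 2 * t + 0 * (z0 \<bullet> y0)"
      unfolding wx by (intro tendsto_intros inv)
    then have wx': "(\<lambda>k. xi_1c (w k)) \<longlonglongrightarrow> - 2 * t" by simp
    have wb': "(\<lambda>k. bdf (w k)) \<longlonglongrightarrow> 0" unfolding wb by (rule inv)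
    have wa': "(\<lambda>k. angle (w k)) \<longlonglongrightarrow> y0" unfolding wa by (rule tendsto_const)
    have we': "(\<lambda>k. eta_1c (w k)) \<longlonglongrightarrow> - (z0 - (z0 \<bullet> y0) *\<^sub>R y0)"
      unfolding we by (rule tendsto_const)
    note lim = conjunct1[OF 1(4)[OF w0 wb' wa' wx' we']] conjunct2[OF 1(4)[OF w0 wb' wa' wx' we']]
    \<comment> \<open>The description of the lift asks for nonzero outgoing momentum at every index,
      which is known only eventually; an initial piece of the sequence is dropped.\<close>
    from lim(1) obtain N where N: "\<And>k. N \<le> k \<Longrightarrow> fst (scattering_map g1 (w k)) \<noteq> 0"
      unfolding eventually_sequentially by metis
    have "\<forall>k. fst (w (k + N)) \<noteq> 0 \<and> fst (scattering_map g1 (w (k + N))) \<noteq> 0"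
      using w0 N by simp
    moreover have "over_front_face (fst ?P)" by (simp add: over_front_face_def boundary_point_def)
    ultimately have "?P \<in> boundary_lift g1"
      unfolding boundary_lift_sequential
      using LIMSEQ_ignore_initial_segment[OF lim(2), of N] by (intro conjI exI[of _ "\<lambda>k. w (k + N)"])
    then have "?P \<in> boundary_lift g2"
      using assms(8) by (simp add: microlocally_lens_equivalent_def)
    then have "\<exists>w. (\<forall>k::nat. fst (w k) \<noteq> 0 \<and> fst (scattering_map g2 (w k)) \<noteq> 0) \<and>
        (\<lambda>k. graph_point g2 (w k)) \<longlonglongrightarrow> ?P"
      unfolding boundary_lift_sequential by (rule conjunct2)
    then obtain u where u0: "\<forall>k::nat. fst (u k) \<noteq> 0 \<and> fst (scattering_map g2 (u k)) \<noteq> 0"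
      and u: "(\<lambda>k. graph_point g2 (u k)) \<longlonglongrightarrow> ?P"
      by (elim exE conjE)
    have u1: "fst (u k) \<noteq> 0" for k using u0 by simp
    \<comment> \<open>Nothing is known of u except its limit, but that limit already fixes the
      incoming data, so the limit theorem for \<open>g2\<close> gives it a second
      description.\<close>
    have "(\<lambda>k. graph_point g2 (u k)) \<longlonglongrightarrow> boundary_point t z0 y0 z1' y1' (lens_length (g2 t) R (z0, y0))"
      by (rule conjunct2[OF 2(4)[OF u1 graph_point_tendstoD[OF u]]])
    with u have "?P = boundary_point t z0 y0 z1' y1' (lens_length (g2 t) R (z0, y0))"
      by (rule LIMSEQ_unique)
    from boundary_point_length[OF this _ 1(2,3) 2(3)] 1(1) 2(1) show ?thesis by simp
  qed
  then show "lens_length (g1 t) R = lens_length (g2 t) R" by (auto intro!: ext)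
qed

end
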